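(* Let $G=(V,E)$ be a simple (no self-loops, no parallel edges), undirected, connected graph with $n=|V|$ vertices and $m=|E|$ edges, given by adjacency lists, and let $k\in[2,n]$ be an integer. There is an algorithm that lists every $k$-subtree of $G$ exactly once (each output explicitly as its list of $k-1$ edges) with delay $O(k^2)$, i.e. after having listed one $k$-subtree it lists the next one within $O(k^2)$ time.
   Context: A $k$-subtree of $G$ is an edge subset $T\subseteq E$ with $|T|=k-1$ that is acyclic and connected and whose edges have exactly $k$ distinct endpoints (an acyclic connected subgraph of $G$ with $k$ vertices). An algorithm has delay $t(k)$ if it takes $O(t(k))$ time to list a $k$-subtree after having listed the previous one. Running times are in the standard RAM model. *)

theory Defs
  imports Main
begin

section \<open>Graphs and k-subtrees\<close>

text \<open>An undirected edge is the two-element set of its endpoints, so there are neither self-loops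
  nor parallel edges.\<close>

definition simple_graph :: "'a set \<Rightarrow> 'a set set \<Rightarrow> bool" where
  "simple_graph V E \<longleftrightarrow>
     finite V \<and> (\<forall>e\<in>E. \<exists>u\<in>V. \<exists>v\<in>V. u \<noteq> v \<and> e = {u, v})"

definition connected_on :: "'a set \<Rightarrow> 'a set set \<Rightarrow> bool" where
  "connected_on V E \<longleftrightarrow> (\<forall>u\<in>V. \<forall>v\<in>V. (u, v) \<in> {(x, y). {x, y} \<in> E}\<^sup>*)"

definition is_cycle :: "'a set set \<Rightarrow> 'a list \<Rightarrow> bool" where
  "is_cycle T vs \<longleftrightarrow> 3 \<le> length vs \<and> distinct vs \<and>
     (\<forall>i<length vs. {vs ! i, vs ! (Suc i mod length vs)} \<in> T)"

definition acyclic_edges :: "'a set set \<Rightarrow> bool" where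
  "acyclic_edges T \<longleftrightarrow> (\<nexists>vs. is_cycle T vs)"

definition k_subtree :: "'a set set \<Rightarrow> nat \<Rightarrow> 'a set set \<Rightarrow> bool" where
  "k_subtree E k T \<longleftrightarrow> T \<subseteq> E \<and> card T = k - 1 \<and>
     acyclic_edges T \<and> connected_on (\<Union>T) T \<and> card (\<Union>T) = k"


section \<open>The random access machine\<close>

text \<open>A unit-cost RAM over natural numbers. The registers (of which a program uses only finitely
  many) are kept apart from the memory, so that the input may occupy an initial segment of the
  memory. Subtraction is truncated. The output is a sequence of records: \<open>Write\<close> appends a single
  word to the current record, \<open>Emit\<close> completes it. The machine halts as soon as the program counter
  leaves the program.\<close>

datatype instr =
    Const nat nat
  | Move nat nat
  | Add nat nat nat
  | Sub nat nat nat
  | Mult nat nat nat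
  | Div nat nat nat
  | Load nat nat
  | Store nat nat
  | Jump nat
  | JumpZero nat nat
  | Write nat
  | Emit

record config =
  pc :: nat
  reg :: "nat \<Rightarrow> nat"
  mem :: "nat \<Rightarrow> nat"
  current :: "nat list"
  emitted :: "nat list list"

definition set_reg :: "nat \<Rightarrow> nat \<Rightarrow> config \<Rightarrow> config" where
  "set_reg r x s = s\<lparr>pc := Suc (pc s), reg := (reg s)(r := x)\<rparr>"

fun exec :: "instr \<Rightarrow> config \<Rightarrow> config" where
  "exec (Const r x) s = set_reg r x s"
| "exec (Move r a) s = set_reg r (reg s a) s"
| "exec (Add r a b) s = set_reg r (reg s a + reg s b) s"
| "exec (Sub r a b) s = set_reg r (reg s a - reg s b) s"
| "exec (Mult r a b) s = set_reg r (reg s a * reg s b) s"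
| "exec (Div r a b) s = set_reg r (reg s a div reg s b) s"
| "exec (Load r a) s = set_reg r (mem s (reg s a)) s"
| "exec (Store a r) s = s\<lparr>pc := Suc (pc s), mem := (mem s)(reg s a := reg s r)\<rparr>"
| "exec (Jump l) s = s\<lparr>pc := l\<rparr>"
| "exec (JumpZero r l) s = s\<lparr>pc := (if reg s r = 0 then l else Suc (pc s))\<rparr>"
| "exec (Write r) s = s\<lparr>pc := Suc (pc s), current := current s @ [reg s r]\<rparr>"
| "exec Emit s = s\<lparr>pc := Suc (pc s), current := [], emitted := emitted s @ [current s]\<rparr>"

definition halted :: "instr list \<Rightarrow> config \<Rightarrow> bool" where
  "halted P s \<longleftrightarrow> length P \<le> pc s"

definition step :: "instr list \<Rightarrow> config \<Rightarrow> config" where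
  "step P s = (if halted P s then s else exec (P ! pc s) s)"

definition run :: "instr list \<Rightarrow> config \<Rightarrow> nat \<Rightarrow> config" where
  "run P s t = (step P ^^ t) s"

definition emits_at :: "instr list \<Rightarrow> config \<Rightarrow> nat \<Rightarrow> bool" where
  "emits_at P s t \<longleftrightarrow> \<not> halted P (run P s t) \<and> P ! pc (run P s t) = Emit"

definition delay_at_most :: "instr list \<Rightarrow> config \<Rightarrow> nat \<Rightarrow> bool" where
  "delay_at_most P s d \<longleftrightarrow>
     (\<forall>t t'. t < t' \<and> emits_at P s t \<and> emits_at P s t' \<and>
        (\<forall>u. t < u \<and> u < t' \<longrightarrow> \<not> emits_at P s u) \<longrightarrow> t' - t \<le> d)"

text \<open>Unit cost is only meaningful for numbers that fit into one machine word. As usual, words have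
  logarithmically many bits, that is, all numbers stay polynomial in the size of the input. Since
  addresses are words as well, only polynomially much memory is available; in particular an algorithm
  cannot compute and store the (possibly exponentially many) results before emitting the first one.\<close>

definition words_at_most :: "instr list \<Rightarrow> config \<Rightarrow> nat \<Rightarrow> bool" where
  "words_at_most P s w \<longleftrightarrow> (\<forall>t a. reg (run P s t) a \<le> w \<and> mem (run P s t) a \<le> w)"


section \<open>Input and output\<close>

text \<open>The vertices are \<open>0, \<dots>, n - 1\<close>; the order within each adjacency list is arbitrary.\<close>

definition adjacency_lists :: "nat set \<Rightarrow> nat set set \<Rightarrow> nat list list \<Rightarrow> bool" where
  "adjacency_lists V E adj \<longleftrightarrow> V = {..<length adj} \<and>
     (\<forall>v<length adj. distinct (adj ! v) \<and> set (adj ! v) = {u. {v, u} \<in> E})"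

text \<open>Memory holds \<open>n\<close>, \<open>k\<close>, a table of \<open>n + 1\<close> addresses, and the adjacency lists one after another.
  The list of vertex \<open>v\<close> starts at the address in cell \<open>2 + v\<close> and ends just before the address in
  cell \<open>3 + v\<close>.\<close>

definition input_words :: "nat list list \<Rightarrow> nat \<Rightarrow> nat list" where
  "input_words adj k =
     [length adj, k] @
     map (\<lambda>v. 3 + length adj + length (concat (take v adj))) [0..<Suc (length adj)] @
     concat adj"

definition initial :: "nat list list \<Rightarrow> nat \<Rightarrow> config" where
  "initial adj k =
     \<lparr>pc = 0, reg = (\<lambda>_. 0),
      mem = (\<lambda>a. if a < length (input_words adj k) then input_words adj k ! a else 0),
      current = [], emitted = []\<rparr>"

text \<open>A record describes an edge set if it consists of the endpoints of its edges, edge by edge,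
  each edge appearing once.\<close>

definition describes :: "nat list \<Rightarrow> nat set set \<Rightarrow> bool" where
  "describes ws T \<longleftrightarrow>
     (\<exists>es. ws = concat (map (\<lambda>(u, v). [u, v]) es) \<and>
       distinct (map (\<lambda>(u, v). {u, v}) es) \<and> set (map (\<lambda>(u, v). {u, v}) es) = T)"

definition lists_exactly_once :: "instr list \<Rightarrow> config \<Rightarrow> nat set set set \<Rightarrow> bool" where
  "lists_exactly_once P s \<T> \<longleftrightarrow>
     (\<exists>t Ts. halted P (run P s t) \<and> current (run P s t) = [] \<and>
       list_all2 describes (emitted (run P s t)) Ts \<and> distinct Ts \<and> set Ts = \<T>)"

end

theory Submission
  imports Defs
begin

text \<open>A tree is grown from its root by taking the next arc from a stack of arcs and either including it,
  which pushes the arcs of the new vertex, or excluding it. As long as \<open>k\<close> vertices can be reached,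
  including greedily leads to a tree within \<open>O(k\<^sup>2)\<close> steps. After a tree has been listed, the search
  resumes at the last inclusion that can be turned into an exclusion. Testing each of the \<open>k - 1\<close>
  inclusions by a separate graph search would take \<open>O(k\<^sup>3)\<close> steps. But since the order is depth-first
  and all later inclusions have failed the test already, the vertices that stay reachable without the
  \<open>j\<close>-th vertex are known (theorem \<open>extensible_at_iff\<close>): the test succeeds if and only if some
  remaining arc leads to the \<open>j\<close>-th vertex or out of the tree. This takes \<open>O(k)\<close> steps after a preparation
  in \<open>O(k\<^sup>2)\<close> steps, in the spirit of the algorithm of Gabow and Myers for spanning trees.

  The vertices are relabelled in such a way that every label but 0 has a smaller neighbour, and a tree
  is rooted at its largest label. Then every root from \<open>k - 1\<close> on has a tree, and no time is lost between
  roots. A table of the next smaller neighbours gives access to the adjacency lists in decreasing order,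
  restricted to the labels below the root.\<close>

section \<open>Structured programs for the machine\<close>

text \<open>The time spent must not depend on vertex degrees. Therefore a neighbour may be passed
  over only if it lies in the current tree; each row holds at most \<open>k\<close> such neighbours,
  and one table lookup leads to the next one. The stack of arcs is never stored: since children are
  taken in decreasing order, \<open>vs\<close>, \<open>ps\<close>, a position \<open>q\<close> and a
  bound \<open>c\<close> determine it (\<open>act\<close>). So the search resumes at position
  \<open>j\<close> from \<open>(ps j, vs j)\<close>, and only the marks of tree vertices have to be
  undone. Cycles never have to be looked for, since they are excluded by counting edges
  (\<open>tree\<close>). Time is proved on the concrete instructions. A structured language carries
  the exact machine time in its states, and an execution that breaks the word bound or the delay
  bound does not exist. Hence it suffices to derive one complete execution with the right output and
  to compile it.\<close>

datatype arith = PLUS | MINUS | TIMES | OVER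

fun arith_val :: "arith \<Rightarrow> nat \<Rightarrow> nat \<Rightarrow> nat" where
  "arith_val PLUS x y = x + y"
| "arith_val MINUS x y = x - y"
| "arith_val TIMES x y = x * y"
| "arith_val OVER x y = x div y"

fun arith_instr :: "arith \<Rightarrow> nat \<Rightarrow> nat \<Rightarrow> nat \<Rightarrow> instr" where
  "arith_instr PLUS = Add"
| "arith_instr MINUS = Sub"
| "arith_instr TIMES = Mult"
| "arith_instr OVER = Div"

datatype com =
    SKIP
  | SET nat nat
  | COPY nat nat
  | OP arith nat nat nat
  | INPUT nat nat
  | GET nat nat nat
  | PUT nat nat nat
  | WRITE nat
  | EMIT
  | SEQ com com (infixr ";;" 60)
  | IF nat com com
  | WHILE nat com

text \<open>\<open>clock\<close> counts machine steps and \<open>latest\<close> is the time of the latest emission. Both are ghost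
  fields without a counterpart in the machine.\<close>

record state =
  regs :: "nat \<Rightarrow> nat"
  arrs :: "nat \<Rightarrow> nat \<Rightarrow> nat"
  line :: "nat list"
  lines :: "nat list list"
  clock :: nat
  latest :: "nat option"

definition tick :: "nat \<Rightarrow> state \<Rightarrow> state" where
  "tick t s = s\<lparr>clock := clock s + t\<rparr>"

definition put_reg :: "nat \<Rightarrow> nat \<Rightarrow> state \<Rightarrow> state" where
  "put_reg r x s = s\<lparr>regs := (regs s)(r := x)\<rparr>"

definition put_arr :: "nat \<Rightarrow> nat \<Rightarrow> nat \<Rightarrow> state \<Rightarrow> state" where
  "put_arr a i x s = s\<lparr>arrs := (arrs s)(a := (arrs s a)(i := x))\<rparr>"

definition put_word :: "nat \<Rightarrow> state \<Rightarrow> state" where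
  "put_word x s = s\<lparr>line := line s @ [x]\<rparr>"

definition put_line :: "state \<Rightarrow> state" where
  "put_line s = s\<lparr>line := [], lines := lines s @ [line s], latest := Some (clock s)\<rparr>"

text \<open>\<open>inp\<close> is the input in the memory cells below \<open>base\<close>, the
  arrays live above it, \<open>wmax\<close> bounds all words and \<open>gap\<close> the number of
  steps between two emissions.\<close>

locale machine =
  fixes inp :: "nat \<Rightarrow> nat" and base wmax gap :: nat
begin

text \<open>Interleaving the 16 arrays makes them disjoint without any bound on the indices.\<close>

definition cell :: "nat \<Rightarrow> nat \<Rightarrow> nat" where
  "cell a i = i * 16 + base + a"

text \<open>A program that would write a word above \<open>wmax\<close>, or let more than \<open>gap\<close> steps pass between two
  emissions, has no execution.\<close>

inductive ev :: "com \<Rightarrow> state \<Rightarrow> state \<Rightarrow> bool" where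
  ev_SKIP: "ev SKIP s s"
| ev_SET: "x \<le> wmax \<Longrightarrow> ev (SET r x) s (tick 1 (put_reg r x s))"
| ev_COPY: "ev (COPY r a) s (tick 1 (put_reg r (regs s a) s))"
| ev_OP: "arith_val f (regs s a) (regs s b) \<le> wmax \<Longrightarrow>
    ev (OP f r a b) s (tick 1 (put_reg r (arith_val f (regs s a) (regs s b)) s))"
| ev_INPUT: "regs s a < base \<Longrightarrow> ev (INPUT r a) s (tick 1 (put_reg r (inp (regs s a)) s))"
| ev_GET: "a < 16 \<Longrightarrow> cell 16 (regs s i) \<le> wmax \<Longrightarrow>
    ev (GET r a i) s (tick 5 (put_reg r (arrs s a (regs s i)) s))"
| ev_PUT: "a < 16 \<Longrightarrow> cell 16 (regs s i) \<le> wmax \<Longrightarrow>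
    ev (PUT a i r) s (tick 5 (put_arr a (regs s i) (regs s r) s))"
| ev_WRITE: "ev (WRITE r) s (tick 1 (put_word (regs s r) s))"
| ev_EMIT: "(\<And>l. latest s = Some l \<Longrightarrow> clock s - l \<le> gap) \<Longrightarrow> ev EMIT s (tick 1 (put_line s))"
| ev_SEQ: "ev c1 s s1 \<Longrightarrow> ev c2 s1 s2 \<Longrightarrow> ev (c1 ;; c2) s s2"
| ev_IF1: "regs s r \<noteq> 0 \<Longrightarrow> ev c1 (tick 1 s) s1 \<Longrightarrow> ev (IF r c1 c2) s (tick 1 s1)"
| ev_IF2: "regs s r = 0 \<Longrightarrow> ev c2 (tick 1 s) s1 \<Longrightarrow> ev (IF r c1 c2) s s1"
| ev_WHILE1: "regs s r \<noteq> 0 \<Longrightarrow> ev c (tick 1 s) s1 \<Longrightarrow> ev (WHILE r c) (tick 1 s1) s2 \<Longrightarrow>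
    ev (WHILE r c) s s2"
| ev_WHILE2: "regs s r = 0 \<Longrightarrow> ev (WHILE r c) s (tick 1 s)"

end

section \<open>Compilation to instructions\<close>

fun code_size :: "com \<Rightarrow> nat" where
  "code_size SKIP = 0"
| "code_size (GET r a i) = 5"
| "code_size (PUT a i r) = 5"
| "code_size (c1 ;; c2) = code_size c1 + code_size c2"
| "code_size (IF r c1 c2) = code_size c1 + code_size c2 + 2"
| "code_size (WHILE r c) = code_size c + 2"
| "code_size _ = 1"

text \<open>Machine registers 1 and 2 hold 16 and the base address of the arrays, 3 and 4 are used for
  address computations.\<close>

fun compile :: "nat \<Rightarrow> com \<Rightarrow> instr list" where
  "compile p SKIP = []"
| "compile p (SET r x) = [Const (r + 5) x]"
| "compile p (COPY r a) = [Move (r + 5) (a + 5)]"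
| "compile p (OP f r a b) = [arith_instr f (r + 5) (a + 5) (b + 5)]"
| "compile p (INPUT r a) = [Load (r + 5) (a + 5)]"
| "compile p (GET r a i) = [Mult 3 (i + 5) 1, Add 3 3 2, Const 4 a, Add 3 3 4, Load (r + 5) 3]"
| "compile p (PUT a i r) = [Mult 3 (i + 5) 1, Add 3 3 2, Const 4 a, Add 3 3 4, Store 3 (r + 5)]"
| "compile p (WRITE r) = [Write (r + 5)]"
| "compile p EMIT = [Emit]"
| "compile p (c1 ;; c2) = compile p c1 @ compile (p + code_size c1) c2"
| "compile p (IF r c1 c2) = JumpZero (r + 5) (p + code_size c1 + 2) # compile (p + 1) c1 @
     Jump (p + code_size c1 + code_size c2 + 2) # compile (p + code_size c1 + 2) c2"
| "compile p (WHILE r c) = JumpZero (r + 5) (p + code_size c + 2) # compile (p + 1) c @ [Jump p]"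

lemma length_compile [simp]: "length (compile p c) = code_size c"
  by (induction c arbitrary: p) auto

definition code_at :: "instr list \<Rightarrow> nat \<Rightarrow> instr list \<Rightarrow> bool" where
  "code_at P p xs \<longleftrightarrow> (\<exists>ys zs. P = ys @ xs @ zs \<and> length ys = p)"

lemma code_at_append: "code_at P p (xs @ ys) \<longleftrightarrow> code_at P p xs \<and> code_at P (p + length xs) ys"
proof
  assume "code_at P p (xs @ ys)"
  then obtain us vs where "P = us @ xs @ ys @ vs" "length us = p"
    by (auto simp: code_at_def)
  then show "code_at P p xs \<and> code_at P (p + length xs) ys"
    unfolding code_at_def by (metis append.assoc length_append)
next
  assume "code_at P p xs \<and> code_at P (p + length xs) ys"
  then obtain us vs us' vs' where *: "P = us @ xs @ vs" "length us = p"
    "P = us' @ ys @ vs'" "length us' = p + length xs"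
    unfolding code_at_def by blast
  then have "us @ xs = us' \<and> vs = ys @ vs'"
    by (metis append.assoc append_eq_append_conv length_append)
  with * have "P = us @ (xs @ ys) @ vs'"
    by auto
  with *(2) show "code_at P p (xs @ ys)"
    unfolding code_at_def by blast
qed

lemma code_at_Nil [simp]: "code_at P p [] \<longleftrightarrow> p \<le> length P"
proof
  assume "p \<le> length P"
  then have "P = take p P @ [] @ drop p P" "length (take p P) = p"
    by simp_all
  then show "code_at P p []"
    unfolding code_at_def by blast
qed (auto simp: code_at_def)

lemma code_at_Cons: "code_at P p (x # xs) \<longleftrightarrow> p < length P \<and> P ! p = x \<and> code_at P (Suc p) xs"
proof -
  have "code_at P p [x] \<longleftrightarrow> p < length P \<and> P ! p = x"
    unfolding code_at_def
    by (auto simp: nth_append) (metis id_take_nth_drop length_take less_imp_le_nat min.absorb2)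
  with code_at_append[of P p "[x]" xs] show ?thesis
    by simp
qed

section \<open>Simulation of structured programs by the machine\<close>

context machine
begin

text \<open>Here \<open>l\<close> is the time of the latest emission before \<open>t\<close>.\<close>

definition good_history :: "instr list \<Rightarrow> config \<Rightarrow> nat \<Rightarrow> nat option \<Rightarrow> bool" where
  "good_history P s t l \<longleftrightarrow>
     (\<forall>u\<le>t. \<forall>a. reg (run P s u) a \<le> wmax \<and> mem (run P s u) a \<le> wmax) \<and>
     (\<forall>u u'. u < u' \<and> u' < t \<and> emits_at P s u \<and> emits_at P s u' \<and>
        (\<forall>v. u < v \<and> v < u' \<longrightarrow> \<not> emits_at P s v) \<longrightarrow> u' - u \<le> gap) \<and>
     (case l of None \<Rightarrow> \<forall>u<t. \<not> emits_at P s u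
      | Some u \<Rightarrow> u < t \<and> emits_at P s u \<and> (\<forall>v. u < v \<and> v < t \<longrightarrow> \<not> emits_at P s v))"

definition represents :: "config \<Rightarrow> state \<Rightarrow> bool" where
  "represents m s \<longleftrightarrow> (\<forall>x. reg m (x + 5) = regs s x) \<and> reg m 1 = 16 \<and> reg m 2 = base \<and>
     (\<forall>a<16. \<forall>i. mem m (cell a i) = arrs s a i) \<and> (\<forall>x<base. mem m x = inp x) \<and>
     current m = line s \<and> emitted m = lines s"

text \<open>The ghost clock serves as the number of machine steps run, so that it determines a
  single configuration and delays can be read off from \<open>latest\<close>.\<close>

definition simulates :: "instr list \<Rightarrow> config \<Rightarrow> nat \<Rightarrow> state \<Rightarrow> bool" where
  "simulates P s0 p s \<longleftrightarrow> pc (run P s0 (clock s)) = p \<and> represents (run P s0 (clock s)) s \<and>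
     good_history P s0 (clock s) (latest s)"

lemma run_Suc: "run P s (Suc t) = step P (run P s t)"
  by (simp add: run_def)

lemma good_history_step:
  assumes h: "good_history P s t l" and p: "p < length P" "pc (run P s t) = p" "P ! p \<noteq> Emit"
    and w: "\<And>a. reg (exec (P ! p) (run P s t)) a \<le> wmax \<and> mem (exec (P ! p) (run P s t)) a \<le> wmax"
  shows "good_history P s (Suc t) l \<and> run P s (Suc t) = exec (P ! p) (run P s t)"
proof -
  have r: "run P s (Suc t) = exec (P ! p) (run P s t)"
    using p by (simp add: run_Suc step_def halted_def)
  have ne: "\<not> emits_at P s t"
    using p by (simp add: emits_at_def)
  have "(\<forall>u\<le>Suc t. \<forall>a. reg (run P s u) a \<le> wmax \<and> mem (run P s u) a \<le> wmax)"
    using h w r by (auto simp: good_history_def le_Suc_eq)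
  then show ?thesis
    using h ne r unfolding good_history_def
    by (auto simp: less_Suc_eq split: option.splits)
qed

lemma good_history_emit:
  assumes h: "good_history P s t l" and p: "p < length P" "pc (run P s t) = p" "P ! p = Emit"
    and g: "\<And>u. l = Some u \<Longrightarrow> t - u \<le> gap"
  shows "good_history P s (Suc t) (Some t) \<and> run P s (Suc t) = exec Emit (run P s t)"
proof -
  have r: "run P s (Suc t) = exec Emit (run P s t)"
    using p by (simp add: run_Suc step_def halted_def)
  have e: "emits_at P s t"
    using p by (simp add: emits_at_def halted_def)
  have "t - u \<le> gap" if "u < t" "emits_at P s u" "\<forall>v. u < v \<and> v < t \<longrightarrow> \<not> emits_at P s v" for u
  proof (cases l)
    case None
    then show ?thesis
      using h that by (auto simp: good_history_def)
  next
    case (Some u')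
    then have "u' < t" "emits_at P s u'" "\<forall>v. u' < v \<and> v < t \<longrightarrow> \<not> emits_at P s v"
      using h by (auto simp: good_history_def)
    then have "u = u'"
      using that by (meson linorder_neqE_nat)
    then show ?thesis
      using g Some by simp
  qed
  moreover have "(\<forall>u\<le>Suc t. \<forall>a. reg (run P s u) a \<le> wmax \<and> mem (run P s u) a \<le> wmax)"
    using h r by (auto simp: good_history_def le_Suc_eq)
  ultimately show ?thesis
    using h e r unfolding good_history_def
    by (auto simp: less_Suc_eq)
qed

lemma simulates_words: "simulates P s0 p s \<Longrightarrow> reg (run P s0 (clock s)) a \<le> wmax \<and> mem (run P s0 (clock s)) a \<le> wmax"
  by (auto simp: simulates_def good_history_def)

lemma clock_tick [simp]: "clock (tick t s) = clock s + t"
  and latest_tick [simp]: "latest (tick t s) = latest s"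
  and regs_tick [simp]: "regs (tick t s) = regs s"
  and arrs_tick [simp]: "arrs (tick t s) = arrs s"
  and line_tick [simp]: "line (tick t s) = line s"
  and lines_tick [simp]: "lines (tick t s) = lines s"
  by (simp_all add: tick_def)

lemma put_reg_simps [simp]: "clock (put_reg r x s) = clock s" "latest (put_reg r x s) = latest s"
  "regs (put_reg r x s) = (regs s)(r := x)" "arrs (put_reg r x s) = arrs s"
  "line (put_reg r x s) = line s" "lines (put_reg r x s) = lines s"
  by (simp_all add: put_reg_def)

lemma put_arr_simps [simp]: "clock (put_arr a i x s) = clock s" "latest (put_arr a i x s) = latest s"
  "regs (put_arr a i x s) = regs s" "arrs (put_arr a i x s) = (arrs s)(a := (arrs s a)(i := x))"
  "line (put_arr a i x s) = line s" "lines (put_arr a i x s) = lines s"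
  by (simp_all add: put_arr_def)

lemma put_word_simps [simp]: "clock (put_word x s) = clock s" "latest (put_word x s) = latest s"
  "regs (put_word x s) = regs s" "arrs (put_word x s) = arrs s"
  "line (put_word x s) = line s @ [x]" "lines (put_word x s) = lines s"
  by (simp_all add: put_word_def)

lemma put_line_simps [simp]: "clock (put_line s) = clock s" "latest (put_line s) = Some (clock s)"
  "regs (put_line s) = regs s" "arrs (put_line s) = arrs s"
  "line (put_line s) = []" "lines (put_line s) = lines s @ [line s]"
  by (simp_all add: put_line_def)

lemma represents_tick [simp]: "represents m (tick t s) = represents m s"
  by (simp add: represents_def)

lemma simulates_step:
  assumes s: "simulates P s0 p s" and p: "p < length P" "P ! p \<noteq> Emit"
    and w: "\<And>m a. represents m s \<Longrightarrow> pc m = p \<Longrightarrow> (\<And>a. reg m a \<le> wmax \<and> mem m a \<le> wmax) \<Longrightarrow>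
      reg (exec (P ! p) m) a \<le> wmax \<and> mem (exec (P ! p) m) a \<le> wmax"
    and r: "\<And>m. represents m s \<Longrightarrow> pc m = p \<Longrightarrow> represents (exec (P ! p) m) s'"
    and q: "\<And>m. represents m s \<Longrightarrow> pc m = p \<Longrightarrow> pc (exec (P ! p) m) = p'"
    and c: "clock s' = clock s + 1" "latest s' = latest s"
  shows "simulates P s0 p' s'"
proof -
  let ?m = "run P s0 (clock s)"
  have m: "represents ?m s" "pc ?m = p" and h: "good_history P s0 (clock s) (latest s)"
    using s by (auto simp: simulates_def)
  have "good_history P s0 (Suc (clock s)) (latest s) \<and>
      run P s0 (Suc (clock s)) = exec (P ! p) ?m"
    using good_history_step[OF h p(1) m(2) p(2)] w[OF m] simulates_words[OF s] by blast
  then show ?thesis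
    using r[OF m] q[OF m] c by (auto simp: simulates_def)
qed

lemma simulates_regs: "simulates P s0 p s \<Longrightarrow> regs s x \<le> wmax"
  using simulates_words[of P s0 p s "x + 5"] by (simp add: simulates_def represents_def)

lemma simulates_input: "simulates P s0 p s \<Longrightarrow> x < base \<Longrightarrow> inp x \<le> wmax"
  using simulates_words[of P s0 p s x] by (simp add: simulates_def represents_def)

lemma cell_inject: "a < 16 \<Longrightarrow> b < 16 \<Longrightarrow> cell a i = cell b j \<longleftrightarrow> a = b \<and> i = j"
proof -
  assume ab: "a < 16" "b < 16"
  have *: "(i * 16 + a) div 16 = i" "(i * 16 + a) mod 16 = a" if "a < 16" for i a :: nat
    using that by auto
  have "a = b \<and> i = j" if "i * 16 + a = j * 16 + b"
    using *[OF ab(1), of i] *[OF ab(2), of j] unfolding that by simp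
  moreover have "cell a i = cell b j \<longleftrightarrow> i * 16 + a = j * 16 + b"
    unfolding cell_def by linarith
  ultimately show ?thesis
    by blast
qed

lemma cell_ge [simp]: "\<not> cell a i < base" "x < base \<Longrightarrow> x \<noteq> cell a i"
  by (auto simp: cell_def)

text \<open>The address computation shared by \<open>GET\<close> and \<open>PUT\<close>. All
  intermediate values are at most \<open>cell 16\<close> of the index, which explains the array
  number 16 in the side conditions of \<open>ev\<close>: it serves every array at once.\<close>

lemma simulates_address:
  assumes s: "simulates P s0 p s" and a: "a < 16" "cell 16 (regs s i) \<le> wmax"
    and c: "code_at P p [Mult 3 (i + 5) 1, Add 3 3 2, Const 4 a, Add 3 3 4]"
  shows "simulates P s0 (p + 4) (tick 4 s) \<and> reg (run P s0 (clock s + 4)) 3 = cell a (regs s i)"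
proof -
  let ?m = "\<lambda>t. run P s0 (clock s + t)"
  note simps = set_reg_def
  have le: "regs s i * 16 + base + a \<le> wmax" "regs s i * 16 + base \<le> wmax" "regs s i * 16 \<le> wmax" "a \<le> wmax"
    using a by (auto simp: cell_def)
  have m: "represents (?m 0) s" "pc (?m 0) = p" and h: "good_history P s0 (clock s) (latest s)"
    using s by (auto simp: simulates_def)
  have w: "reg (?m 0) x \<le> wmax" "mem (?m 0) x \<le> wmax" for x
    using simulates_words[OF s] by auto
  have P: "p < length P" "P ! p = Mult 3 (i + 5) 1" "Suc p < length P" "P ! Suc p = Add 3 3 2"
    "Suc (Suc p) < length P" "P ! Suc (Suc p) = Const 4 a"
    "Suc (Suc (Suc p)) < length P" "P ! Suc (Suc (Suc p)) = Add 3 3 4"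
    using c by (auto simp: code_at_Cons)
  have g: "good_history P s0 (clock s + 1) (latest s) \<and> ?m 1 = exec (P ! p) (?m 0)"
    using good_history_step[OF h P(1)] m P w le by (auto simp: simps represents_def)
  note m1 = conjunct2[OF g, unfolded P exec.simps simps]
  have g2: "good_history P s0 (clock s + 2) (latest s) \<and> ?m 2 = exec (P ! Suc p) (?m 1)"
    using good_history_step[OF conjunct1[OF g] P(3)] m1 m P w le by (auto simp: simps represents_def)
  note m2 = conjunct2[OF g2, unfolded P exec.simps simps m1]
  have g3: "good_history P s0 (clock s + 3) (latest s) \<and> ?m 3 = exec (P ! Suc (Suc p)) (?m 2)"
    using good_history_step[OF conjunct1[OF g2] P(5)] m2 m P w le
    by (auto simp: simps represents_def eval_nat_numeral)
  note m3 = conjunct2[OF g3, unfolded P exec.simps simps m2]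
  have g4: "good_history P s0 (clock s + 4) (latest s) \<and> ?m 4 = exec (P ! Suc (Suc (Suc p))) (?m 3)"
    using good_history_step[OF conjunct1[OF g3] P(7)] m3 m P w le
    by (auto simp: simps represents_def numeral_eq_Suc)
  note m4 = conjunct2[OF g4, unfolded P exec.simps simps m3]
  have "represents (?m 4) s" "pc (?m 4) = p + 4" "reg (?m 4) 3 = cell a (regs s i)"
    using m m4 by (simp_all add: represents_def cell_def)
  then show ?thesis
    using g4 by (simp add: simulates_def)
qed

text \<open>Induction on the execution rather than on the program, so that a loop is unrolled by its
  own derivation. Emissions are the only place where \<open>gap\<close> is consulted
  (\<open>good_history_emit\<close>).\<close>

theorem compile_correct:
  "ev c s s' \<Longrightarrow> code_at P p (compile p c) \<Longrightarrow> simulates P s0 p s \<Longrightarrow>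
     simulates P s0 (p + code_size c) s'"
proof (induction arbitrary: p rule: ev.induct)
  case (ev_SKIP s)
  then show ?case by simp
next
  case (ev_SET x r s)
  then show ?case
    by (intro simulates_step[OF ev_SET(3)]) (auto simp: code_at_Cons set_reg_def represents_def)
next
  case (ev_COPY r a s)
  then show ?case
    using simulates_regs[OF ev_COPY(2), of a]
    by (intro simulates_step[OF ev_COPY(2)]) (auto simp: code_at_Cons set_reg_def represents_def)
next
  case (ev_OP f s a b r)
  have [simp]: "exec (arith_instr f x y z) m = set_reg x (arith_val f (reg m y) (reg m z)) m"
    "arith_instr f x y z \<noteq> Emit" for x y z m
    by (cases f; simp)+
  from ev_OP show ?case
    by (intro simulates_step[OF ev_OP(3)]) (auto simp: code_at_Cons set_reg_def represents_def)
next
  case (ev_INPUT s a r)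
  then show ?case
    using simulates_input[OF ev_INPUT(3,1)]
    by (intro simulates_step[OF ev_INPUT(3)]) (auto simp: code_at_Cons set_reg_def represents_def)
next
  case (ev_GET a s i r)
  have c: "code_at P p [Mult 3 (i + 5) 1, Add 3 3 2, Const 4 a, Add 3 3 4]" "p + 4 < length P"
    "P ! (p + 4) = Load (r + 5) 3"
    using ev_GET(3) by (auto simp: code_at_Cons eval_nat_numeral)
  note A = simulates_address[OF ev_GET(4) ev_GET(1,2) c(1)]
  let ?m = "run P s0 (clock s + 4)"
  have m: "represents ?m s" "pc ?m = p + 4" "reg ?m 3 = cell a (regs s i)"
    and h: "good_history P s0 (clock s + 4) (latest s)"
    using A by (auto simp: simulates_def)
  have w: "reg ?m x \<le> wmax" "mem ?m x \<le> wmax" for x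
    using h by (auto simp: good_history_def)
  have e: "Suc (clock s + 4) = clock s + 5"
    by simp
  have "good_history P s0 (clock s + 5) (latest s) \<and> run P s0 (clock s + 5) = exec (P ! (p + 4)) ?m"
    unfolding e[symmetric] using good_history_step[OF h c(2) m(2)] c(3) w by (auto simp: set_reg_def)
  then show ?case
    using m c(3) ev_GET(1) by (auto simp: simulates_def represents_def set_reg_def)
next
  case (ev_PUT a s i r)
  have c: "code_at P p [Mult 3 (i + 5) 1, Add 3 3 2, Const 4 a, Add 3 3 4]" "p + 4 < length P"
    "P ! (p + 4) = Store 3 (r + 5)"
    using ev_PUT(3) by (auto simp: code_at_Cons eval_nat_numeral)
  note A = simulates_address[OF ev_PUT(4) ev_PUT(1,2) c(1)]
  let ?m = "run P s0 (clock s + 4)"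
  have m: "represents ?m s" "pc ?m = p + 4" "reg ?m 3 = cell a (regs s i)"
    and h: "good_history P s0 (clock s + 4) (latest s)"
    using A by (auto simp: simulates_def)
  have w: "reg ?m x \<le> wmax" "mem ?m x \<le> wmax" for x
    using h by (auto simp: good_history_def)
  have e: "Suc (clock s + 4) = clock s + 5"
    by simp
  have "good_history P s0 (clock s + 5) (latest s) \<and> run P s0 (clock s + 5) = exec (P ! (p + 4)) ?m"
    unfolding e[symmetric] using good_history_step[OF h c(2) m(2)] c(3) w by auto
  then show ?case
    using m c(3) ev_PUT(1) by (auto simp: simulates_def represents_def cell_inject)
next
  case (ev_WRITE r s)
  then show ?case
    by (intro simulates_step[OF ev_WRITE(2)]) (auto simp: code_at_Cons represents_def)
next
  case (ev_EMIT s)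
  then have m: "represents (run P s0 (clock s)) s" "pc (run P s0 (clock s)) = p"
    and h: "good_history P s0 (clock s) (latest s)"
    by (auto simp: simulates_def)
  have c: "p < length P" "P ! p = Emit"
    using ev_EMIT by (auto simp: code_at_Cons)
  have "good_history P s0 (Suc (clock s)) (Some (clock s)) \<and>
      run P s0 (Suc (clock s)) = exec Emit (run P s0 (clock s))"
    using good_history_emit[OF h c(1) m(2) c(2)] ev_EMIT(1) by auto
  then show ?case
    using m by (auto simp: simulates_def represents_def)
next
  case (ev_SEQ c1 s s1 c2 s2)
  have "code_at P p (compile p c1)" "code_at P (p + code_size c1) (compile (p + code_size c1) c2)"
    using ev_SEQ.prems(1) by (simp_all add: code_at_append)
  then show ?case
    using ev_SEQ.IH ev_SEQ.prems(2) by (simp add: add.assoc[symmetric])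
next
  case (ev_IF1 s r c1 s1 c2)
  have c: "p < length P" "P ! p = JumpZero (r + 5) (p + code_size c1 + 2)"
    "code_at P (p + 1) (compile (p + 1) c1)"
    "p + 1 + code_size c1 < length P" "P ! (p + 1 + code_size c1) = Jump (p + code_size c1 + code_size c2 + 2)"
    using ev_IF1 by (auto simp: code_at_append code_at_Cons)
  have "simulates P s0 (p + 1) (tick 1 s)"
    using ev_IF1(1) c by (intro simulates_step[OF ev_IF1(5)]) (auto simp: represents_def)
  from ev_IF1.IH[OF c(3) this] have s1: "simulates P s0 (p + 1 + code_size c1) s1" .
  show ?case
    using c by (intro simulates_step[OF s1]) (auto simp: represents_def)
next
  case (ev_IF2 s r c2 s1 c1)
  have c: "p < length P" "P ! p = JumpZero (r + 5) (p + code_size c1 + 2)"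
    "code_at P (p + code_size c1 + 2) (compile (p + code_size c1 + 2) c2)"
    using ev_IF2 by (auto simp: code_at_append code_at_Cons)
  have "simulates P s0 (p + code_size c1 + 2) (tick 1 s)"
    using ev_IF2(1) c by (intro simulates_step[OF ev_IF2(5)]) (auto simp: represents_def)
  from ev_IF2.IH[OF c(3) this] show ?case
    by (simp add: algebra_simps)
next
  case (ev_WHILE1 s r c s1 s2)
  have c: "p < length P" "P ! p = JumpZero (r + 5) (p + code_size c + 2)"
    "code_at P (p + 1) (compile (p + 1) c)"
    "p + 1 + code_size c < length P" "P ! (p + 1 + code_size c) = Jump p"
    using ev_WHILE1 by (auto simp: code_at_append code_at_Cons)
  have "simulates P s0 (p + 1) (tick 1 s)"
    using ev_WHILE1(1) c by (intro simulates_step[OF ev_WHILE1(7)]) (auto simp: represents_def)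
  from ev_WHILE1.IH(1)[OF c(3) this] have s1: "simulates P s0 (p + 1 + code_size c) s1" .
  have "simulates P s0 p (tick 1 s1)"
    using c by (intro simulates_step[OF s1]) (auto simp: represents_def)
  from ev_WHILE1.IH(2)[OF ev_WHILE1(6) this] show ?case .
next
  case (ev_WHILE2 s r c)
  have c: "p < length P" "P ! p = JumpZero (r + 5) (p + code_size c + 2)"
    using ev_WHILE2 by (auto simp: code_at_append code_at_Cons)
  then show ?case
    using ev_WHILE2 by (intro simulates_step[OF ev_WHILE2(3)]) (auto simp: represents_def)
qed

text \<open>Total correctness: as \<open>ev\<close> relates only complete executions,
  \<open>wp\<close> asserts termination, the word bound and the delay bound along with
  \<open>Q\<close>.\<close>

definition wp :: "com \<Rightarrow> (state \<Rightarrow> bool) \<Rightarrow> state \<Rightarrow> bool" where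
  "wp c Q s \<longleftrightarrow> (\<exists>s'. ev c s s' \<and> Q s')"

inductive_simps ev_simps:
  "ev SKIP s s'" "ev (SET r x) s s'" "ev (COPY r a) s s'" "ev (OP f r a b) s s'" "ev (INPUT r a) s s'"
  "ev (GET r a i) s s'" "ev (PUT a i r) s s'" "ev (WRITE r) s s'" "ev EMIT s s'" "ev (c1 ;; c2) s s'"
  "ev (IF r c1 c2) s s'"

lemma wp_simps [simp]:
  "wp SKIP Q s \<longleftrightarrow> Q s"
  "wp (SET r x) Q s \<longleftrightarrow> x \<le> wmax \<and> Q (tick 1 (put_reg r x s))"
  "wp (COPY r a) Q s \<longleftrightarrow> Q (tick 1 (put_reg r (regs s a) s))"
  "wp (OP f r a b) Q s \<longleftrightarrow> arith_val f (regs s a) (regs s b) \<le> wmax \<and>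
     Q (tick 1 (put_reg r (arith_val f (regs s a) (regs s b)) s))"
  "wp (INPUT r a) Q s \<longleftrightarrow> regs s a < base \<and> Q (tick 1 (put_reg r (inp (regs s a)) s))"
  "wp (GET r a i) Q s \<longleftrightarrow> a < 16 \<and> cell 16 (regs s i) \<le> wmax \<and>
     Q (tick 5 (put_reg r (arrs s a (regs s i)) s))"
  "wp (PUT a i r) Q s \<longleftrightarrow> a < 16 \<and> cell 16 (regs s i) \<le> wmax \<and>
     Q (tick 5 (put_arr a (regs s i) (regs s r) s))"
  "wp (WRITE r) Q s \<longleftrightarrow> Q (tick 1 (put_word (regs s r) s))"
  "wp EMIT Q s \<longleftrightarrow> (\<forall>l. latest s = Some l \<longrightarrow> clock s - l \<le> gap) \<and> Q (tick 1 (put_line s))"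
  "wp (c1 ;; c2) Q s \<longleftrightarrow> wp c1 (wp c2 Q) s"
  "wp (IF r c1 c2) Q s \<longleftrightarrow>
     (if regs s r \<noteq> 0 then wp c1 (\<lambda>s. Q (tick 1 s)) (tick 1 s) else wp c2 Q (tick 1 s))"
  by (auto simp: wp_def ev_simps)

section \<open>Frame conditions and the loop rule\<close>

fun writes_reg :: "com \<Rightarrow> nat \<Rightarrow> bool" where
  "writes_reg (SET r _) x \<longleftrightarrow> x = r"
| "writes_reg (COPY r _) x \<longleftrightarrow> x = r"
| "writes_reg (OP _ r _ _) x \<longleftrightarrow> x = r"
| "writes_reg (INPUT r _) x \<longleftrightarrow> x = r"
| "writes_reg (GET r _ _) x \<longleftrightarrow> x = r"
| "writes_reg (c1 ;; c2) x \<longleftrightarrow> writes_reg c1 x \<or> writes_reg c2 x"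
| "writes_reg (IF _ c1 c2) x \<longleftrightarrow> writes_reg c1 x \<or> writes_reg c2 x"
| "writes_reg (WHILE _ c) x \<longleftrightarrow> writes_reg c x"
| "writes_reg _ x \<longleftrightarrow> False"

fun writes_arr :: "com \<Rightarrow> nat \<Rightarrow> bool" where
  "writes_arr (PUT a _ _) x \<longleftrightarrow> x = a"
| "writes_arr (c1 ;; c2) x \<longleftrightarrow> writes_arr c1 x \<or> writes_arr c2 x"
| "writes_arr (IF _ c1 c2) x \<longleftrightarrow> writes_arr c1 x \<or> writes_arr c2 x"
| "writes_arr (WHILE _ c) x \<longleftrightarrow> writes_arr c x"
| "writes_arr _ x \<longleftrightarrow> False"

fun silent :: "com \<Rightarrow> bool" where
  "silent (WRITE _) \<longleftrightarrow> False"
| "silent EMIT \<longleftrightarrow> False"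
| "silent (c1 ;; c2) \<longleftrightarrow> silent c1 \<and> silent c2"
| "silent (IF _ c1 c2) \<longleftrightarrow> silent c1 \<and> silent c2"
| "silent (WHILE _ c) \<longleftrightarrow> silent c"
| "silent _ \<longleftrightarrow> True"

definition same :: "com \<Rightarrow> state \<Rightarrow> state \<Rightarrow> bool" where
  "same c s s' \<longleftrightarrow> (\<forall>x. \<not> writes_reg c x \<longrightarrow> regs s' x = regs s x) \<and>
     (\<forall>a. \<not> writes_arr c a \<longrightarrow> arrs s' a = arrs s a) \<and>
     (silent c \<longrightarrow> line s' = line s \<and> lines s' = lines s \<and> latest s' = latest s)"

lemma same_regs: "same c s s' \<Longrightarrow> \<not> writes_reg c x \<Longrightarrow> regs s' x = regs s x"
  and same_arrs: "same c s s' \<Longrightarrow> \<not> writes_arr c a \<Longrightarrow> arrs s' a = arrs s a"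
  and same_out: "same c s s' \<Longrightarrow> silent c \<Longrightarrow> line s' = line s"
    "same c s s' \<Longrightarrow> silent c \<Longrightarrow> lines s' = lines s"
    "same c s s' \<Longrightarrow> silent c \<Longrightarrow> latest s' = latest s"
  by (auto simp: same_def)

lemmas sames = same_regs same_arrs same_out

lemma ev_same: "ev c s s' \<Longrightarrow> same c s s'"
  by (induction rule: ev.induct) (auto simp: same_def)

lemma wp_mono:
  assumes "wp c Q s" "\<And>s'. Q s' \<Longrightarrow> same c s s' \<Longrightarrow> Q' s'"
  shows "wp c Q' s"
  using assms ev_same by (auto simp: wp_def)

text \<open>The frame condition relative to the state before the loop is available in the body and
  at the exit, so invariants list only what changes. The inner ticks are the test and the jump
  back.\<close>

lemma wp_WHILE:
  assumes "I s"
    and body: "\<And>t. I t \<Longrightarrow> same (WHILE r c) s t \<Longrightarrow> regs t r \<noteq> 0 \<Longrightarrow>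
      wp c (\<lambda>t'. I (tick 1 t') \<and> (V (tick 1 t') :: nat) < V t) (tick 1 t)"
    and exit: "\<And>t. I t \<Longrightarrow> same (WHILE r c) s t \<Longrightarrow> regs t r = 0 \<Longrightarrow> Q (tick 1 t)"
  shows "wp (WHILE r c) Q s"
proof -
  have "wp (WHILE r c) Q t" if "I t" "same (WHILE r c) s t" for t
    using that
  proof (induction "V t" arbitrary: t rule: less_induct)
    case less
    show ?case
    proof (cases "regs t r = 0")
      case True
      then show ?thesis
        using exit[OF less.prems True] ev_WHILE2[OF True] unfolding wp_def by blast
    next
      case False
      then obtain t' where t': "ev c (tick 1 t) t'" "I (tick 1 t')" "V (tick 1 t') < V t"
        using body less by (auto simp: wp_def)
      have "same (WHILE r c) s (tick 1 t')"
        using ev_same[OF t'(1)] less.prems(2) by (auto simp: same_def)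
      then have "wp (WHILE r c) Q (tick 1 t')"
        using less.hyps t' by blast
      then show ?thesis
        using ev_WHILE1[OF False t'(1)] by (auto simp: wp_def)
    qed
  qed
  then show ?thesis
    using assms(1) by (auto simp: same_def)
qed

end

section \<open>Counting edges in trees\<close>

text \<open>A set without an edge across its border would absorb everything reachable from one of
  its vertices.\<close>

lemma connected_onD:
  assumes "connected_on V T" "Q \<subseteq> V" "Q \<noteq> {}" "Q \<noteq> V"
  shows "\<exists>p u. {p, u} \<in> T \<and> p \<in> Q \<and> u \<notin> Q"
proof (rule ccontr)
  assume *: "\<not> ?thesis"
  obtain a where a: "a \<in> Q"
    using assms by blast
  have "b \<in> Q" if "(a, b) \<in> {(x, y). {x, y} \<in> T}\<^sup>*" for b
    using that by (induction rule: rtrancl_induct) (use a * in auto)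
  then have "V \<subseteq> Q"
    using assms(1,2) a unfolding connected_on_def by blast
  then show False
    using assms by blast
qed

text \<open>Growing \<open>Q\<close> by one vertex at a time uses a new edge each time.\<close>

lemma card_connected_ge:
  assumes "connected_on (\<Union>T) T" "finite T" "finite (\<Union>T)" "Q \<subseteq> \<Union>T" "Q \<noteq> {}"
  shows "card {e\<in>T. e \<subseteq> Q} + card (\<Union>T - Q) \<le> card T"
  using assms(4,5)
proof (induction "card (\<Union>T - Q)" arbitrary: Q)
  case 0
  then show ?case
    using assms(2) by (auto intro!: card_mono)
next
  case (Suc m)
  then have "Q \<noteq> \<Union>T"
    by auto
  then obtain p u where pu: "{p, u} \<in> T" "p \<in> Q" "u \<notin> Q"
    using connected_onD[OF assms(1) Suc.prems] by blast
  then have u: "u \<in> \<Union>T - Q"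
    by blast
  have "\<Union>T - Q = insert u (\<Union>T - insert u Q)"
    using u by blast
  then have c: "card (\<Union>T - Q) = Suc (card (\<Union>T - insert u Q))"
    using assms(3) by (metis Diff_iff card_insert_disjoint finite_Diff insertI1)
  then have "card {e\<in>T. e \<subseteq> insert u Q} + card (\<Union>T - insert u Q) \<le> card T"
    using Suc.hyps(2) Suc.prems u by (intro Suc.hyps(1)) auto
  moreover have "card (insert {p, u} {e\<in>T. e \<subseteq> Q}) \<le> card {e\<in>T. e \<subseteq> insert u Q}"
    using assms(2) pu by (intro card_mono) auto
  moreover have "card (insert {p, u} {e\<in>T. e \<subseteq> Q}) = Suc (card {e\<in>T. e \<subseteq> Q})"
    using assms(2) pu by (intro card_insert_disjoint) auto
  ultimately show ?case
    using c by linarith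
qed

text \<open>\<open>k_subtree\<close> without acyclicity, which the number of edges enforces
  (\<open>k_subtree_iff_tree\<close>). The search thus never has to argue about cycles as
  sequences.\<close>

definition tree :: "'a set set \<Rightarrow> nat \<Rightarrow> 'a set set \<Rightarrow> bool" where
  "tree E k T \<longleftrightarrow> T \<subseteq> E \<and> card T = k - 1 \<and> connected_on (\<Union>T) T \<and> card (\<Union>T) = k"

text \<open>The edges between consecutive vertices are pairwise distinct: if two of them coincided,
  two steps along the cycle would lead back to the start, which needs a length dividing 2.\<close>

lemma cycle_edges:
  assumes "is_cycle T vs" "finite T"
  shows "length vs \<le> card {e\<in>T. e \<subseteq> set vs}"
proof -
  let ?n = "length vs"
  let ?f = "\<lambda>i. {vs ! i, vs ! (Suc i mod ?n)}"
  have d: "distinct vs" and n: "3 \<le> ?n" and e: "\<And>i. i < ?n \<Longrightarrow> ?f i \<in> T"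
    using assms by (auto simp: is_cycle_def)
  have "inj_on ?f {..<?n}"
  proof (rule inj_onI)
    fix i j
    assume ij: "i \<in> {..<?n}" "j \<in> {..<?n}" "?f i = ?f j"
    have m: "Suc i mod ?n < ?n" "Suc j mod ?n < ?n"
      using n by (auto intro!: mod_less_divisor simp del: length_greater_0_conv)
    show "i = j"
    proof (rule ccontr)
      assume "i \<noteq> j"
      then have "i = Suc j mod ?n" "j = Suc i mod ?n"
        using ij m d by (auto simp: doubleton_eq_iff nth_eq_iff_index_eq)
      then have "Suc (Suc i mod ?n) mod ?n = i"
        by simp
      then have "(i + 2) mod ?n = i mod ?n"
        using ij(1) by (simp add: mod_Suc_eq)
      then have "?n dvd 2"
        by (metis add_diff_cancel_left' le_add1 mod_eq_dvd_iff_nat)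
      then show False
        using n by (auto dest: dvd_imp_le)
    qed
  qed
  then have "card (?f ` {..<?n}) = ?n"
    by (simp add: card_image)
  moreover have "?f ` {..<?n} \<subseteq> {e\<in>T. e \<subseteq> set vs}"
  proof
    fix x
    assume "x \<in> ?f ` {..<?n}"
    then obtain i where i: "i < ?n" "x = ?f i"
      by blast
    moreover have "Suc i mod ?n < ?n"
      using i(1) by (intro mod_less_divisor) linarith
    ultimately show "x \<in> {e\<in>T. e \<subseteq> set vs}"
      using e[OF i(1)] by simp
  qed
  ultimately show ?thesis
    using card_mono[of "{e\<in>T. e \<subseteq> set vs}" "?f ` {..<?n}"] assms(2) by simp
qed

text \<open>A cycle brings as many edges as vertices, and by \<open>card_connected_ge\<close> every
  further vertex costs one more edge. That makes at least \<open>k\<close> edges, but there are only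
  \<open>k - 1\<close>.\<close>

lemma k_subtree_iff_tree:
  assumes "2 \<le> k"
  shows "k_subtree E k T \<longleftrightarrow> tree E k T"
proof -
  have "acyclic_edges T" if T: "tree E k T"
    unfolding acyclic_edges_def
  proof
    assume "\<exists>vs. is_cycle T vs"
    then obtain vs where vs: "is_cycle T vs"
      by blast
    have f: "finite T" "finite (\<Union>T)"
      using T assms by (auto simp: tree_def intro: card_ge_0_finite)
    have len: "3 \<le> length vs" "distinct vs"
      using vs by (auto simp: is_cycle_def)
    have "set vs \<subseteq> \<Union>T"
    proof
      fix x
      assume "x \<in> set vs"
      then obtain i where "i < length vs" "x = vs ! i"
        by (auto simp: in_set_conv_nth)
      then show "x \<in> \<Union>T"
        using vs unfolding is_cycle_def by (intro UnionI[of "{vs ! i, vs ! (Suc i mod length vs)}"]) auto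
    qed
    moreover have "set vs \<noteq> {}"
      using len by auto
    ultimately have "card {e\<in>T. e \<subseteq> set vs} + card (\<Union>T - set vs) \<le> card T"
      using T f by (intro card_connected_ge) (auto simp: tree_def)
    moreover have "card (\<Union>T - set vs) = card (\<Union>T) - length vs" "length vs \<le> card (\<Union>T)"
      using card_Diff_subset[OF _ \<open>set vs \<subseteq> _\<close>] card_mono[OF f(2) \<open>set vs \<subseteq> _\<close>]
      by (simp_all add: distinct_card[OF len(2)])
    ultimately show False
      using cycle_edges[OF vs f(1)] T assms by (auto simp: tree_def)
  qed
  then show ?thesis
    by (auto simp: k_subtree_def tree_def)
qed

text \<open>Two edges from a subtree to the same further vertex would close a cycle.\<close>

lemma tree_unique_edge:
  assumes T: "tree E k T" "2 \<le> k" and X: "X \<subseteq> T" "\<Union>X \<subseteq> S" "card S \<le> Suc (card X)"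
    and S: "S \<subseteq> \<Union>T" and e: "{p, u} \<in> T" "{q, u} \<in> T" "p \<in> S" "q \<in> S" "u \<notin> S"
  shows "p = q"
proof (rule ccontr)
  assume "p \<noteq> q"
  have f: "finite T" "finite (\<Union>T)"
    using T by (auto simp: tree_def intro: card_ge_0_finite)
  have fX: "finite X" "finite S"
    using f X S finite_subset by metis+
  have u: "u \<in> \<Union>T"
    using e by blast
  have "{p, u} \<noteq> {q, u}" "{p, u} \<notin> X" "{q, u} \<notin> X"
    using \<open>p \<noteq> q\<close> e X by (auto simp: doubleton_eq_iff)
  then have "card (insert {p, u} (insert {q, u} X)) = Suc (Suc (card X))"
    using fX by simp
  moreover have "card (insert {p, u} (insert {q, u} X)) \<le> card {e\<in>T. e \<subseteq> insert u S}"
    using X e f by (intro card_mono) auto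
  moreover have "card {e\<in>T. e \<subseteq> insert u S} + card (\<Union>T - insert u S) \<le> card T"
    using T f S u by (intro card_connected_ge) (auto simp: tree_def)
  moreover have "card (\<Union>T - insert u S) = card (\<Union>T) - Suc (card S)"
    using S u fX e by (subst card_Diff_subset) auto
  moreover have "Suc (card S) \<le> card (\<Union>T)"
    using card_mono[of "\<Union>T" "insert u S"] S u f fX e by simp
  ultimately show False
    using T X by (auto simp: tree_def)
qed

section \<open>Relabelling of vertices\<close>

lemma connected_on_image:
  assumes "connected_on (\<Union>T) T"
  shows "connected_on (\<Union>((`) f ` T)) ((`) f ` T)"
proof -
  have *: "(f a, f b) \<in> {(x, y). {x, y} \<in> (`) f ` T}\<^sup>*" if "(a, b) \<in> {(x, y). {x, y} \<in> T}\<^sup>*" for a b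
    using that
  proof (induction rule: rtrancl_induct)
    case (step y z)
    have "f ` {y, z} \<in> (`) f ` T"
      using step by blast
    then have "(f y, f z) \<in> {(x, y). {x, y} \<in> (`) f ` T}"
      by simp
    with step.IH show ?case
      by (rule rtrancl_into_rtrancl)
  qed simp
  show ?thesis
    using assms unfolding connected_on_def by (auto intro!: * )
qed

lemma tree_image:
  assumes "inj_on f (\<Union>E)" "tree E k T"
  shows "tree ((`) f ` E) k ((`) f ` T)"
proof -
  have T: "T \<subseteq> E"
    using assms by (simp add: tree_def)
  then have "\<Union>T \<subseteq> \<Union>E"
    by blast
  then have i: "inj_on f (\<Union>T)"
    using assms(1) inj_on_subset by blast
  then have "inj_on ((`) f) T"
    by (meson Union_upper inj_on_image_eq_iff inj_on_def)
  then have "card ((`) f ` T) = card T"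
    by (rule card_image)
  moreover have "\<Union>((`) f ` T) = f ` \<Union>T"
    by blast
  then have "card (\<Union>((`) f ` T)) = card (\<Union>T)"
    using i by (simp add: card_image)
  ultimately show ?thesis
    using assms(2) T connected_on_image[of T f] by (auto simp: tree_def)
qed

text \<open>\<open>tree_image\<close> for \<open>f\<close> gives one inclusion; the other is
  \<open>tree_image\<close> for the inverse of \<open>f\<close>.\<close>

lemma trees_image:
  assumes "inj_on f (\<Union>E)"
  shows "{T. tree ((`) f ` E) k T} = (`) ((`) f) ` {T. tree E k T}"
proof
  show "(`) ((`) f) ` {T. tree E k T} \<subseteq> {T. tree ((`) f ` E) k T}"
    using tree_image[OF assms] by blast
  show "{T. tree ((`) f ` E) k T} \<subseteq> (`) ((`) f) ` {T. tree E k T}"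
  proof
    fix T
    assume "T \<in> {T. tree ((`) f ` E) k T}"
    then have T: "tree ((`) f ` E) k T"
      by simp
    let ?g = "inv_into (\<Union>E) f"
    have g: "?g ` f ` e = e" if "e \<in> E" for e
      using that assms by (simp add: Union_upper inv_into_image_cancel)
    have "inj_on ?g (\<Union>((`) f ` E))"
      by (rule inj_on_subset[OF inj_on_inv_into[of "f ` \<Union>E" f "\<Union>E"]]) auto
    then have "tree ((`) ?g ` (`) f ` E) k ((`) ?g ` T)"
      using T by (rule tree_image)
    moreover have "(`) ?g ` (`) f ` E = E"
      using g by (force simp: image_image)
    moreover have "(`) f ` (`) ?g ` T = T"
    proof -
      have "f ` ?g ` e = e" if "e \<in> T" for e
        using that T g by (force simp: tree_def)
      then show ?thesis
        by (force simp: image_image)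
    qed
    ultimately show "T \<in> (`) ((`) f) ` {T. tree E k T}"
      by (metis (no_types, lifting) image_eqI mem_Collect_eq)
  qed
qed

section \<open>Depth-first search for trees\<close>

locale ordered_graph =
  fixes adj :: "nat \<Rightarrow> nat \<Rightarrow> bool" and n k :: nat
  assumes adj_sym: "adj u v \<Longrightarrow> adj v u"
    and adj_irrefl: "\<not> adj u u"
    and adj_less: "adj u v \<Longrightarrow> u < n"
    and k_ge: "2 \<le> k"
begin

definition edges :: "nat set set" where
  "edges = {{u, v} | u v. adj u v}"

abbreviation trees :: "nat set set set" where
  "trees \<equiv> {T. tree edges k T}"

lemma adj_if_edge: "{u, v} \<in> edges \<Longrightarrow> adj u v"
  using adj_sym by (auto simp: edges_def doubleton_eq_iff)

text \<open>The arcs that may still be taken when the next child of \<open>vs q\<close> is sought below \<open>c\<close>: besides those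
  of \<open>vs q\<close> itself, the later siblings of all vertices on the path to \<open>vs q\<close>.\<close>

function act :: "(nat \<Rightarrow> nat) \<Rightarrow> (nat \<Rightarrow> nat) \<Rightarrow> nat \<Rightarrow> nat \<Rightarrow> (nat \<times> nat) set" where
  "act vs ps q c = {(vs q, u) | u. adj (vs q) u \<and> u < c} \<union>
     (if ps q < q then act vs ps (ps q) (vs q) else {})"
  by auto
termination
  by (relation "measure (\<lambda>(vs, ps, q, c). q)") auto

declare act.simps [simp del]

abbreviation pending :: "(nat \<Rightarrow> nat) \<Rightarrow> (nat \<Rightarrow> nat) \<Rightarrow> nat \<Rightarrow> (nat \<times> nat) set" where
  "pending vs ps j \<equiv> act vs ps (ps j) (vs j)"

lemma act_mono: "c \<le> c' \<Longrightarrow> act vs ps q c \<subseteq> act vs ps q c'"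
  by (subst (1 2) act.simps) auto

text \<open>Only positions up to \<open>q\<close> are consulted. Hence appending a vertex leaves
  earlier stacks alone, and old entries behind the current length do no harm.\<close>

lemma act_cong:
  assumes "\<And>i. i \<le> q \<Longrightarrow> vs i = vs' i" "\<And>i. i \<le> q \<Longrightarrow> ps i = ps' i"
  shows "act vs ps q c = act vs' ps' q c"
  using assms
proof (induction q arbitrary: c rule: less_induct)
  case (less q)
  have "ps q < q \<Longrightarrow> act vs ps (ps q) (vs q) = act vs' ps' (ps q) (vs q)"
    using less.prems by (intro less.IH) auto
  then show ?case
    using less.prems[of q] by (subst (1 2) act.simps) auto
qed

lemma act_tail: "(p, u) \<in> act vs ps q c \<Longrightarrow> adj p u \<and> (\<exists>t\<le>q. p = vs t)"
proof (induction q arbitrary: c rule: less_induct)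
  case (less q)
  show ?case
  proof (cases "(p, u) \<in> pending vs ps q \<and> ps q < q")
    case True
    then show ?thesis
      using less.IH[of "ps q" "vs q"] by (meson le_trans less_imp_le_nat)
  next
    case False
    then show ?thesis
      using less.prems by (subst (asm) act.simps) (auto split: if_splits)
  qed
qed

lemma act_head:
  assumes "(p, u) \<in> act vs ps q c" "c \<le> r" "\<And>i. i \<le> q \<Longrightarrow> vs i \<le> r"
  shows "u < r"
  using assms
proof (induction q arbitrary: c rule: less_induct)
  case (less q)
  show ?case
  proof (cases "(p, u) \<in> pending vs ps q \<and> ps q < q")
    case True
    then show ?thesis
      using less.IH[of "ps q" "vs q"] less.prems by auto
  next
    case False
    then show ?thesis
      using less.prems by (subst (asm) act.simps) (auto split: if_splits)
  qed
qed

text \<open>In stack order, the part below an arc \<open>(vs t, u)\<close> is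
  \<open>act vs ps t u\<close>: the smaller children of \<open>vs t\<close>, then what its ancestors
  have left. Injectivity recovers the position \<open>t\<close> from the vertex.\<close>

lemma act_suffix:
  assumes "(vs t, u) \<in> act vs ps q c" "inj_on vs {..<m}" "t < m" "q < m"
  shows "act vs ps t u \<subseteq> act vs ps q c"
  using assms
proof (induction q arbitrary: c rule: less_induct)
  case (less q)
  show ?case
  proof (cases "(vs t, u) \<in> pending vs ps q \<and> ps q < q")
    case True
    then have "act vs ps t u \<subseteq> pending vs ps q"
      using less.prems by (intro less.IH) auto
    then show ?thesis
      using True by (subst act.simps[of vs ps q c]) auto
  next
    case False
    then have "vs t = vs q" "u < c"
      using less.prems(1) by (subst (asm) act.simps; auto split: if_splits)+
    then have "t = q"
      using less.prems by (auto dest: inj_onD)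
    then show ?thesis
      using \<open>u < c\<close> act_mono by simp
  qed
qed

text \<open>\<open>vs\<close> lists the vertices of a tree in depth-first order, \<open>ps i\<close> is the index of the parent of
  \<open>vs i\<close>, and children are visited in decreasing order.\<close>

definition dfs :: "nat \<Rightarrow> (nat \<Rightarrow> nat) \<Rightarrow> (nat \<Rightarrow> nat) \<Rightarrow> nat \<Rightarrow> bool" where
  "dfs r vs ps m \<longleftrightarrow> 1 \<le> m \<and> vs 0 = r \<and> inj_on vs {..<m} \<and> (\<forall>i. 0 < i \<and> i < m \<longrightarrow>
     ps i < i \<and> (vs (ps i), vs i) \<in> act vs ps (i - 1) r)"

definition verts :: "(nat \<Rightarrow> nat) \<Rightarrow> nat \<Rightarrow> nat set" where
  "verts vs m = vs ` {..<m}"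

definition tree_edges :: "(nat \<Rightarrow> nat) \<Rightarrow> (nat \<Rightarrow> nat) \<Rightarrow> nat \<Rightarrow> nat set set" where
  "tree_edges vs ps m = (\<lambda>i. {vs (ps i), vs i}) ` {1..<m}"

lemma dfs_prefix: "dfs r vs ps m \<Longrightarrow> 1 \<le> j \<Longrightarrow> j \<le> m \<Longrightarrow> dfs r vs ps j"
  unfolding dfs_def by (auto elim: inj_on_subset)

lemma dfs_le:
  assumes "dfs r vs ps m" "i < m"
  shows "vs i \<le> r \<and> (0 < i \<longrightarrow> vs i < r \<and> adj (vs (ps i)) (vs i))"
  using assms(2)
proof (induction i rule: less_induct)
  case (less i)
  show ?case
  proof (cases "i = 0")
    case True
    then show ?thesis
      using assms by (simp add: dfs_def)
  next
    case False
    then have e: "(vs (ps i), vs i) \<in> act vs ps (i - 1) r"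
      using assms less.prems by (auto simp: dfs_def)
    then have "vs i < r"
      by (rule act_head) (use False less in auto)
    then show ?thesis
      using act_tail[OF e] by auto
  qed
qed

lemma act_step: "dfs r vs ps m \<Longrightarrow> 0 < i \<Longrightarrow> i < m \<Longrightarrow>
    act vs ps i c = {(vs i, u) | u. adj (vs i) u \<and> u < c} \<union> pending vs ps i"
  by (subst act.simps) (auto simp: dfs_def)

text \<open>The guard \<open>ps q < q\<close> in \<open>act\<close> both makes the recursion
  terminate and recognises the root: nothing is below 0, whatever \<open>ps 0\<close> may
  be.\<close>

lemma act_root: "act vs ps 0 c = {(vs 0, u) | u. adj (vs 0) u \<and> u < c}"
  by (subst act.simps) auto

lemma dfs_inj: "dfs r vs ps m \<Longrightarrow> inj_on vs {..<m}"
  by (simp add: dfs_def)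

lemma dfs_eq_iff: "dfs r vs ps m \<Longrightarrow> i < m \<Longrightarrow> j < m \<Longrightarrow> vs i = vs j \<longleftrightarrow> i = j"
  by (auto simp: dfs_def dest: inj_onD)

lemma dfs_parent: "dfs r vs ps m \<Longrightarrow> 0 < i \<Longrightarrow> i < m \<Longrightarrow> ps i < i"
  by (simp add: dfs_def)

lemma dfs_arc: "dfs r vs ps m \<Longrightarrow> 0 < i \<Longrightarrow> i < m \<Longrightarrow> (vs (ps i), vs i) \<in> act vs ps (i - 1) r"
  by (simp add: dfs_def)

lemma dfs_act_head: "dfs r vs ps m \<Longrightarrow> q < m \<Longrightarrow> c \<le> r \<Longrightarrow> (p, u) \<in> act vs ps q c \<Longrightarrow> u < r"
  by (rule act_head[of p u vs ps q c]) (use dfs_le[of r vs ps m] in auto)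

lemma pending_head: "dfs r vs ps m \<Longrightarrow> 0 < j \<Longrightarrow> j < m \<Longrightarrow> (p, u) \<in> pending vs ps j \<Longrightarrow> u < r"
  using dfs_act_head[of r vs ps m "ps j" "vs j"] dfs_parent[of r vs ps m j] dfs_le[of r vs ps m j] by simp

text \<open>At its own parent the arc is cut off by the strict bound \<open>vs j\<close>, and all
  other pending arcs start at proper ancestors of the parent. This is what makes excluding and
  including an arc disjoint.\<close>

lemma arc_not_pending:
  assumes "dfs r vs ps m" "0 < j" "j < m"
  shows "(vs (ps j), vs j) \<notin> pending vs ps j"
proof
  let ?p = "ps j"
  assume a: "(vs ?p, vs j) \<in> pending vs ps j"
  have p: "?p < j"
    using assms dfs_parent by blast
  have "0 < ?p \<and> (vs ?p, vs j) \<in> pending vs ps ?p"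
    using a by (subst (asm) act.simps) (auto split: if_splits)
  then have "\<exists>t\<le>ps ?p. vs ?p = vs t"
    using act_tail by blast
  then obtain t where "t \<le> ps ?p" "vs ?p = vs t"
    by blast
  moreover have "ps ?p < ?p"
    using \<open>0 < ?p \<and> _\<close> assms p dfs_parent by auto
  ultimately show False
    using dfs_eq_iff[OF assms(1), of ?p t] p assms by auto
qed

lemma pending_suffix:
  assumes "dfs r vs ps m" "0 < j" "j < m" "q < m" "(vs (ps j), vs j) \<in> act vs ps q c"
  shows "pending vs ps j \<subseteq> act vs ps q c"
  using assms by (intro act_suffix[of _ _ _ _ _ _ m]) (auto simp: dfs_def)

section \<open>How the stack evolves along the depth-first list\<close>

definition arcs_from :: "nat \<Rightarrow> (nat \<Rightarrow> nat) \<Rightarrow> nat \<Rightarrow> nat \<Rightarrow> (nat \<times> nat) set" where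
  "arcs_from r vs y m = {(vs t, u) | t u. y \<le> t \<and> t < m \<and> adj (vs t) u \<and> u < r}"

text \<open>Whatever is on the stack from position \<open>y\<close> on was either pending at
  \<open>j\<close> already or pushed by a position from \<open>y\<close> on. In the induction the
  arc to \<open>vs i\<close> is of one of these two kinds, and either kind settles what lies below
  it.\<close>

lemma act_subset_pending_arcs:
  assumes d: "dfs r vs ps m" "0 < j" "j \<le> y" "y < m"
    and base: "pending vs ps y \<subseteq> pending vs ps j"
    and i: "y \<le> i" "i < m"
  shows "act vs ps i r \<subseteq> pending vs ps j \<union> arcs_from r vs y m"
  using i
proof (induction i rule: less_induct)
  case (less i)
  have "act vs ps i r = {(vs i, u) | u. adj (vs i) u \<and> u < r} \<union> pending vs ps i"
    using act_step[OF d(1)] less.prems d by simp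
  moreover have "{(vs i, u) | u. adj (vs i) u \<and> u < r} \<subseteq> arcs_from r vs y m"
    using less.prems by (auto simp: arcs_from_def)
  moreover have "pending vs ps i \<subseteq> pending vs ps j \<union> arcs_from r vs y m"
  proof (cases "i = y")
    case True
    then show ?thesis
      using base by blast
  next
    case False
    have p: "ps i < i"
      using dfs_parent[OF d(1)] less.prems d by simp
    have "(vs (ps i), vs i) \<in> act vs ps (i - 1) r"
      using dfs_arc[OF d(1)] less.prems d by simp
    also have "\<dots> \<subseteq> pending vs ps j \<union> arcs_from r vs y m"
      using less.prems False by (intro less.IH) auto
    finally show ?thesis
    proof
      assume "(vs (ps i), vs i) \<in> pending vs ps j"
      then have "pending vs ps i \<subseteq> pending vs ps j"
        using d less.prems dfs_parent[OF d(1), of j] by (intro pending_suffix[OF d(1)]) auto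
      then show ?thesis
        by blast
    next
      assume "(vs (ps i), vs i) \<in> arcs_from r vs y m"
      then obtain t where "y \<le> t" "t < m" "vs (ps i) = vs t"
        by (auto simp: arcs_from_def)
      then have "y \<le> ps i"
        using dfs_eq_iff[OF d(1), of "ps i" t] p less.prems by simp
      have "pending vs ps i \<subseteq> act vs ps (ps i) r"
        using dfs_le[OF d(1) less.prems(2)] by (intro act_mono) simp
      also have "\<dots> \<subseteq> pending vs ps j \<union> arcs_from r vs y m"
        using \<open>y \<le> ps i\<close> p less.prems by (intro less.IH) auto
      finally show ?thesis .
    qed
  qed
  ultimately show ?case
    by blast
qed

lemma arc_in_pending_arcs:
  assumes d: "dfs r vs ps m" "0 < j" "j \<le> y" "y < m"
    and base: "pending vs ps y \<subseteq> pending vs ps j"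
    and i: "y < i" "i < m"
  shows "(vs (ps i), vs i) \<in> pending vs ps j \<or> y \<le> ps i"
proof -
  have p: "ps i < i"
    using dfs_parent[OF d(1)] i by simp
  have "(vs (ps i), vs i) \<in> act vs ps (i - 1) r"
    using dfs_arc[OF d(1)] i by simp
  also have "\<dots> \<subseteq> pending vs ps j \<union> arcs_from r vs y m"
    using i by (intro act_subset_pending_arcs[OF d base]) auto
  finally show ?thesis
  proof
    assume "(vs (ps i), vs i) \<in> arcs_from r vs y m"
    then obtain t where "y \<le> t" "t < m" "vs (ps i) = vs t"
      by (auto simp: arcs_from_def)
    then show ?thesis
      using dfs_eq_iff[OF d(1), of "ps i" t] p i by simp
  qed blast
qed

text \<open>The premise \<open>desc\<close> says that the positions from \<open>j\<close> to
  \<open>y - 1\<close> belong to the subtree of \<open>vs j\<close>. While this subtree is built,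
  the stack pending at \<open>j\<close> stays untouched under the arcs of the subtree.\<close>

lemma pending_descendant:
  assumes d: "dfs r vs ps m" "0 < j" "y \<le> m" and desc: "\<And>i. j < i \<Longrightarrow> i < y \<Longrightarrow> j \<le> ps i"
    and x: "j \<le> x" "x < y"
  shows "pending vs ps j \<subseteq> pending vs ps x \<and>
    (\<forall>p u. (p, u) \<in> pending vs ps x \<longrightarrow> (p, u) \<in> pending vs ps j \<or> (\<exists>t. j \<le> t \<and> t < x \<and> p = vs t))"
  using x
proof (induction x rule: less_induct)
  case (less x)
  show ?case
  proof (cases "x = j")
    case False
    then have p: "j \<le> ps x" "ps x < x"
      using desc[of x] dfs_parent[OF d(1), of x] less.prems d by auto
    then have "pending vs ps x = {(vs (ps x), u) | u. adj (vs (ps x)) u \<and> u < vs x} \<union> pending vs ps (ps x)"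
      using d less.prems by (intro act_step[OF d(1)]) auto
    moreover have "pending vs ps j \<subseteq> pending vs ps (ps x)"
      "\<And>p u. (p, u) \<in> pending vs ps (ps x) \<Longrightarrow> (p, u) \<in> pending vs ps j \<or> (\<exists>t. j \<le> t \<and> t < ps x \<and> p = vs t)"
      using less.IH[of "ps x"] p less.prems by auto
    moreover have "t < x" if "t < ps x" for t
      using that p by simp
    ultimately show ?thesis
      using p by blast
  qed auto
qed

text \<open>\<open>y\<close> is the first position outside the subtree of \<open>vs j\<close>. Its
  arc was on the stack during the subtree but does not start in it, so it was pending at
  \<open>j\<close>.\<close>

lemma arc_after_descendants:
  assumes d: "dfs r vs ps m" "0 < j" "j < y" "y < m" and desc: "\<And>i. j < i \<Longrightarrow> i < y \<Longrightarrow> j \<le> ps i"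
    and y: "ps y < j"
  shows "(vs (ps y), vs y) \<in> pending vs ps j"
proof -
  have "(vs (ps y), vs y) \<in> act vs ps (y - 1) r"
    using d by (intro dfs_arc) auto
  also have "act vs ps (y - 1) r = {(vs (y - 1), u) | u. adj (vs (y - 1)) u \<and> u < r} \<union> pending vs ps (y - 1)"
    using d by (intro act_step) auto
  finally have "(vs (ps y), vs y) \<in> pending vs ps (y - 1)"
    using dfs_eq_iff[OF d(1), of "ps y" "y - 1"] d y by auto
  moreover have "\<not> (\<exists>t. j \<le> t \<and> t < y - 1 \<and> vs (ps y) = vs t)"
    using dfs_eq_iff[OF d(1), of "ps y"] d y by auto
  ultimately show ?thesis
    using pending_descendant[OF d(1,2) less_imp_le[OF d(4)] desc, of "y - 1"] d
    by (metis Suc_diff_1 Suc_leI diff_less less_Suc_eq_le less_nat_zero_code linorder_neqE_nat zero_less_one)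
qed

section \<open>Reachability and the test for extensibility\<close>

inductive_set reach :: "nat \<Rightarrow> nat set \<Rightarrow> (nat \<times> nat) set \<Rightarrow> nat set" for r S A where
  start: "(p, u) \<in> A \<Longrightarrow> u \<notin> S \<Longrightarrow> u \<in> reach r S A"
| extend: "w \<in> reach r S A \<Longrightarrow> adj w u \<Longrightarrow> u < r \<Longrightarrow> u \<notin> S \<Longrightarrow> u \<in> reach r S A"

text \<open>Decides whether some tree respects the choices made. Necessity is
  \<open>solutions_empty\<close>; sufficiency comes from the search itself, which under this
  condition never gets stuck (\<open>searching_pop\<close>) and keeps it
  (\<open>searching_include\<close>).\<close>

definition extensible :: "nat \<Rightarrow> nat set \<Rightarrow> (nat \<times> nat) set \<Rightarrow> bool" where
  "extensible r S A \<longleftrightarrow> k \<le> card (S \<union> reach r S A)"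

abbreviation extensible_at :: "nat \<Rightarrow> (nat \<Rightarrow> nat) \<Rightarrow> (nat \<Rightarrow> nat) \<Rightarrow> nat \<Rightarrow> bool" where
  "extensible_at r vs ps j \<equiv> extensible r (verts vs j) (pending vs ps j)"

lemma reach_less: "u \<in> reach r S A \<Longrightarrow> (\<And>p u. (p, u) \<in> A \<Longrightarrow> u < r) \<Longrightarrow> u < r"
  by (induction rule: reach.induct) auto

lemma finite_reach: "(\<And>p u. (p, u) \<in> A \<Longrightarrow> u < r) \<Longrightarrow> finite (reach r S A)"
  by (rule finite_subset[of _ "{..<r}"]) (auto dest: reach_less)

lemma finite_verts [simp]: "finite (verts vs m)"
  by (simp add: verts_def)

lemma card_verts: "dfs r vs ps m \<Longrightarrow> j \<le> m \<Longrightarrow> card (verts vs j) = j"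
  unfolding verts_def by (subst card_image) (auto simp: dfs_def elim: inj_on_subset)

lemma in_verts_iff: "dfs r vs ps m \<Longrightarrow> i < m \<Longrightarrow> j \<le> m \<Longrightarrow> vs i \<in> verts vs j \<longleftrightarrow> i < j"
  unfolding verts_def by (auto simp: dfs_eq_iff[of r vs ps m])

text \<open>If \<open>vs x\<close> can be reached without its tree arc, all later tree vertices
  follow, since each hangs on an arc pending at \<open>x\<close> or on a position from
  \<open>x\<close> on. Together with the first \<open>x\<close> vertices this makes
  \<open>k\<close>.\<close>

lemma extensible_at_if_reach:
  assumes d: "dfs r vs ps k" "0 < x" "x < k" and x: "vs x \<in> reach r (verts vs x) (pending vs ps x)"
  shows "extensible_at r vs ps x"
proof -
  let ?R = "reach r (verts vs x) (pending vs ps x)"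
  have R: "vs i \<in> ?R" if "x \<le> i" "i < k" for i
    using that
  proof (induction i rule: less_induct)
    case (less i)
    show ?case
    proof (cases "i = x")
      case False
      have ni: "vs i \<notin> verts vs x"
        using in_verts_iff[OF d(1)] less.prems d by auto
      have l: "adj (vs (ps i)) (vs i)" "vs i < r" "ps i < i"
        using dfs_le[OF d(1), of i] dfs_parent[OF d(1), of i] less.prems d by auto
      have "(vs (ps i), vs i) \<in> pending vs ps x \<or> x \<le> ps i"
        using d less.prems False by (intro arc_in_pending_arcs[OF d(1,2)]) auto
      then show ?thesis
      proof
        assume "x \<le> ps i"
        then have "vs (ps i) \<in> ?R"
          using l less.prems by (intro less.IH) auto
        then show ?thesis
          using l(1,2) ni by (rule reach.extend)
      qed (use ni reach.start in blast)
    qed (use x in simp)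
  qed
  have "verts vs k \<subseteq> verts vs x \<union> ?R"
    using R by (auto simp: verts_def) (metis imageI lessThan_iff not_le)
  moreover have "finite ?R"
    using pending_head[OF d] by (rule finite_reach)
  ultimately have "card (verts vs k) \<le> card (verts vs x \<union> ?R)"
    by (intro card_mono) auto
  then show ?thesis
    using card_verts[OF d(1)] by (simp add: extensible_def)
qed

text \<open>The search backtracks from the last tree vertex to the first one. When every later position
  has turned out not to be extensible, the vertices that remain reachable after dropping \<open>vs j\<close> are
  known: they are exactly the vertices from \<open>y\<close> on, unless one of the remaining arcs leads to \<open>vs j\<close>
  itself or out of the current tree.\<close>

theorem extensible_at_iff:
  assumes d: "dfs r vs ps k" "0 < j" "j < y" "y \<le> k" and desc: "\<And>i. j < i \<Longrightarrow> i < y \<Longrightarrow> j \<le> ps i"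
    and y: "y < k \<Longrightarrow> ps y < j"
    and later: "\<And>i. j < i \<Longrightarrow> i < k \<Longrightarrow> \<not> extensible_at r vs ps i"
  shows "extensible_at r vs ps j \<longleftrightarrow>
    (\<exists>(p, u)\<in>pending vs ps j \<union> arcs_from r vs y k. u = vs j \<or> u \<notin> verts vs k)"
proof -
  let ?R = "\<lambda>x. reach r (verts vs x) (pending vs ps x)"
  let ?Y = "vs ` {y..<k}"
  have jk: "j < k"
    using d by simp
  have base: "pending vs ps y \<subseteq> pending vs ps j" "(vs (ps y), vs y) \<in> pending vs ps j" if "y < k"
  proof -
    show "(vs (ps y), vs y) \<in> pending vs ps j"
      using arc_after_descendants[OF d(1-3) that desc y[OF that]] .
    then show "pending vs ps y \<subseteq> pending vs ps j"
      using that d dfs_parent[OF d(1), of j] by (intro pending_suffix[OF d(1)]) auto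
  qed
  have sub: "pending vs ps j \<subseteq> pending vs ps x" if "j \<le> x" "x < y" for x
    using pending_descendant[OF d(1,2,4) desc that] by blast
  \<comment> \<open>The vertices after the subtree of \<open>vs j\<close> hang on arcs pending at
    \<open>j\<close> or on each other. So they stay reachable when the positions from
    \<open>x\<close> to \<open>y - 1\<close> are dropped, for every \<open>x\<close> in the subtree
    and not only for \<open>x = j\<close>.\<close>
  have Y: "vs i \<in> ?R x" if "j \<le> x" "x < y" "y \<le> i" "i < k" for x i
    using that(3,4)
  proof (induction i rule: less_induct)
    case (less i)
    have ni: "vs i \<notin> verts vs x"
      using in_verts_iff[OF d(1), of i x] less.prems that by auto
    have l: "adj (vs (ps i)) (vs i)" "vs i < r" "ps i < i"
      using dfs_le[OF d(1), of i] dfs_parent[OF d(1), of i] less.prems d by auto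
    have "(vs (ps i), vs i) \<in> pending vs ps j \<or> y \<le> ps i"
      using base less.prems d arc_in_pending_arcs[OF d(1,2), of y i] by (cases "i = y") auto
    then show ?case
    proof
      assume "y \<le> ps i"
      then have "vs (ps i) \<in> ?R x"
        using l less.prems by (intro less.IH) auto
      then show ?case
        using l(1,2) ni by (rule reach.extend)
    qed (use ni sub that reach.start in blast)
  qed
  have fin: "finite (?R x)" if "0 < x" "x < k" for x
    using pending_head[OF d(1) that] by (rule finite_reach)
  have step: "u \<in> ?R x"
    if "(p, u) \<in> pending vs ps j \<union> arcs_from r vs y k" "u \<notin> verts vs x" "j \<le> x" "x < y" for p u x
    using that(1)
  proof
    assume "(p, u) \<in> arcs_from r vs y k"
    then show ?thesis
      using that Y[of x] reach.extend[of p r "verts vs x" "pending vs ps x" u] by (auto simp: arcs_from_def)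
  qed (use that sub reach.start in blast)
  show ?thesis
  proof
    assume "\<exists>(p, u)\<in>pending vs ps j \<union> arcs_from r vs y k. u = vs j \<or> u \<notin> verts vs k"
    then obtain p u where pu: "(p, u) \<in> pending vs ps j \<union> arcs_from r vs y k" "u = vs j \<or> u \<notin> verts vs k"
      by blast
    have nj: "vs j \<notin> verts vs j"
      using in_verts_iff[OF d(1), of j j] jk by simp
    show "extensible_at r vs ps j"
    proof (cases "u = vs j")
      case True
      then have "vs j \<in> ?R j"
        using step[OF pu(1), of j] nj d by simp
      then show ?thesis
        using extensible_at_if_reach[OF d(1,2) jk] by blast
    next
      case False
      then have u: "u \<notin> verts vs k"
        using pu by blast
      \<comment> \<open>A single new vertex outside the tree can replace only a single dropped one,
        so it is the last position of the subtree that is dropped. This shows position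
        \<open>y - 1\<close> to be extensible, and by \<open>later\<close> it must be
        \<open>j\<close> itself.\<close>
      define x where "x = y - 1"
      have x: "j \<le> x" "x < y" "0 < x" "x < k" "Suc x = y"
        using d by (auto simp: x_def)
      have ux: "u \<notin> verts vs x"
        using u x by (auto simp: verts_def)
      have "verts vs x \<union> insert u ?Y \<subseteq> verts vs x \<union> ?R x"
        using Y[of x] step[OF pu(1) ux] x by auto
      then have "card (verts vs x \<union> insert u ?Y) \<le> card (verts vs x \<union> ?R x)"
        using fin[of x] x by (intro card_mono) auto
      moreover have "card (verts vs x \<union> insert u ?Y) = k"
      proof -
        have "verts vs x \<inter> ?Y = {}"
          using in_verts_iff[OF d(1), of _ x] x by auto
        moreover have "card ?Y = k - y"
          using dfs_inj[OF d(1)] by (subst card_image) (auto elim: inj_on_subset)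
        moreover have "u \<notin> verts vs x \<union> ?Y"
          using u ux by (auto simp: verts_def)
        ultimately have "card (insert u (verts vs x \<union> ?Y)) = Suc (x + (k - y))"
          using card_verts[OF d(1), of x] x by (simp add: card_Un_disjoint)
        then show ?thesis
          using x d by simp
      qed
      ultimately have e: "extensible_at r vs ps x"
        by (simp add: extensible_def)
      then have "x = j"
        using later[of x] x by (cases "x = j") auto
      then show ?thesis
        using e by simp
    qed
  next
    assume e: "extensible_at r vs ps j"
    show "\<exists>(p, u)\<in>pending vs ps j \<union> arcs_from r vs y k. u = vs j \<or> u \<notin> verts vs k"
    proof (rule ccontr)
      assume "\<not> ?thesis"
      then have closed: "u \<in> verts vs k \<and> u \<noteq> vs j" if "(p, u) \<in> pending vs ps j \<union> arcs_from r vs y k" for p u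
        using that by blast
      \<comment> \<open>A head at a position strictly between \<open>j\<close> and \<open>y\<close>
        would be reachable without its own tree arc and thus make that position extensible, against
        \<open>later\<close>.\<close>
      have inY: "u \<in> ?Y" if a: "(p, u) \<in> pending vs ps j \<union> arcs_from r vs y k" and u: "u \<notin> verts vs j" for p u
      proof -
        obtain x where x: "x < k" "u = vs x" "x \<noteq> j"
          using closed[OF a] by (auto simp: verts_def)
        then have "j < x"
          using u in_verts_iff[OF d(1), of x j] jk by auto
        have "\<not> x < y"
        proof
          assume "x < y"
          moreover have "vs x \<notin> verts vs x"
            using in_verts_iff[OF d(1), of x x] x by simp
          ultimately have "vs x \<in> ?R x"
            using step[of p "vs x" x] a x \<open>j < x\<close> by simp
          then show False
            using extensible_at_if_reach[OF d(1), of x] later[of x] x \<open>j < x\<close> by simp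
        qed
        then show ?thesis
          using x by simp
      qed
      have "u \<in> ?Y" if "u \<in> ?R j" for u
        using that
      proof (induction rule: reach.induct)
        case (start p u)
        then show ?case
          by (intro inY) auto
      next
        case (extend w u)
        then show ?case
          by (intro inY[of w]) (auto simp: arcs_from_def)
      qed
      then have "verts vs j \<union> ?R j \<subseteq> verts vs j \<union> ?Y"
        by blast
      then have "card (verts vs j \<union> ?R j) \<le> card (verts vs j \<union> ?Y)"
        by (intro card_mono) auto
      \<comment> \<open>The nonempty subtree from \<open>j\<close> to \<open>y - 1\<close> is
        dropped without compensation, which leaves fewer than \<open>k\<close> vertices.\<close>
      also have "\<dots> \<le> j + (k - y)"
        using card_Un_le[of "verts vs j" ?Y] card_verts[OF d(1), of j] card_image_le[of "{y..<k}" vs] jk by simp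
      finally show False
        using e d by (simp add: extensible_def)
    qed
  qed
qed

end

section \<open>Sets of trees determined by partial decisions\<close>

context ordered_graph
begin

text \<open>Exclusions are encoded by absence: an arc out of the chosen vertices \<open>S\<close>
  that is missing from \<open>A\<close> has been rejected. The inclusions are
  \<open>X\<close>.\<close>

definition solutions :: "nat \<Rightarrow> nat set \<Rightarrow> nat set set \<Rightarrow> (nat \<times> nat) set \<Rightarrow> nat set set set" where
  "solutions r S X A = {T \<in> trees. r \<in> \<Union>T \<and> \<Union>T \<subseteq> {..r} \<and> X \<subseteq> T \<and>
     (\<forall>p u. {p, u} \<in> T \<and> p \<in> S \<and> u \<notin> S \<longrightarrow> (p, u) \<in> A)}"

abbreviation solutions_at :: "nat \<Rightarrow> (nat \<Rightarrow> nat) \<Rightarrow> (nat \<Rightarrow> nat) \<Rightarrow> nat \<Rightarrow> nat \<Rightarrow> nat \<Rightarrow> nat set set set" where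
  "solutions_at r vs ps m q c \<equiv> solutions r (verts vs m) (tree_edges vs ps m) (act vs ps q c)"

text \<open>The trees that deviate from the current one at some position \<open>j\<close>, by excluding the arc to \<open>vs j\<close>,
  and the trees with a smaller root.\<close>

definition remaining :: "nat \<Rightarrow> (nat \<Rightarrow> nat) \<Rightarrow> (nat \<Rightarrow> nat) \<Rightarrow> nat \<Rightarrow> nat set set set" where
  "remaining r vs ps m =
     (\<Union>j\<in>{1..<m}. solutions_at r vs ps j (ps j) (vs j)) \<union> {T \<in> trees. \<Union>T \<subseteq> {..<r}}"

lemma finite_tree: "T \<in> trees \<Longrightarrow> finite T" "T \<in> trees \<Longrightarrow> finite (\<Union>T)"
  using k_ge by (auto simp: tree_def intro: card_ge_0_finite)

lemma tree_edges_props: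
  assumes d: "dfs r vs ps m"
  shows "card (tree_edges vs ps m) = m - 1" "\<Union>(tree_edges vs ps m) \<subseteq> verts vs m"
    "2 \<le> m \<Longrightarrow> \<Union>(tree_edges vs ps m) = verts vs m"
    "tree_edges vs ps m \<subseteq> edges"
proof -
  have p: "ps i < i" if "0 < i" "i < m" for i
    using dfs_parent[OF d that] .
  have "inj_on (\<lambda>i. {vs (ps i), vs i}) {1..<m}"
  proof (rule inj_onI)
    fix i j
    assume ij: "i \<in> {1..<m}" "j \<in> {1..<m}" "{vs (ps i), vs i} = {vs (ps j), vs j}"
    show "i = j"
    proof (rule ccontr)
      assume "i \<noteq> j"
      then have "vs i = vs (ps j)" "vs j = vs (ps i)"
        using ij dfs_eq_iff[OF d, of i j] by (auto simp: doubleton_eq_iff)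
      then have "i = ps j" "j = ps i"
        using ij p[of i] p[of j] dfs_eq_iff[OF d, of i "ps j"] dfs_eq_iff[OF d, of j "ps i"] by auto
      then show False
        using ij p[of i] p[of j] by simp
    qed
  qed
  then show "card (tree_edges vs ps m) = m - 1"
    by (simp add: tree_edges_def card_image)
  have "vs (ps i) \<in> verts vs m \<and> vs i \<in> verts vs m" if "0 < i" "i < m" for i
    using p[OF that] that by (auto simp: verts_def)
  then show *: "\<Union>(tree_edges vs ps m) \<subseteq> verts vs m"
    by (auto simp: tree_edges_def)
  show "\<Union>(tree_edges vs ps m) = verts vs m" if "2 \<le> m"
  proof
    show "verts vs m \<subseteq> \<Union>(tree_edges vs ps m)"
    proof
      fix v
      assume "v \<in> verts vs m"
      then obtain i where i: "i < m" "v = vs i"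
        by (auto simp: verts_def)
      show "v \<in> \<Union>(tree_edges vs ps m)"
      proof (cases "i = 0")
        case True
        have "ps 1 = 0"
          using p[of 1] that by simp
        then have "v \<in> {vs (ps 1), vs 1}"
          using i True by simp
        then show ?thesis
          using that unfolding tree_edges_def by force
      next
        case False
        then have "{vs (ps i), vs i} \<in> tree_edges vs ps m"
          using i by (auto simp: tree_edges_def)
        then show ?thesis
          using i by blast
      qed
    qed
  qed (rule *)
  show "tree_edges vs ps m \<subseteq> edges"
    using dfs_le[OF d] unfolding tree_edges_def edges_def by fastforce
qed

lemma tree_tree_edges:
  assumes d: "dfs r vs ps k"
  shows "tree_edges vs ps k \<in> trees"
proof -
  let ?T = "tree_edges vs ps k"
  let ?E = "{(x, y). {x, y} \<in> ?T}"
  have r0: "(vs 0, vs i) \<in> ?E\<^sup>* \<and> (vs i, vs 0) \<in> ?E\<^sup>*" if "i < k" for i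
    using that
  proof (induction i rule: less_induct)
    case (less i)
    show ?case
    proof (cases "i = 0")
      case False
      then have "{vs (ps i), vs i} \<in> ?T" "ps i < i"
        using less.prems dfs_parent[OF d, of i] by (auto simp: tree_edges_def)
      then have "(vs (ps i), vs i) \<in> ?E" "(vs i, vs (ps i)) \<in> ?E"
        by (auto simp: insert_commute)
      then show ?thesis
        using less.IH[OF \<open>ps i < i\<close>] less.prems \<open>ps i < i\<close>
        by (meson less_trans converse_rtrancl_into_rtrancl rtrancl_into_rtrancl)
    qed simp
  qed
  have U: "\<Union>?T = verts vs k"
    using tree_edges_props(3)[OF d k_ge] .
  have "connected_on (\<Union>?T) ?T"
    unfolding connected_on_def U using r0 by (auto simp: verts_def intro: rtrancl_trans)
  then show ?thesis
    using U tree_edges_props[OF d] card_verts[OF d, of k] by (simp add: tree_def)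
qed

text \<open>The \<open>k - 1\<close> edges already included leave no room for further ones, and no
  edge of the tree leaves its vertex set.\<close>

lemma solutions_complete:
  assumes d: "dfs r vs ps k"
  shows "solutions_at r vs ps k q c = {tree_edges vs ps k}"
proof
  show "solutions_at r vs ps k q c \<subseteq> {tree_edges vs ps k}"
  proof
    fix T
    assume T: "T \<in> solutions_at r vs ps k q c"
    then have "T \<in> trees" "tree_edges vs ps k \<subseteq> T"
      by (auto simp: solutions_def)
    then have "tree_edges vs ps k = T"
      using tree_edges_props(1)[OF d] by (intro card_subset_eq finite_tree) (auto simp: tree_def)
    then show "T \<in> {tree_edges vs ps k}"
      by simp
  qed
  have "verts vs k \<subseteq> {..r}" "r \<in> verts vs k"
    using dfs_le[OF d] d k_ge by (auto simp: verts_def dfs_def)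
  moreover have "u \<in> verts vs k" if "{p, u} \<in> tree_edges vs ps k" for p u
    using that tree_edges_props(2)[OF d] by blast
  ultimately show "{tree_edges vs ps k} \<subseteq> solutions_at r vs ps k q c"
    using tree_tree_edges[OF d] tree_edges_props(3)[OF d k_ge] by (auto simp: solutions_def)
qed

text \<open>In a solution, the vertices that lie in \<open>S\<close> or are reachable are closed
  along tree edges and thus comprise the whole tree, so at least \<open>k\<close> vertices would be
  available.\<close>

lemma solutions_empty:
  assumes "\<not> extensible r S A" "r \<in> S" "finite S" "\<And>p u. (p, u) \<in> A \<Longrightarrow> u < r"
  shows "solutions r S X A = {}"
proof (rule ccontr)
  assume "solutions r S X A \<noteq> {}"
  then obtain T where T: "T \<in> trees" "r \<in> \<Union>T" "\<Union>T \<subseteq> {..r}"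
    "\<And>p u. {p, u} \<in> T \<Longrightarrow> p \<in> S \<Longrightarrow> u \<notin> S \<Longrightarrow> (p, u) \<in> A"
    unfolding solutions_def by blast
  let ?Q = "\<Union>T \<inter> (S \<union> reach r S A)"
  have "?Q = \<Union>T"
  proof (rule ccontr)
    assume "?Q \<noteq> \<Union>T"
    then obtain p u where pu: "{p, u} \<in> T" "p \<in> ?Q" "u \<notin> ?Q"
      using connected_onD[of "\<Union>T" T ?Q] T(1,2) assms(2) by (auto simp: tree_def)
    then have u: "u \<in> \<Union>T" "u \<notin> S" "u \<notin> reach r S A"
      by auto
    have "adj p u"
      using pu T(1) adj_if_edge by (auto simp: tree_def)
    moreover have "u < r"
      using u T(3) assms(2) by (metis atMost_iff le_neq_implies_less subsetD)
    ultimately show False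
      using pu u T(4) reach.start[of p u A S r] reach.extend[of p r S A u] by auto
  qed
  then have "card (\<Union>T) \<le> card (S \<union> reach r S A)"
    using assms finite_reach[of A r S] by (intro card_mono) auto
  then show False
    using assms(1) T(1) by (simp add: extensible_def tree_def)
qed

text \<open>Arcs that lead back into \<open>S\<close> have no influence; this is what allows the
  search to skip them.\<close>

lemma solutions_cong:
  assumes "\<And>p u. u \<notin> S \<Longrightarrow> (p, u) \<in> A \<longleftrightarrow> (p, u) \<in> B"
  shows "solutions r S X A = solutions r S X B"
  using assms by (auto simp: solutions_def)

lemma reach_cong:
  assumes "\<And>p u. u \<notin> S \<Longrightarrow> (p, u) \<in> A \<longleftrightarrow> (p, u) \<in> B"
  shows "reach r S A = reach r S B"
proof -
  have "u \<in> reach r S B" if "u \<in> reach r S A" "\<And>p u. u \<notin> S \<Longrightarrow> (p, u) \<in> A \<Longrightarrow> (p, u) \<in> B" for u A B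
    using that by (induction rule: reach.induct) (auto intro: reach.intros)
  then show ?thesis
    using assms by blast
qed

lemma extensible_cong:
  assumes "\<And>p u. u \<notin> S \<Longrightarrow> (p, u) \<in> A \<longleftrightarrow> (p, u) \<in> B"
  shows "extensible r S A \<longleftrightarrow> extensible r S B"
  using reach_cong[of S A B r, OF assms] by (simp add: extensible_def)

text \<open>Trees are split by whether they contain \<open>{p, u}\<close>. From right to left, a
  tree containing this edge might also use a rejected arc from \<open>S\<close> to \<open>u\<close>;
  two edges from the spanned set \<open>S\<close> to \<open>u\<close> are impossible by
  \<open>tree_unique_edge\<close>. The premises on \<open>X\<close> say that \<open>X\<close> spans
  \<open>S\<close>, the single root having no edge.\<close>

lemma solutions_branch:
  assumes e: "p \<in> S" "u \<notin> S" "(p, u) \<in> A" "r \<in> S" "\<And>p u. (p, u) \<in> A \<Longrightarrow> p \<in> S"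
    and X: "\<Union>X \<subseteq> S" "card S \<le> Suc (card X)" "X = {} \<Longrightarrow> S = {r}" "X \<noteq> {} \<Longrightarrow> S \<subseteq> \<Union>X"
  shows "solutions r S X A = solutions r S X (A - {(p, u)}) \<union>
    solutions r (insert u S) (insert {p, u} X) (A - {(p, u)} \<union> {(u, w) | w. adj u w \<and> w < r})"
    (is "_ = _ \<union> solutions r ?S ?X ?A")
proof
  show "solutions r S X A \<subseteq> solutions r S X (A - {(p, u)}) \<union> solutions r ?S ?X ?A"
  proof
    fix T
    assume T: "T \<in> solutions r S X A"
    show "T \<in> solutions r S X (A - {(p, u)}) \<union> solutions r ?S ?X ?A"
    proof (cases "{p, u} \<in> T")
      case True
      have "(p', u') \<in> ?A" if a: "{p', u'} \<in> T" "p' \<in> ?S" "u' \<notin> ?S" for p' u'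
      proof (cases "p' \<in> S")
        case True
        then show ?thesis
          using T a by (auto simp: solutions_def)
      next
        case False
        then have "p' = u"
          using a by simp
        moreover have "u' \<in> \<Union>T" "u' \<noteq> r"
          using a e by auto
        then have "u' < r"
          using T by (auto simp: solutions_def)
        moreover have "adj p' u'"
          using a T adj_if_edge by (auto simp: solutions_def tree_def)
        ultimately show ?thesis
          by simp
      qed
      then show ?thesis
        using T True by (auto simp: solutions_def)
    next
      case False
      then have "T \<in> solutions r S X (A - {(p, u)})"
        using T by (auto simp: solutions_def)
      then show ?thesis
        by blast
    qed
  qed
  have "T \<in> solutions r S X A" if T: "T \<in> solutions r ?S ?X ?A" for T
  proof -
    have t: "T \<in> trees" "r \<in> \<Union>T" "X \<subseteq> T" "{p, u} \<in> T"
      using T by (auto simp: solutions_def)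
    have "S \<subseteq> \<Union>T"
      using X(3,4) t by (cases "X = {}") auto
    have "(p', u') \<in> A" if a: "{p', u'} \<in> T" "p' \<in> S" "u' \<notin> S" for p' u'
    proof (cases "u' = u")
      case True
      then have "p = p'"
        using tree_unique_edge[of edges k T X S p u p'] t k_ge X(1,2) \<open>S \<subseteq> \<Union>T\<close> e a by blast
      then show ?thesis
        using True e by simp
    next
      case False
      then have "(p', u') \<in> ?A"
        using T a by (auto simp: solutions_def)
      then show ?thesis
        using a e by auto
    qed
    then show ?thesis
      using T by (auto simp: solutions_def)
  qed
  then show "solutions r S X (A - {(p, u)}) \<union> solutions r ?S ?X ?A \<subseteq> solutions r S X A"
    by (auto simp: solutions_def)
qed

text \<open>Including an arc moves \<open>u\<close> from the reachable to the chosen vertices and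
  opens its own arcs, so the union of both kinds does not change. An inclusion therefore never
  destroys extensibility.\<close>

lemma reach_branch:
  assumes "u \<notin> S" "(p, u) \<in> A" "r \<in> S" "\<And>p u. (p, u) \<in> A \<Longrightarrow> u < r"
  shows "insert u (reach r (insert u S) (A - {(p, u)} \<union> {(u, w) | w. adj u w \<and> w < r})) = reach r S A"
    (is "insert u ?R = _")
proof
  have "v \<in> reach r S A" if "v \<in> ?R" for v
    using that
  proof (induction rule: reach.induct)
    case (start q v)
    then show ?case
      using reach.start[OF assms(2,1), of r] by (auto intro: reach.intros)
  qed (auto intro: reach.extend)
  then show "insert u ?R \<subseteq> reach r S A"
    using reach.start[OF assms(2,1), of r] by blast
  have "v = u \<or> v \<in> ?R" if "v \<in> reach r S A" for v
    using that
  proof (induction rule: reach.induct)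
    case (start q v)
    then show ?case
      by (auto intro!: reach.start[of q])
  next
    case (extend w v)
    then show ?case
      using reach.start[of u v "A - {(p, u)} \<union> {(u, w) | w. adj u w \<and> w < r}" "insert u S" r]
        reach.extend[of w r "insert u S" "A - {(p, u)} \<union> {(u, w) | w. adj u w \<and> w < r}" v]
      by auto
  qed
  then show "reach r S A \<subseteq> insert u ?R"
    by blast
qed

text \<open>The search state: the first \<open>m\<close> entries of the depth-first list are fixed, and the next arc
  is sought among the children of \<open>vs q\<close> below \<open>c\<close>.\<close>

definition searching :: "nat \<Rightarrow> (nat \<Rightarrow> nat) \<Rightarrow> (nat \<Rightarrow> nat) \<Rightarrow> nat \<Rightarrow> nat \<Rightarrow> nat \<Rightarrow> bool" where
  "searching r vs ps m q c \<longleftrightarrow> dfs r vs ps m \<and> m \<le> k \<and> q < m \<and> c \<le> r \<and>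
     act vs ps q c \<subseteq> act vs ps (m - 1) r \<and> extensible r (verts vs m) (act vs ps q c)"

definition todo :: "nat \<Rightarrow> (nat \<Rightarrow> nat) \<Rightarrow> (nat \<Rightarrow> nat) \<Rightarrow> nat \<Rightarrow> nat \<Rightarrow> nat \<Rightarrow> nat set set set" where
  "todo r vs ps m q c = solutions_at r vs ps m q c \<union> remaining r vs ps m"

lemma searching_skip:
  assumes s: "searching r vs ps m q c" and u: "u < c" "u \<in> verts vs m"
    "\<And>v. u < v \<Longrightarrow> v < c \<Longrightarrow> \<not> adj (vs q) v"
  shows "searching r vs ps m q u \<and> todo r vs ps m q u = todo r vs ps m q c"
proof -
  have "(p, w) \<in> act vs ps q u \<longleftrightarrow> (p, w) \<in> act vs ps q c" if "w \<notin> verts vs m" for p w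
  proof -
    have "adj (vs q) w \<Longrightarrow> w < c \<longleftrightarrow> w < u"
      using u that by (metis linorder_neqE_nat less_trans)
    then show ?thesis
      by (subst (1 2) act.simps) auto
  qed
  then have "extensible r (verts vs m) (act vs ps q u) \<longleftrightarrow> extensible r (verts vs m) (act vs ps q c)"
    "solutions_at r vs ps m q u = solutions_at r vs ps m q c"
    by (intro extensible_cong solutions_cong; simp)+
  then show ?thesis
    using s u act_mono[of u c vs ps q] by (auto simp: searching_def todo_def)
qed

text \<open>The stack cannot run empty before \<open>k\<close> vertices are chosen: an exhausted
  root would leave nothing reachable beyond the \<open>m < k\<close> tree vertices, against
  extensibility. So growing a tree has no failure case.\<close>

lemma searching_pop:
  assumes s: "searching r vs ps m q c" and m: "m < k" and u: "\<And>v. v < c \<Longrightarrow> \<not> adj (vs q) v"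
  shows "0 < q \<and> ps q < q \<and> searching r vs ps m (ps q) (vs q) \<and>
    todo r vs ps m (ps q) (vs q) = todo r vs ps m q c"
proof -
  have d: "dfs r vs ps m" and q: "q < m"
    using s by (auto simp: searching_def)
  have "0 < q"
  proof (rule ccontr)
    assume "\<not> 0 < q"
    then have a: "act vs ps q c = {}"
      using u act_root[of vs ps c] by auto
    have "reach r (verts vs m) {} = {}"
    proof -
      have "False" if "x \<in> reach r (verts vs m) {}" for x
        using that by (induction rule: reach.induct) auto
      then show ?thesis
        by blast
    qed
    then have "k \<le> card (verts vs m)"
      using s a by (simp add: searching_def extensible_def)
    then show False
      using card_verts[OF d, of m] m by simp
  qed
  then have "act vs ps q c = pending vs ps q"
    using act_step[OF d _ q] u by auto
  then show ?thesis
    using s dfs_parent[OF d \<open>0 < q\<close> q] dfs_le[OF d q] \<open>0 < q\<close>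
    by (simp add: searching_def todo_def)
qed

lemma searching_include:
  assumes s: "searching r vs ps m q c" and m: "m < k" and u: "u < c" "adj (vs q) u" "u \<notin> verts vs m"
    and max: "\<And>v. u < v \<Longrightarrow> v < c \<Longrightarrow> \<not> adj (vs q) v"
  shows "searching r (vs(m := u)) (ps(m := q)) (Suc m) m r \<and>
    todo r (vs(m := u)) (ps(m := q)) (Suc m) m r = todo r vs ps m q c"
proof -
  let ?vs = "vs(m := u)" and ?ps = "ps(m := q)"
  have d: "dfs r vs ps m" and q: "q < m" and m0: "1 \<le> m" and c: "c \<le> r"
    using s by (auto simp: searching_def dfs_def)
  have act: "act ?vs ?ps i c' = act vs ps i c'" if "i < m" for i c'
    using that by (intro act_cong) auto
  have verts: "verts ?vs j = verts vs j" if "j \<le> m" for j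
    using that by (auto simp: verts_def)
  have vertsS: "verts ?vs (Suc m) = insert u (verts vs m)"
    by (auto simp: verts_def lessThan_Suc)
  have tes: "tree_edges ?vs ?ps j = tree_edges vs ps j" if "j \<le> m" for j
    unfolding tree_edges_def
  proof (rule image_cong)
    fix i
    assume i: "i \<in> {1..<j}"
    then have "i < m" "ps i < m"
      using that dfs_parent[OF d, of i] by auto
    then show "{?vs (?ps i), ?vs i} = {vs (ps i), vs i}"
      by simp
  qed simp
  have teS: "tree_edges ?vs ?ps (Suc m) = insert {vs q, u} (tree_edges vs ps m)"
  proof -
    have "{1..<Suc m} = insert m {1..<m}"
      using m0 by auto
    then have "tree_edges ?vs ?ps (Suc m) = insert {?vs (?ps m), ?vs m} (tree_edges ?vs ?ps m)"
      by (simp only: tree_edges_def image_insert)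
    then show ?thesis
      using tes[of m] q by simp
  qed
  have arc: "(vs q, u) \<in> act vs ps q c"
    using u by (subst act.simps) auto
  have i': "inj_on ?vs {..<Suc m}"
    using dfs_inj[OF d] u(3) by (auto simp: inj_on_def verts_def)
  have ps: "ps i < m" if "0 < i" "i < m" for i
    using dfs_parent[OF d that] that by simp
  have d': "dfs r ?vs ?ps (Suc m)"
    unfolding dfs_def
  proof (intro conjI allI impI i')
    show "?vs 0 = r"
      using d m0 by (simp add: dfs_def)
    fix i
    assume i: "0 < i \<and> i < Suc m"
    show "?ps i < i"
      using i d q by (auto simp: dfs_def less_Suc_eq)
    \<comment> \<open>For the new position this uses the inclusion kept in \<open>searching\<close>:
      the current stack is part of the stack \<open>act vs ps (m - 1) r\<close> right after the last
      inclusion.\<close>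
    show "(?vs (?ps i), ?vs i) \<in> act ?vs ?ps (i - 1) r"
    proof (cases "i = m")
      case True
      then show ?thesis
        using s q arc act[of "m - 1" r] m0 by (auto simp: searching_def)
    next
      case False
      then have "i < m"
        using i by simp
      then show ?thesis
        using i ps[of i] dfs_arc[OF d, of i] act[of "i - 1" r] by simp
    qed
  qed simp
  have mem: "p \<in> verts vs m" if "(p, w) \<in> act vs ps q c" for p w
    using act_tail[OF that] q by (auto simp: verts_def)
  have head: "w < r" if "(p, w) \<in> act vs ps q c" for p w
    using dfs_act_head[OF d q c that] .
  have rm: "r \<in> verts vs m"
    using d by (auto simp: verts_def dfs_def)
  \<comment> \<open>No neighbour lies strictly between \<open>u\<close> and \<open>c\<close>, so
    lowering the bound to \<open>u\<close> removes exactly one arc.\<close>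
  have rest: "act vs ps q u = act vs ps q c - {(vs q, u)}"
  proof -
    have "{(vs q, w) | w. adj (vs q) w \<and> w < u} = {(vs q, w) | w. adj (vs q) w \<and> w < c} - {(vs q, u)}"
    proof -
      have "w < u \<or> w = u" if "adj (vs q) w" "w < c" for w
        using max[of w] that by linarith
      then show ?thesis
        using u by auto
    qed
    moreover have "(vs q, u) \<notin> pending vs ps q" if q': "ps q < q"
    proof
      assume "(vs q, u) \<in> pending vs ps q"
      then obtain t where "t \<le> ps q" "vs q = vs t"
        using act_tail by blast
      then show False
        using dfs_eq_iff[OF d, of q t] q q' by auto
    qed
    ultimately show ?thesis
      by (subst (1 2) act.simps) auto
  qed
  have pend: "act ?vs ?ps m r = act vs ps q c - {(vs q, u)} \<union> {(u, w) | w. adj u w \<and> w < r}"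
    using act_step[OF d', of m r] act[OF q] q m0 rest by auto
  have br: "solutions_at r vs ps m q c = solutions_at r vs ps m q u \<union> solutions_at r ?vs ?ps (Suc m) m r"
    unfolding pend vertsS teS rest
  proof (rule solutions_branch)
    show "vs q \<in> verts vs m"
      using q by (auto simp: verts_def)
    show "card (verts vs m) \<le> Suc (card (tree_edges vs ps m))"
      using card_verts[OF d] tree_edges_props(1)[OF d] by simp
    show "verts vs m = {r}" if "tree_edges vs ps m = {}"
    proof -
      have "m = 1"
        using that tree_edges_props(1)[OF d] m0 by simp
      then show ?thesis
        using d by (auto simp: verts_def dfs_def)
    qed
    show "verts vs m \<subseteq> \<Union>(tree_edges vs ps m)" if "tree_edges vs ps m \<noteq> {}"
    proof -
      have "2 \<le> m"
        using that by (auto simp: tree_edges_def)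
      then show ?thesis
        using tree_edges_props(3)[OF d] by simp
    qed
  qed (use u arc rm mem tree_edges_props(2)[OF d] in auto)
  have rem: "remaining r ?vs ?ps (Suc m) = solutions_at r vs ps m q u \<union> remaining r vs ps m"
  proof -
    have "{1..<Suc m} = insert m {1..<m}"
      using m0 by auto
    moreover have "solutions_at r ?vs ?ps j (?ps j) (?vs j) = solutions_at r vs ps j (ps j) (vs j)"
      if "j \<in> {1..<m}" for j
      using that verts[of j] tes[of j] act[of "ps j"] ps[of j] by simp
    moreover have "solutions_at r ?vs ?ps m (?ps m) (?vs m) = solutions_at r vs ps m q u"
      using verts[of m] tes[of m] act[of q u] q by simp
    ultimately show ?thesis
      unfolding remaining_def by auto
  qed
  have "extensible r (verts ?vs (Suc m)) (act ?vs ?ps m r)"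
  proof -
    have "insert u (verts vs m \<union> reach r (insert u (verts vs m)) (act ?vs ?ps m r)) =
      verts vs m \<union> reach r (verts vs m) (act vs ps q c)"
    proof -
      have "insert u (reach r (insert u (verts vs m)) (act ?vs ?ps m r)) = reach r (verts vs m) (act vs ps q c)"
        unfolding pend by (rule reach_branch[OF u(3) arc rm]) (rule head)
      then show ?thesis
        by blast
    qed
    then show ?thesis
      using s unfolding vertsS by (simp add: extensible_def searching_def)
  qed
  then show ?thesis
    using d' m br rem by (auto simp: searching_def todo_def)
qed

text \<open>The third claim prevents repetitions. At each deviation \<open>j\<close> the tree itself
  uses the arc to \<open>vs j\<close>, which is no longer pending, and trees with a smaller root do
  not contain \<open>r\<close>.\<close>

lemma todo_complete:
  assumes s: "searching r vs ps k q c"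
  shows "tree_edges vs ps k \<in> trees"
    "todo r vs ps k q c = insert (tree_edges vs ps k) (remaining r vs ps k)"
    "tree_edges vs ps k \<notin> remaining r vs ps k"
proof -
  have d: "dfs r vs ps k"
    using s by (simp add: searching_def)
  show "tree_edges vs ps k \<in> trees"
    by (rule tree_tree_edges[OF d])
  show "todo r vs ps k q c = insert (tree_edges vs ps k) (remaining r vs ps k)"
    using solutions_complete[OF d] by (simp add: todo_def)
  have "tree_edges vs ps k \<notin> solutions_at r vs ps j (ps j) (vs j)" if j: "0 < j" "j < k" for j
  proof
    assume a: "tree_edges vs ps k \<in> solutions_at r vs ps j (ps j) (vs j)"
    have "{vs (ps j), vs j} \<in> tree_edges vs ps k"
      using j by (auto simp: tree_edges_def)
    moreover have "vs (ps j) \<in> verts vs j" "vs j \<notin> verts vs j"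
      using in_verts_iff[OF d, of _ j] dfs_parent[OF d j] j by auto
    ultimately show False
      using a arc_not_pending[OF d j] by (auto simp: solutions_def)
  qed
  moreover have "r \<in> \<Union>(tree_edges vs ps k)"
    using tree_edges_props(3)[OF d k_ge] d by (auto simp: verts_def dfs_def)
  ultimately show "tree_edges vs ps k \<notin> remaining r vs ps k"
    by (auto simp: remaining_def)
qed

lemma remaining_pop:
  assumes d: "dfs r vs ps k" and j: "0 < j" "j < k" and e: "\<not> extensible_at r vs ps j"
  shows "remaining r vs ps (Suc j) = remaining r vs ps j"
proof -
  have "r \<in> verts vs j"
    using d j by (auto simp: verts_def dfs_def)
  then have "solutions_at r vs ps j (ps j) (vs j) = {}"
    using pending_head[OF d j] by (intro solutions_empty[OF e]) auto
  moreover have "{1..<Suc j} = insert j {1..<j}"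
    using j by auto
  ultimately show ?thesis
    by (simp add: remaining_def)
qed

text \<open>Starting again at \<open>(ps j, vs j)\<close> restores the stack left when the arc to
  \<open>vs j\<close> was taken; that arc is excluded because the bound is strict.\<close>

lemma searching_resume:
  assumes d: "dfs r vs ps k" and j: "0 < j" "j < k" and e: "extensible_at r vs ps j"
  shows "searching r vs ps j (ps j) (vs j)" "todo r vs ps j (ps j) (vs j) = remaining r vs ps (Suc j)"
proof -
  have "pending vs ps j \<subseteq> act vs ps (j - 1) r"
    using dfs_arc[OF d j] j by (intro pending_suffix[OF d]) auto
  then show "searching r vs ps j (ps j) (vs j)"
    using dfs_prefix[OF d, of j] j e dfs_parent[OF d j] dfs_le[OF d, of j] by (simp add: searching_def)
  have "{1..<Suc j} = insert j {1..<j}"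
    using j by auto
  then show "todo r vs ps j (ps j) (vs j) = remaining r vs ps (Suc j)"
    by (auto simp: todo_def remaining_def)
qed

lemma remaining_1: "remaining r vs ps 1 = {T \<in> trees. \<Union>T \<subseteq> {..<r}}"
  by (simp add: remaining_def)

lemma no_small_trees: "r < k \<Longrightarrow> {T \<in> trees. \<Union>T \<subseteq> {..<r}} = {}"
proof -
  have "k \<le> r" if "T \<in> trees" "\<Union>T \<subseteq> {..<r}" for T
    using that card_mono[of "{..<r}" "\<Union>T"] by (simp add: tree_def)
  then show "r < k \<Longrightarrow> {T \<in> trees. \<Union>T \<subseteq> {..<r}} = {}"
    by force
qed

lemma all_trees: "trees = {T \<in> trees. \<Union>T \<subseteq> {..<n}}"
proof -
  have "x < n" if "T \<in> trees" "e \<in> T" "x \<in> e" for T e x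
  proof -
    have "e \<in> edges"
      using that by (auto simp: tree_def)
    then show ?thesis
      using that(3) adj_less adj_sym by (auto simp: edges_def)
  qed
  then show ?thesis
    by blast
qed

text \<open>By \<open>low\<close> the vertices up to \<open>r\<close> induce a connected graph, so that no root \<open>r \<ge> k - 1\<close> is fruitless.\<close>

lemma searching_root:
  assumes low: "\<And>i. 0 < i \<Longrightarrow> i < n \<Longrightarrow> \<exists>u<i. adj i u" and r: "r < n" "k \<le> Suc r" and v: "vs 0 = r"
  shows "searching r vs ps 1 0 r" "todo r vs ps 1 0 r = {T \<in> trees. \<Union>T \<subseteq> {..<Suc r}}"
proof -
  let ?A = "act vs ps 0 r"
  have A: "?A = {(r, u) | u. adj r u \<and> u < r}"
    using act_root[of vs ps r] v by simp
  have V: "verts vs 1 = {r}"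
    using v by (simp add: verts_def lessThan_Suc)
  \<comment> \<open>Smaller neighbours lead from any reachable vertex down to 0 without meeting
    \<open>r\<close>. From 0 the same kind of edges is then followed upwards, to every label below
    \<open>r\<close>.\<close>
  have down: "0 \<in> reach r {r} ?A" if "u \<in> reach r {r} ?A" for u
    using that
  proof (induction u rule: less_induct)
    case (less u)
    have "u < r"
      using less.prems A by (auto dest: reach_less)
    show ?case
    proof (cases "u = 0")
      case False
      then obtain w where w: "w < u" "adj u w"
        using low[of u] \<open>u < r\<close> r by auto
      then have "w \<in> reach r {r} ?A"
        using less.prems \<open>u < r\<close> reach.extend[of u r "{r}" ?A w] by auto
      then show ?thesis
        using less.IH w by blast
    qed (use less.prems in simp)
  qed
  obtain u where "u < r" "adj r u"
    using low[of r] r k_ge by auto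
  then have "u \<in> reach r {r} ?A"
    using A by (intro reach.start[of r]) auto
  then have zero: "0 \<in> reach r {r} ?A"
    by (rule down)
  have "i \<in> reach r {r} ?A" if "i < r" for i
    using that
  proof (induction i rule: less_induct)
    case (less i)
    show ?case
    proof (cases "i = 0")
      case False
      then obtain w where w: "w < i" "adj i w"
        using low[of i] less.prems r by auto
      then have "w \<in> reach r {r} ?A"
        using less by simp
      then show ?thesis
        using w less.prems adj_sym reach.extend[of w r "{r}" ?A i] by auto
    qed (use zero in simp)
  qed
  then have "{..r} \<subseteq> {r} \<union> reach r {r} ?A"
    by (auto simp: le_less)
  moreover have "finite (reach r {r} ?A)"
    using A by (intro finite_reach) auto
  ultimately have "card {..r} \<le> card ({r} \<union> reach r {r} ?A)"
    by (intro card_mono) auto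
  then have "extensible r (verts vs 1) ?A"
    using r unfolding V extensible_def by simp
  then show "searching r vs ps 1 0 r"
    using v k_ge by (auto simp: searching_def dfs_def lessThan_Suc)
  have "T \<in> solutions r {r} {} ?A \<or> \<Union>T \<subseteq> {..<r}" if T: "T \<in> trees" "\<Union>T \<subseteq> {..<Suc r}" for T
  proof (cases "r \<in> \<Union>T")
    case True
    have "(r, w) \<in> ?A" if w: "{r, w} \<in> T" "w \<noteq> r" for w
    proof -
      have "w < Suc r"
        using T w by blast
      moreover have "adj r w"
        using T w adj_if_edge by (auto simp: tree_def)
      ultimately show ?thesis
        using w A by simp
    qed
    then show ?thesis
      using T True by (auto simp: solutions_def less_Suc_eq_le)
  next
    case False
    have "x < r" if "x \<in> \<Union>T" for x
      using that T(2) False less_antisym by blast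
    then show ?thesis
      by auto
  qed
  moreover have "tree_edges vs ps 1 = {}"
    by (simp add: tree_edges_def)
  ultimately show "todo r vs ps 1 0 r = {T \<in> trees. \<Union>T \<subseteq> {..<Suc r}}"
    unfolding todo_def V remaining_1 by (auto simp: solutions_def less_Suc_eq_le)
qed

end

section \<open>The search as a program\<close>

abbreviation (input) RN :: nat where "RN \<equiv> 2"
abbreviation (input) RK :: nat where "RK \<equiv> 3"
abbreviation (input) RONE :: nat where "RONE \<equiv> 4"
abbreviation (input) RR :: nat where "RR \<equiv> 5"
abbreviation (input) RM :: nat where "RM \<equiv> 6"
abbreviation (input) RQ :: nat where "RQ \<equiv> 7"
abbreviation (input) RC :: nat where "RC \<equiv> 8"
abbreviation (input) RX :: nat where "RX \<equiv> 9"
abbreviation (input) RT :: nat where "RT \<equiv> 10"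
abbreviation (input) RI :: nat where "RI \<equiv> 11"
abbreviation (input) RJ :: nat where "RJ \<equiv> 12"
abbreviation (input) RV :: nat where "RV \<equiv> 13"
abbreviation (input) RF :: nat where "RF \<equiv> 14"
abbreviation (input) RW :: nat where "RW \<equiv> 15"
abbreviation (input) RY :: nat where "RY \<equiv> 16"
abbreviation (input) RG :: nat where "RG \<equiv> 17"
abbreviation (input) RP :: nat where "RP \<equiv> 18"
abbreviation (input) RS :: nat where "RS \<equiv> 19"
abbreviation (input) RL :: nat where "RL \<equiv> 20"

abbreviation (input) ADJ :: nat where "ADJ \<equiv> 2"
abbreviation (input) LAB :: nat where "LAB \<equiv> 3"
abbreviation (input) ORD :: nat where "ORD \<equiv> 4"
abbreviation (input) NXT :: nat where "NXT \<equiv> 5"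
abbreviation (input) VS :: nat where "VS \<equiv> 6"
abbreviation (input) PS :: nat where "PS \<equiv> 7"
abbreviation (input) INL :: nat where "INL \<equiv> 8"
abbreviation (input) OUTF :: nat where "OUTF \<equiv> 9"
abbreviation (input) OUTS :: nat where "OUTS \<equiv> 10"

function depth :: "(nat \<Rightarrow> nat) \<Rightarrow> nat \<Rightarrow> nat" where
  "depth ps q = (if ps q < q then Suc (depth ps (ps q)) else 0)"
  by auto
termination
  by (relation "measure snd") auto

declare depth.simps [simp del]

lemma depth_le: "depth ps q \<le> q"
proof (induction q rule: less_induct)
  case (less q)
  then show ?case
    by (subst depth.simps) (use less_le_trans in force)
qed

lemma depth_cong: "(\<And>i. i \<le> q \<Longrightarrow> ps i = ps' i) \<Longrightarrow> depth ps q = depth ps' q"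
proof (induction q rule: less_induct)
  case (less q)
  have "ps q < q \<Longrightarrow> depth ps (ps q) = depth ps' (ps q)"
    using less.prems by (intro less.IH) auto
  then show ?case
    using less.prems[of q] by (subst (1 2) depth.simps) auto
qed

text \<open>Each iteration consumes one entry of the neighbour table: it skips a tree vertex,
  returns to the parent, or includes a new vertex. A loop can only test a register for zero, hence
  \<open>RT\<close> holding \<open>k - m\<close>.\<close>

definition DESCEND :: com where
  "DESCEND = OP MINUS RT RK RM ;; WHILE RT (
     GET RW VS RQ ;; OP TIMES RX RW RN ;; OP PLUS RX RX RC ;; GET RX NXT RX ;;
     IF RX (OP MINUS RX RX RONE ;; GET RY INL RX ;;
       IF RY (COPY RC RX)
         (PUT VS RM RX ;; PUT PS RM RQ ;; PUT INL RX RONE ;; COPY RQ RM ;; OP PLUS RM RM RONE ;; COPY RC RR))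
       (COPY RC RW ;; GET RQ PS RQ) ;;
     OP MINUS RT RK RM)"

lemma index_less: "w < n \<Longrightarrow> c < n \<Longrightarrow> w * n + c < n * (n :: nat)"
proof -
  assume "w < n" "c < n"
  then have "w * n + c < Suc w * n" "Suc w * n \<le> n * n"
    by (auto simp del: mult_Suc intro: mult_le_mono1) simp
  then show ?thesis
    by linarith
qed

locale roomy_machine = machine inp base wmax gap
  for inp :: "nat \<Rightarrow> nat" and base wmax gap n :: nat +
  assumes room: "cell 16 (n * n) \<le> wmax"
begin

lemma fits:
  "i \<le> n * n \<Longrightarrow> cell 16 i \<le> wmax" "i \<le> n * n \<Longrightarrow> i \<le> wmax"
  "i \<le> n \<Longrightarrow> cell 16 i \<le> wmax" "i \<le> n \<Longrightarrow> i \<le> wmax" "i \<le> base \<Longrightarrow> i \<le> wmax"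
  using room le_square[of n] unfolding cell_def by linarith+

lemma index_fits:
  assumes "w < n" "c < n"
  shows "w * n \<le> wmax" "w * n + c \<le> wmax" "cell 16 (w * n + c) \<le> wmax"
proof -
  have "w * n + c \<le> n * n"
    using index_less[OF assms] by simp
  then show "w * n + c \<le> wmax" "cell 16 (w * n + c) \<le> wmax"
    by (simp_all only: fits(1,2))
  then show "w * n \<le> wmax"
    by simp
qed

end

locale lister = ordered_graph adj n k + roomy_machine inp base wmax gap n
  for adj :: "nat \<Rightarrow> nat \<Rightarrow> bool" and n k :: nat and inp :: "nat \<Rightarrow> nat" and base wmax gap :: nat +
  assumes k_le: "k \<le> n"
begin

definition globals :: "state \<Rightarrow> bool" where
  "globals s \<longleftrightarrow> regs s RN = n \<and> regs s RK = k \<and> regs s RONE = 1"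

text \<open>Neighbours are stored shifted by one, so that 0 can mean that none is left.\<close>

definition next_ok :: "(nat \<Rightarrow> nat) \<Rightarrow> bool" where
  "next_ok f \<longleftrightarrow> (\<forall>w<n. \<forall>c<n.
     (f (w * n + c) = 0 \<longrightarrow> (\<forall>u<c. \<not> adj w u)) \<and>
     (\<forall>u. f (w * n + c) = Suc u \<longrightarrow> u < c \<and> adj w u \<and> (\<forall>v. u < v \<and> v < c \<longrightarrow> \<not> adj w v)))"

definition marks :: "nat set \<Rightarrow> (nat \<Rightarrow> nat) \<Rightarrow> bool" where
  "marks S f \<longleftrightarrow> (\<forall>v<n. f v = (if v \<in> S then 1 else 0))"

text \<open>Bounds the number of iterations of \<open>DESCEND\<close>. Including a vertex pays \<open>2 * (k + 2)\<close> for one more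
  level of depth and for up to \<open>k\<close> tree vertices below the new bound.\<close>

definition fuel :: "(nat \<Rightarrow> nat) \<Rightarrow> (nat \<Rightarrow> nat) \<Rightarrow> nat \<Rightarrow> nat \<Rightarrow> nat \<Rightarrow> nat" where
  "fuel vs ps m q c = (k - m) * (2 * (k + 2)) + depth ps q * (k + 2) + card {v \<in> verts vs m. v < c}"

lemma card_filter_verts: "searching r vs ps m q c \<Longrightarrow> card {v \<in> verts vs m. P v} \<le> k"
  using card_mono[of "verts vs m" "{v \<in> verts vs m. P v}"] card_verts[of r vs ps m m]
  by (simp add: searching_def)

lemma fuel_le:
  assumes "searching r vs ps m q c"
  shows "fuel vs ps m q c \<le> 8 * k\<^sup>2"
proof -
  have *: "m \<le> k" "q \<le> k"
    using assms by (auto simp: searching_def)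
  have "(k - m) * (2 * (k + 2)) \<le> k * (2 * (k + 2))"
    by (intro mult_le_mono1) simp
  moreover have "depth ps q * (k + 2) \<le> k * (k + 2)"
    using depth_le[of ps q] * by (intro mult_le_mono1) simp
  moreover have "card {v \<in> verts vs m. v < c} \<le> k"
    by (rule card_filter_verts[OF assms])
  ultimately have "fuel vs ps m q c \<le> k * (2 * (k + 2)) + k * (k + 2) + k"
    unfolding fuel_def by (intro add_mono)
  \<comment> \<open>The sum is \<open>3 * k^2 + 7 * k\<close>, and
    \<open>7 * k \<le> 5 * k^2\<close> because of \<open>k \<ge> 2\<close>.\<close>
  also have "\<dots> \<le> 8 * k\<^sup>2"
    using k_ge by (simp add: power2_eq_square algebra_simps)
  finally show ?thesis .
qed

lemma fuel_skip:
  assumes "u < c" "u \<in> verts vs m"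
  shows "fuel vs ps m q u < fuel vs ps m q c"
proof -
  have "{v \<in> verts vs m. v < u} \<subset> {v \<in> verts vs m. v < c}"
    using assms by auto
  then have "card {v \<in> verts vs m. v < u} < card {v \<in> verts vs m. v < c}"
    by (intro psubset_card_mono) auto
  then show ?thesis
    by (simp add: fuel_def)
qed

text \<open>The level of depth given up is worth \<open>k + 2\<close>, which covers the at most
  \<open>k\<close> tree vertices below the new bound \<open>vs q\<close>.\<close>

lemma fuel_pop:
  assumes "searching r vs ps m (ps q) (vs q)" "ps q < q"
  shows "fuel vs ps m (ps q) (vs q) < fuel vs ps m q c"
proof -
  have "depth ps q = Suc (depth ps (ps q))"
    using assms by (subst depth.simps) simp
  moreover have "card {v \<in> verts vs m. v < vs q} \<le> k"
    by (rule card_filter_verts[OF assms(1)])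
  ultimately show ?thesis
    by (simp add: fuel_def)
qed

lemma fuel_include:
  assumes "searching r (vs(m := u)) (ps(m := q)) (Suc m) m r" "q < m" "m < k"
  shows "fuel (vs(m := u)) (ps(m := q)) (Suc m) m r < fuel vs ps m q c"
proof -
  have "depth (ps(m := q)) m = Suc (depth (ps(m := q)) q)"
    using assms by (subst depth.simps) simp
  also have "depth (ps(m := q)) q = depth ps q"
    using assms by (intro depth_cong) auto
  finally have "depth (ps(m := q)) m = Suc (depth ps q)" .
  moreover have "card {v \<in> verts (vs(m := u)) (Suc m). v < r} \<le> k"
    by (rule card_filter_verts[OF assms(1)])
  moreover have "k - m = Suc (k - Suc m)"
    using assms by simp
  then have "(k - m) * (2 * (k + 2)) = (k - Suc m) * (2 * (k + 2)) + 2 * (k + 2)"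
    by simp
  ultimately show ?thesis
    unfolding fuel_def by simp
qed

lemma searching_bounds:
  assumes "searching r vs ps m q c" "r < n"
  shows "q < m" "m \<le> k" "q < n" "vs q < n" "c < n" "m \<le> n" "c \<le> r"
  using assms k_le dfs_le[of r vs ps m q] by (auto simp: searching_def)

lemma wp_DESCEND:
  assumes pre: "globals s" "regs s RR = r" "r < n" "next_ok (arrs s NXT)"
      "searching r (arrs s VS) (arrs s PS) (regs s RM) (regs s RQ) (regs s RC)"
      "marks (verts (arrs s VS) (regs s RM)) (arrs s INL)"
    and post: "\<And>t. same DESCEND s t \<Longrightarrow>
      searching r (arrs t VS) (arrs t PS) k (regs t RQ) (regs t RC) \<Longrightarrow>
      todo r (arrs t VS) (arrs t PS) k (regs t RQ) (regs t RC) =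
        todo r (arrs s VS) (arrs s PS) (regs s RM) (regs s RQ) (regs s RC) \<Longrightarrow>
      marks (verts (arrs t VS) k) (arrs t INL) \<Longrightarrow>
      clock t \<le> clock s + 480 * k\<^sup>2 + 2 \<Longrightarrow> Q t"
  shows "wp DESCEND Q s"
proof -
  define s0 where "s0 = s"
  let ?fuel = "\<lambda>t. fuel (arrs t VS) (arrs t PS) (regs t RM) (regs t RQ) (regs t RC)"
  let ?I = "\<lambda>t. regs t RT = k - regs t RM \<and>
    searching r (arrs t VS) (arrs t PS) (regs t RM) (regs t RQ) (regs t RC) \<and>
    todo r (arrs t VS) (arrs t PS) (regs t RM) (regs t RQ) (regs t RC) =
      todo r (arrs s0 VS) (arrs s0 PS) (regs s0 RM) (regs s0 RQ) (regs s0 RC) \<and>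
    marks (verts (arrs t VS) (regs t RM)) (arrs t INL) \<and>
    clock t + 60 * ?fuel t \<le> clock s0 + 480 * k\<^sup>2 + 1"
  \<comment> \<open>60 steps suffice for an iteration, and \<open>fuel_le\<close> admits at most
    \<open>8 * k^2\<close> of them; this is the origin of 480.\<close>
  have f: "60 * ?fuel s \<le> 480 * k\<^sup>2"
    using fuel_le[OF pre(5)] by simp
  have "wp DESCEND (\<lambda>t. searching r (arrs t VS) (arrs t PS) k (regs t RQ) (regs t RC) \<and>
      todo r (arrs t VS) (arrs t PS) k (regs t RQ) (regs t RC) =
        todo r (arrs s VS) (arrs s PS) (regs s RM) (regs s RQ) (regs s RC) \<and>
      marks (verts (arrs t VS) k) (arrs t INL) \<and>
      clock t \<le> clock s + 480 * k\<^sup>2 + 2) s"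
    unfolding DESCEND_def wp_simps
  proof (rule conjI, goal_cases)
    case 1
    then show ?case
      using pre fits(4)[of k] k_le by (simp add: globals_def)
  next
    case 2
    show ?case
    proof (rule wp_WHILE[where I = ?I and V = ?fuel], goal_cases)
      case 1
      then show ?case
        using pre f by (simp add: globals_def s0_def)
    next
      case (2 t)
      have t: "globals t" "regs t RR = r" "arrs t NXT = arrs s NXT"
        using pre 2(2) by (simp_all add: globals_def sames)
      define vs ps m q c where "vs = arrs t VS" "ps = arrs t PS" "m = regs t RM" "q = regs t RQ" "c = regs t RC"
      note defs = this
      have s: "searching r vs ps m q c" "m < k" "marks (verts vs m) (arrs t INL)"
        using 2 by (auto simp: defs)
      note b = searching_bounds[OF s(1) pre(3)]
      define x where "x = arrs t NXT (vs q * n + c)"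
      have n: "(x = 0 \<longrightarrow> (\<forall>u<c. \<not> adj (vs q) u)) \<and>
       (\<forall>u. x = Suc u \<longrightarrow> u < c \<and> adj (vs q) u \<and> (\<forall>v. u < v \<and> v < c \<longrightarrow> \<not> adj (vs q) v))"
        using pre(4) b unfolding t next_ok_def x_def by blast
      have nx: "arrs s NXT (vs q * n + c) = x"
        by (simp add: x_def t)
      have W: "k - m \<le> wmax" "k - Suc m \<le> wmax" "Suc m \<le> wmax" "cell 16 m \<le> wmax" "cell 16 q \<le> wmax"
        using b s(2) k_le by (simp_all add: fits(3,4))
      note W' = index_fits[OF b(4,5)]
      show ?case
      proof (cases x)
        case 0
        note p = searching_pop[OF s(1,2)]
        have p: "0 < q" "ps q < q" "searching r vs ps m (ps q) (vs q)"
           "todo r vs ps m (ps q) (vs q) = todo r vs ps m q c"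
          using p n 0 by auto
        show ?thesis
          using 2 t 0 p fuel_pop[OF p(3,2), of c] W W' nx
          by (simp add: globals_def defs[symmetric])
      next
        case (Suc u)
        then have u: "u < c" "adj (vs q) u" "\<And>v. u < v \<Longrightarrow> v < c \<Longrightarrow> \<not> adj (vs q) v"
          using n by auto
        have Wu: "u \<le> wmax" "cell 16 u \<le> wmax"
          using u b by (simp_all add: fits(3,4))
        show ?thesis
        proof (cases "u \<in> verts vs m")
          case True
          then have "arrs t INL u = 1"
            using s(3) u b by (simp add: marks_def)
          then show ?thesis
            using 2 t Suc u searching_skip[OF s(1) u(1) True u(3)] fuel_skip[OF u(1) True, of ps q] W W' Wu nx
            by (simp add: globals_def defs[symmetric])
        next
          case False
          then have "arrs t INL u = 0"
            using s(3) u b by (simp add: marks_def)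
          note inc = searching_include[OF s(1,2) u(1,2) False u(3)]
          have "marks (verts (vs(m := u)) (Suc m)) ((arrs t INL)(u := Suc 0))"
            using s(3) by (auto simp: marks_def verts_def lessThan_Suc)
          then show ?thesis
            using 2 t Suc u inc fuel_include[OF conjunct1[OF inc] b(1) s(2), of c] W W' Wu nx \<open>arrs t INL u = 0\<close>
            by (simp add: globals_def defs[symmetric])
        qed
      qed
    next
      case (3 t)
      then have "regs t RM = k"
        by (auto simp: searching_def)
      then show ?case
        using 3 by (auto simp: s0_def)
    qed
  qed
  then show ?thesis
    by (rule wp_mono) (use post in auto)
qed

end

section \<open>Writing a record and preparing the tests\<close>

definition OUTPUT :: com where
  "OUTPUT = COPY RI RONE ;; OP MINUS RT RK RI ;; WHILE RT (
     GET RX PS RI ;; GET RX VS RX ;; GET RX ORD RX ;; WRITE RX ;;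
     GET RX VS RI ;; GET RX ORD RX ;; WRITE RX ;;
     OP PLUS RI RI RONE ;; OP MINUS RT RK RI)"

text \<open>Looks for a neighbour of \<open>RW\<close> below \<open>RC\<close> outside the tree.
  Only tree vertices are passed over, so \<open>k + 1\<close> lookups suffice whatever the degree;
  \<open>RX\<close> is nonzero at the end exactly if the search succeeded.\<close>

definition SCAN :: com where
  "SCAN = COPY RT RONE ;; WHILE RT (
     OP TIMES RX RW RN ;; OP PLUS RX RX RC ;; GET RX NXT RX ;;
     IF RX (OP MINUS RC RX RONE ;; GET RT INL RC) (SET RT 0))"

text \<open>Whether an arc leaves the tree does not depend on the position \<open>j\<close> tested
  later. Computing this once per tree, for the arcs of \<open>vs i\<close> below the root
  (\<open>OUTF\<close>) and for the arcs of its parent below \<open>vs i\<close>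
  (\<open>OUTS\<close>), spares the later tests a factor \<open>k\<close>.\<close>

definition FLAGS :: com where
  "FLAGS = COPY RI RONE ;; OP MINUS RL RK RI ;; WHILE RL (
     GET RV VS RI ;; GET RW PS RI ;; GET RW VS RW ;; COPY RC RV ;; SCAN ;; PUT OUTS RI RX ;;
     COPY RW RV ;; COPY RC RR ;; SCAN ;; PUT OUTF RI RX ;;
     OP PLUS RI RI RONE ;; OP MINUS RL RK RI)"

context lister
begin

definition record_of :: "(nat \<Rightarrow> nat) \<Rightarrow> (nat \<Rightarrow> nat) \<Rightarrow> (nat \<Rightarrow> nat) \<Rightarrow> nat \<Rightarrow> nat list" where
  "record_of f vs ps i = concat (map (\<lambda>i. [f (vs (ps i)), f (vs i)]) [1..<i])"

lemma record_of_Suc: "1 \<le> i \<Longrightarrow> record_of f vs ps (Suc i) = record_of f vs ps i @ [f (vs (ps i)), f (vs i)]"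
  by (simp add: record_of_def)

lemma wp_OUTPUT:
  assumes pre: "globals s" "dfs r (arrs s VS) (arrs s PS) k" "r < n" "line s = []"
    and post: "\<And>t. same OUTPUT s t \<Longrightarrow> lines t = lines s \<Longrightarrow> latest t = latest s \<Longrightarrow>
      line t = record_of (arrs s ORD) (arrs s VS) (arrs s PS) k \<Longrightarrow>
      clock t \<le> clock s + 40 * k + 3 \<Longrightarrow> Q t"
  shows "wp OUTPUT Q s"
proof -
  define s0 where "s0 = s"
  define vs ps where "vs = arrs s VS" "ps = arrs s PS"
  note defs = this
  let ?I = "\<lambda>t. regs t RT = k - regs t RI \<and> 1 \<le> regs t RI \<and> regs t RI \<le> k \<and>
    lines t = lines s0 \<and> latest t = latest s0 \<and>
    line t = record_of (arrs s0 ORD) vs ps (regs t RI) \<and>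
    clock t + 40 * regs t RT \<le> clock s0 + 40 * k + 2"
  have "wp OUTPUT (\<lambda>t. lines t = lines s \<and> latest t = latest s \<and>
      line t = record_of (arrs s ORD) vs ps k \<and> clock t \<le> clock s + 40 * k + 3) s"
    unfolding OUTPUT_def wp_simps
  proof (rule conjI, goal_cases)
    case 1
    then show ?case
      using pre fits(4)[of k] k_le by (simp add: globals_def)
  next
    case 2
    show ?case
    proof (rule wp_WHILE[where I = ?I and V = "\<lambda>t. regs t RT"], goal_cases)
      case 1
      then show ?case
        using pre k_ge by (simp add: globals_def s0_def record_of_def)
    next
      case (2 t)
      have t: "globals t" "arrs t = arrs s"
        using pre 2(2) by (auto simp: globals_def sames)
      define i where "i = regs t RI"
      have i: "1 \<le> i" "i < k"
        using 2 by (auto simp: i_def)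
      have p: "ps i < i" "vs i < n" "vs (ps i) < n"
        using dfs_parent[OF pre(2), of i] dfs_le[OF pre(2), of i] dfs_le[OF pre(2), of "arrs s PS i"] i pre(3)
        by (auto simp: defs)
      have W: "cell 16 i \<le> wmax" "cell 16 (ps i) \<le> wmax" "cell 16 (vs i) \<le> wmax" "cell 16 (vs (ps i)) \<le> wmax"
        "Suc i \<le> wmax" "k - Suc i \<le> wmax"
        using i p k_le by (simp_all add: fits(3,4))
      have "k - i = Suc (k - Suc i)"
        using i by simp
      then show ?case
        using 2(1) t W i record_of_Suc[OF i(1)] by (simp add: globals_def defs[symmetric] i_def[symmetric] s0_def)
    next
      case (3 t)
      then have "regs t RI = k"
        by simp
      then show ?case
        using 3(1) by (simp add: s0_def)
    qed
  qed
  then show ?thesis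
    by (rule wp_mono) (use post defs in auto)
qed

lemma wp_SCAN:
  assumes pre: "globals s" "next_ok (arrs s NXT)" "marks L (arrs s INL)" "finite L" "card L \<le> k"
      "regs s RW < n" "regs s RC < n"
    and post: "\<And>t. same SCAN s t \<Longrightarrow>
      regs t RX \<noteq> 0 \<longleftrightarrow> (\<exists>u<regs s RC. adj (regs s RW) u \<and> u \<notin> L) \<Longrightarrow>
      clock t \<le> clock s + 30 * k + 40 \<Longrightarrow> Q t"
  shows "wp SCAN Q s"
proof -
  define s0 where "s0 = s"
  define w c where "w = regs s RW" "c = regs s RC"
  note defs = this
  \<comment> \<open>Every lookup but the last passes a tree vertex below the bound; the
    \<open>+ 1\<close> stands for the last.\<close>
  let ?V = "\<lambda>t. if regs t RT = 0 then 0 else card {v \<in> L. v < regs t RC} + 1"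
  let ?I = "\<lambda>t. regs t RC < n \<and>
    (if regs t RT = 0 then regs t RX \<noteq> 0 \<longleftrightarrow> (\<exists>u<c. adj w u \<and> u \<notin> L)
     else (\<exists>u<regs t RC. adj w u \<and> u \<notin> L) \<longleftrightarrow> (\<exists>u<c. adj w u \<and> u \<notin> L)) \<and>
    clock t + 30 * ?V t \<le> clock s0 + 30 * k + 39"
  have "card {v \<in> L. v < c} \<le> k"
    using card_mono[OF pre(4), of "{v \<in> L. v < c}"] pre(5) by simp
  then have "?I (tick 1 (put_reg RT (regs s RONE) s))"
    using pre by (simp add: globals_def s0_def defs)
  then have "wp SCAN (\<lambda>t. (regs t RX \<noteq> 0 \<longleftrightarrow> (\<exists>u<c. adj w u \<and> u \<notin> L)) \<and> clock t \<le> clock s + 30 * k + 40) s"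
    unfolding SCAN_def wp_simps
  proof (rule wp_WHILE[where V = ?V], goal_cases)
    case (1 t)
    have t: "globals t" "arrs t = arrs s" "regs t RW = w"
      using pre 1(2) by (auto simp: globals_def sames defs)
    define d where "d = regs t RC"
    define x where "x = arrs s NXT (w * n + d)"
    have d: "d < n" "w < n"
      using 1 pre by (auto simp: d_def defs)
    note W = index_fits[OF d(2,1)]
    have e: "(\<exists>u<d. adj w u \<and> u \<notin> L) \<longleftrightarrow> (\<exists>u<c. adj w u \<and> u \<notin> L)"
      using 1 by (simp add: d_def)
    have n: "(x = 0 \<longrightarrow> (\<forall>u<d. \<not> adj w u)) \<and>
     (\<forall>u. x = Suc u \<longrightarrow> u < d \<and> adj w u \<and> (\<forall>v. u < v \<and> v < d \<longrightarrow> \<not> adj w v))"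
      using pre(2) d unfolding next_ok_def x_def by blast
    have T: "regs t RT \<noteq> 0"
      by (rule 1(3))
    show ?case
    proof (cases x)
      case 0
      then show ?thesis
        using 1(1) T t W n e by (auto simp: globals_def d_def[symmetric] x_def[symmetric])
    next
      case (Suc u)
      then have u: "u < d" "adj w u" "\<And>v. u < v \<Longrightarrow> v < d \<Longrightarrow> \<not> adj w v"
        using n by auto
      have un: "u < n"
        using u d by simp
      have Wu: "u \<le> wmax" "cell 16 u \<le> wmax"
        using un by (simp_all add: fits(3,4))
      show ?thesis
      proof (cases "u \<in> L")
        case True
        then have m: "arrs s INL u = 1"
          using pre(3) un by (simp add: marks_def)
        have "(\<exists>v<u. adj w v \<and> v \<notin> L) \<longleftrightarrow> (\<exists>v<d. adj w v \<and> v \<notin> L)"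
          using u True by (metis less_trans linorder_neqE_nat)
        then have e': "(\<exists>v<u. adj w v \<and> v \<notin> L) \<longleftrightarrow> (\<exists>v<c. adj w v \<and> v \<notin> L)"
          using e by simp
        have "{v \<in> L. v < u} \<subset> {v \<in> L. v < d}"
          using u True by auto
        then have "card {v \<in> L. v < u} < card {v \<in> L. v < d}"
          using pre(4) by (intro psubset_card_mono) auto
        then show ?thesis
          using 1(1) T t W Wu Suc m e' un
          by (simp add: globals_def d_def[symmetric] x_def[symmetric])
      next
        case False
        then have m: "arrs s INL u = 0"
          using pre(3) un by (simp add: marks_def)
        have "\<exists>v<c. adj w v \<and> v \<notin> L"
          using e u False by blast
        then show ?thesis
          using 1(1) T t W Wu Suc m un
          by (simp add: globals_def d_def[symmetric] x_def[symmetric])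
      qed
    qed
  next
    case (2 t)
    then show ?case
      by (simp add: s0_def)
  qed
  then show ?thesis
    by (rule wp_mono) (use post defs in auto)
qed

definition flags_ok :: "nat \<Rightarrow> (nat \<Rightarrow> nat) \<Rightarrow> (nat \<Rightarrow> nat) \<Rightarrow> nat \<Rightarrow> (nat \<Rightarrow> nat) \<Rightarrow> (nat \<Rightarrow> nat) \<Rightarrow> bool" where
  "flags_ok r vs ps m f g \<longleftrightarrow> (\<forall>i. 1 \<le> i \<and> i < m \<longrightarrow>
     (f i \<noteq> 0 \<longleftrightarrow> (\<exists>u<r. adj (vs i) u \<and> u \<notin> verts vs k)) \<and>
     (g i \<noteq> 0 \<longleftrightarrow> (\<exists>u<vs i. adj (vs (ps i)) u \<and> u \<notin> verts vs k)))"

lemma wp_FLAGS: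
  assumes pre: "globals s" "regs s RR = r" "r < n" "next_ok (arrs s NXT)"
      "dfs r (arrs s VS) (arrs s PS) k" "marks (verts (arrs s VS) k) (arrs s INL)"
    and post: "\<And>t. same FLAGS s t \<Longrightarrow>
      flags_ok r (arrs s VS) (arrs s PS) k (arrs t OUTF) (arrs t OUTS) \<Longrightarrow>
      clock t \<le> clock s + k * (60 * k + 200) + 3 \<Longrightarrow> Q t"
  shows "wp FLAGS Q s"
proof -
  define s0 where "s0 = s"
  define vs ps where "vs = arrs s VS" "ps = arrs s PS"
  note defs = this
  let ?L = "verts vs k"
  \<comment> \<open>Two scans of at most \<open>30 * k + 40\<close> steps each, with slack for the
    other instructions.\<close>
  let ?K = "60 * k + 200"
  let ?I = "\<lambda>t. regs t RL = k - regs t RI \<and> 1 \<le> regs t RI \<and> regs t RI \<le> k \<and>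
    flags_ok r vs ps (regs t RI) (arrs t OUTF) (arrs t OUTS) \<and>
    clock t + regs t RL * ?K \<le> clock s0 + k * ?K + 2"
  have card: "card ?L \<le> k"
    using card_verts[OF pre(5), of k] by (simp add: defs)
  have wr: "writes_reg SCAN x \<longleftrightarrow> x \<in> {RT, RX, RC}" "\<not> writes_arr SCAN a" "silent SCAN" for x a
    by (auto simp: SCAN_def)
  have "wp FLAGS (\<lambda>t. flags_ok r vs ps k (arrs t OUTF) (arrs t OUTS) \<and>
      clock t \<le> clock s + k * ?K + 3) s"
    unfolding FLAGS_def wp_simps
  proof (rule conjI, goal_cases)
    case 1
    then show ?case
      using pre fits(4)[of k] k_le by (simp add: globals_def)
  next
    case 2
    show ?case
    proof (rule wp_WHILE[where I = ?I and V = "\<lambda>t. regs t RL"], goal_cases)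
      case 1
      have "(k - 1) * ?K \<le> k * ?K"
        by (intro mult_le_mono1) simp
      then show ?case
        using pre k_ge by (simp add: globals_def s0_def flags_ok_def)
    next
      case (2 t)
      have t: "globals t" "regs t RR = r" "arrs t VS = vs" "arrs t PS = ps" "arrs t NXT = arrs s NXT"
         "arrs t INL = arrs s INL"
        using pre 2(2) by (auto simp: globals_def sames defs wr)
      define i where "i = regs t RI"
      have i: "1 \<le> i" "i < k"
        using 2 by (auto simp: i_def)
      have p: "ps i < i" "vs i < n" "vs (ps i) < n"
        using dfs_parent[OF pre(5), of i] dfs_le[OF pre(5), of i] dfs_le[OF pre(5), of "arrs s PS i"] i pre(3)
        by (auto simp: defs)
      have W: "cell 16 i \<le> wmax" "cell 16 (ps i) \<le> wmax" "Suc i \<le> wmax" "k - Suc i \<le> wmax"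
        using i p k_le by (simp_all add: fits(3,4))
      have fl: "flags_ok r vs ps i (arrs t OUTF) (arrs t OUTS)"
        using 2 by (simp add: i_def)
      have K: "(k - i) * ?K = (k - Suc i) * ?K + ?K"
        using i by (simp add: Suc_diff_Suc[symmetric])
      have clk: "clock t + (k - i) * ?K \<le> clock s0 + k * ?K + 2"
        using 2(1) unfolding i_def by (elim conjE) simp
      show ?case
        unfolding wp_simps
        apply (simp add: W t defs[symmetric] i_def[symmetric])
        apply (rule wp_SCAN[where L = ?L])
               apply (use t pre p card in \<open>simp_all add: globals_def defs[symmetric]\<close>)[7]
        apply (simp add: W same_regs same_arrs wr t defs[symmetric] i_def[symmetric])
        apply (rule wp_SCAN[where L = ?L])
               apply (use t pre p card in \<open>simp_all add: globals_def same_regs same_arrs wr defs[symmetric]\<close>)[7]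
        subgoal premises prems for t1 t2
        proof -
          have "flags_ok r vs ps (Suc i) ((arrs t OUTF)(i := regs t2 RX)) ((arrs t OUTS)(i := regs t1 RX))"
            using fl prems(2,5) unfolding flags_ok_def
            by (simp add: t i_def[symmetric] less_Suc_eq)
          moreover have "clock t2 \<le> clock t + 60 * k + 130"
            using prems(3,6) by simp
          ultimately show ?thesis
            using prems(1,4) W i t 2(1) K clk
            by (simp add: same_regs same_arrs wr globals_def i_def[symmetric])
        qed
        done
    next
      case (3 t)
      then have "regs t RI = k"
        by simp
      then show ?case
        using 3(1) by (simp add: s0_def)
    qed
  qed
  then show ?thesis
    by (rule wp_mono) (use post defs in auto)
qed

end

text \<open>Climbs from \<open>j\<close> to the root through the pending arcs, one ancestor at a
  time. Each takes constant time: \<open>OUTS\<close> answers for the arcs leaving the tree, and a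
  lookup in column \<open>vs j + 1\<close> for the arc to \<open>vs j\<close>
  (\<open>next_adj\<close>).\<close>

definition PATH :: com where
  "PATH = COPY RI RJ ;; WHILE RI (
     GET RP PS RI ;; GET RY VS RI ;; OP MINUS RT RY RV ;;
     IF RT (GET RW VS RP ;; OP TIMES RX RW RN ;; OP PLUS RX RX RS ;; GET RX NXT RX ;;
         OP MINUS RX RS RX ;; IF RX SKIP (SET RF 1)) SKIP ;;
     GET RX OUTS RI ;; IF RX (SET RF 1) SKIP ;;
     COPY RI RP)"

text \<open>\<open>RG\<close> is switched on at the first position whose parent precedes
  \<open>j\<close>, which ends the subtree of \<open>vs j\<close>, and stays on. From there on all
  arcs with heads below the root count.\<close>

definition LATER :: com where
  "LATER = SET RG 0 ;; OP PLUS RI RJ RONE ;; OP MINUS RL RK RI ;; WHILE RL (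
     GET RP PS RI ;; OP MINUS RX RJ RP ;; IF RX (SET RG 1) SKIP ;;
     IF RG (GET RX OUTF RI ;; IF RX (SET RF 1) SKIP ;;
         GET RW VS RI ;; OP TIMES RX RW RN ;; OP PLUS RX RX RS ;; GET RX NXT RX ;;
         OP MINUS RX RS RX ;; IF RX SKIP (SET RF 1)) SKIP ;;
     OP PLUS RI RI RONE ;; OP MINUS RL RK RI)"

text \<open>\<open>vs j\<close> is unmarked whether or not the search stops at \<open>j\<close>, as
  a resumed search drops it as well. The flags were computed for the complete tree and are not
  affected. \<open>RC\<close> is cleared to leave the loop with \<open>RJ\<close> intact.\<close>

definition BACKTRACK :: com where
  "BACKTRACK = OP MINUS RJ RK RONE ;; COPY RC RONE ;; WHILE RC (
     SET RF 0 ;; GET RV VS RJ ;; OP PLUS RS RV RONE ;; PATH ;; LATER ;;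
     SET RX 0 ;; PUT INL RV RX ;; IF RF (SET RC 0) (OP MINUS RJ RJ RONE ;; COPY RC RJ))"

context lister
begin

text \<open>Below the bound \<open>v + 1\<close> the vertex \<open>v\<close> is the first candidate,
  so a single lookup decides adjacency. Entries never exceed their column, hence equality can be
  tested by truncated subtraction.\<close>

lemma next_adj:
  assumes "next_ok f" "w < n" "Suc v < n"
  shows "Suc v - f (w * n + Suc v) = 0 \<longleftrightarrow> adj w v"
proof -
  let ?x = "f (w * n + Suc v)"
  have n: "(?x = 0 \<longrightarrow> (\<forall>u<Suc v. \<not> adj w u)) \<and>
     (\<forall>u. ?x = Suc u \<longrightarrow> u < Suc v \<and> adj w u \<and> (\<forall>v'. u < v' \<and> v' < Suc v \<longrightarrow> \<not> adj w v'))"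
    using assms unfolding next_ok_def by blast
  show ?thesis
  proof (cases ?x)
    case (Suc u)
    then have "u < Suc v" "adj w u" "\<And>v'. u < v' \<Longrightarrow> v' < Suc v \<Longrightarrow> \<not> adj w v'"
      using n by auto
    then show ?thesis
      using Suc by (cases "u = v") auto
  qed (use n in auto)
qed

text \<open>The criterion of \<open>extensible_at_iff\<close> with \<open>v\<close> in place of
  \<open>vs j\<close>, for one part of the arcs at a time.\<close>

definition escapes :: "(nat \<Rightarrow> nat) \<Rightarrow> nat \<Rightarrow> (nat \<times> nat) set \<Rightarrow> bool" where
  "escapes vs v A \<longleftrightarrow> (\<exists>(p, u)\<in>A. u = v \<or> u \<notin> verts vs k)"

lemma escapes_pending:
  assumes d: "dfs r vs ps k" "0 < i" "i < k"
  shows "escapes vs v (pending vs ps i) \<longleftrightarrow>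
    v < vs i \<and> adj (vs (ps i)) v \<or> (\<exists>u<vs i. adj (vs (ps i)) u \<and> u \<notin> verts vs k) \<or>
    0 < ps i \<and> escapes vs v (pending vs ps (ps i))"
proof (cases "ps i = 0")
  case True
  then show ?thesis
    using act_root[of vs ps "vs i"] by (auto simp: escapes_def)
next
  case False
  then have "pending vs ps i = {(vs (ps i), u) | u. adj (vs (ps i)) u \<and> u < vs i} \<union> pending vs ps (ps i)"
    using dfs_parent[OF d] d by (intro act_step[OF d(1)]) auto
  then show ?thesis
    using False by (auto simp: escapes_def)
qed

lemma wp_PATH:
  assumes pre: "globals s" "r < n" "next_ok (arrs s NXT)" "dfs r (arrs s VS) (arrs s PS) k"
      "flags_ok r (arrs s VS) (arrs s PS) k (arrs s OUTF) (arrs s OUTS)"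
      "0 < regs s RJ" "regs s RJ < k" "regs s RV < r" "regs s RS = Suc (regs s RV)" "regs s RF = 0"
    and post: "\<And>t. same PATH s t \<Longrightarrow>
      regs t RF \<noteq> 0 \<longleftrightarrow> escapes (arrs s VS) (regs s RV) (pending (arrs s VS) (arrs s PS) (regs s RJ)) \<Longrightarrow>
      clock t \<le> clock s + 40 * k + 2 \<Longrightarrow> Q t"
  shows "wp PATH Q s"
proof -
  define s0 where "s0 = s"
  define vs ps j v where "vs = arrs s VS" "ps = arrs s PS" "j = regs s RJ" "v = regs s RV"
  note defs = this
  let ?esc = "\<lambda>i. escapes vs v (pending vs ps i)"
  \<comment> \<open>Parents have smaller positions, so \<open>RI\<close> itself bounds the number of
    iterations left.\<close>
  let ?I = "\<lambda>t. regs t RI < k \<and>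
    (regs t RF \<noteq> 0 \<or> (regs t RI \<noteq> 0 \<and> ?esc (regs t RI)) \<longleftrightarrow> ?esc j) \<and>
    clock t + 40 * regs t RI \<le> clock s0 + 40 * k + 1"
  have v: "v < r" "Suc v < n"
    using pre by (auto simp: defs)
  have "?I (tick 1 (put_reg RI (regs s RJ) s))"
    using pre by (simp add: s0_def defs)
  then have "wp PATH (\<lambda>t. (regs t RF \<noteq> 0 \<longleftrightarrow> ?esc j) \<and> clock t \<le> clock s + 40 * k + 2) s"
    unfolding PATH_def wp_simps
  proof (rule wp_WHILE[where V = "\<lambda>t. regs t RI"], goal_cases)
    case (1 t)
    have t: "globals t" "arrs t = arrs s" "regs t RV = v" "regs t RS = Suc v"
      using pre 1(2) by (auto simp: globals_def sames defs)
    define i where "i = regs t RI"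
    have i: "0 < i" "i < k"
      using 1 by (auto simp: i_def)
    have p: "ps i < i" "vs (ps i) < n"
      using dfs_parent[OF pre(4), of i] dfs_le[OF pre(4), of "arrs s PS i"] i pre(2)
      by (auto simp: defs)
    note W = index_fits[OF p(2) v(2)]
    have W': "cell 16 i \<le> wmax" "cell 16 (ps i) \<le> wmax" "1 \<le> wmax" "0 \<le> wmax"
      using i p k_le by (simp_all add: fits(3,4))
    have x: "Suc v - arrs s NXT (vs (ps i) * n + Suc v) = 0 \<longleftrightarrow> adj (vs (ps i)) v"
      using next_adj[OF pre(3) p(2) v(2)] .
    have x': "Suc v - arrs s NXT (vs (ps i) * n + Suc v) \<le> wmax"
      using W by simp
    have vi: "vs i \<le> wmax"
      using dfs_le[OF pre(4), of i] i pre(2) by (simp add: defs fits(4))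
    have fl: "arrs s OUTS i \<noteq> 0 \<longleftrightarrow> (\<exists>u<vs i. adj (vs (ps i)) u \<and> u \<notin> verts vs k)"
      using pre(5) i by (simp add: flags_ok_def defs)
    have esc: "?esc i \<longleftrightarrow> v < vs i \<and> adj (vs (ps i)) v \<or> arrs s OUTS i \<noteq> 0 \<or> 0 < ps i \<and> ?esc (ps i)"
      using escapes_pending[of r vs ps i v] pre(4) i fl by (simp add: defs)
    have vx: "vs i - v = 0 \<longleftrightarrow> \<not> v < vs i" "vs i - v \<le> wmax"
      using vi by auto
    note 1 = 1(1)[folded i_def]
    show ?case
      by (cases "v < vs i"; cases "adj (vs (ps i)) v"; cases "arrs s OUTS i = 0")
        (use 1 t W W' x x' vx i p esc in
          \<open>simp_all add: globals_def i_def[symmetric] defs[symmetric]\<close>)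
  next
    case (2 t)
    then show ?case
      by (simp add: s0_def)
  qed
  then show ?thesis
    by (rule wp_mono) (use post defs in auto)
qed

lemma wp_LATER:
  assumes pre: "globals s" "r < n" "next_ok (arrs s NXT)" "dfs r (arrs s VS) (arrs s PS) k"
      "flags_ok r (arrs s VS) (arrs s PS) k (arrs s OUTF) (arrs s OUTS)"
      "0 < regs s RJ" "regs s RJ < y" "y \<le> k" "regs s RV < r" "regs s RS = Suc (regs s RV)"
      "\<And>i. regs s RJ < i \<Longrightarrow> i < y \<Longrightarrow> regs s RJ \<le> arrs s PS i" "y < k \<Longrightarrow> arrs s PS y < regs s RJ"
    and post: "\<And>t. same LATER s t \<Longrightarrow>
      regs t RF \<noteq> 0 \<longleftrightarrow> regs s RF \<noteq> 0 \<or> escapes (arrs s VS) (regs s RV) (arcs_from r (arrs s VS) y k) \<Longrightarrow>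
      clock t \<le> clock s + 50 * k + 4 \<Longrightarrow> Q t"
  shows "wp LATER Q s"
proof -
  define s0 where "s0 = s"
  define vs ps j v where "vs = arrs s VS" "ps = arrs s PS" "j = regs s RJ" "v = regs s RV"
  note defs = this
  let ?esc = "\<lambda>i. escapes vs v (arcs_from r vs y i)"
  let ?I = "\<lambda>t. regs t RL = k - regs t RI \<and> j < regs t RI \<and> regs t RI \<le> k \<and>
    (regs t RG \<noteq> 0 \<longleftrightarrow> y < regs t RI) \<and>
    (regs t RF \<noteq> 0 \<longleftrightarrow> regs s0 RF \<noteq> 0 \<or> ?esc (regs t RI)) \<and>
    clock t + 50 * regs t RL \<le> clock s0 + 50 * k + 3"
  have v: "v < r" "Suc v < n"
    using pre by (auto simp: defs)
  have j: "0 < j" "j < y"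
    using pre by (auto simp: defs)
  have jk: "j < k"
    using j pre by simp
  have e0: "\<not> ?esc (Suc j)"
    using j by (auto simp: escapes_def arcs_from_def)
  have "wp LATER (\<lambda>t. (regs t RF \<noteq> 0 \<longleftrightarrow> regs s RF \<noteq> 0 \<or> ?esc k) \<and> clock t \<le> clock s + 50 * k + 4) s"
    unfolding LATER_def wp_simps
  proof (intro conjI, goal_cases)
    case 4
    show ?case
    proof (rule wp_WHILE[where I = ?I and V = "\<lambda>t. regs t RL"], goal_cases)
      case 1
      then show ?case
        using pre e0 jk j by (simp add: globals_def s0_def defs)
    next
      case (2 t)
      have t: "globals t" "arrs t = arrs s" "regs t RV = v" "regs t RS = Suc v" "regs t RJ = j"
        using pre 2(2) by (auto simp: globals_def sames defs)
      define i where "i = regs t RI"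
      have i: "0 < i" "i < k" "j < i"
        using 2 j by (auto simp: i_def)
      have p: "vs i < n"
        using dfs_le[OF pre(4), of i] i pre(2) by (auto simp: defs)
      note W = index_fits[OF p v(2)]
      have W': "cell 16 i \<le> wmax" "1 \<le> wmax" "0 \<le> wmax" "Suc i \<le> wmax" "k - Suc i \<le> wmax" "j \<le> wmax"
        using i k_le by (simp_all add: fits(3,4))
      then have W'': "j - x \<le> wmax" for x
        by (meson diff_le_self le_trans)
      have x: "Suc v - arrs s NXT (vs i * n + Suc v) = 0 \<longleftrightarrow> adj (vs i) v"
        using next_adj[OF pre(3) p v(2)] .
      have x': "Suc v - arrs s NXT (vs i * n + Suc v) \<le> wmax"
        using W by simp
      have fl: "arrs s OUTF i \<noteq> 0 \<longleftrightarrow> (\<exists>u<r. adj (vs i) u \<and> u \<notin> verts vs k)"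
        using pre(5) i by (simp add: flags_ok_def defs)
      have esc: "?esc (Suc i) \<longleftrightarrow> ?esc i \<or> (y \<le> i \<and> (arrs s OUTF i \<noteq> 0 \<or> adj (vs i) v))"
        unfolding fl using v by (auto simp: escapes_def arcs_from_def less_Suc_eq)
      \<comment> \<open>Position \<open>y\<close> itself must count: \<open>RG\<close> is raised by
        \<open>ps y < j\<close> in the very iteration that tests it. Before \<open>y\<close> all
        parents are at least \<open>j\<close>.\<close>
      have g: "y \<le> i \<longleftrightarrow> y < i \<or> j - ps i \<noteq> 0"
      proof -
        have "i < y \<Longrightarrow> j \<le> ps i" "i = y \<Longrightarrow> ps i < j"
          using pre(11)[of i] pre(12) i by (auto simp: defs)
        then show ?thesis
          by (metis diff_is_0_eq le_neq_implies_less linorder_not_less less_imp_le)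
      qed
      have K: "k - i = Suc (k - Suc i)"
        using i by simp
      have y: "y < Suc i \<longleftrightarrow> y \<le> i"
        by auto
      note 2 = 2(1)[folded i_def]
      show ?case
        by (cases "y < i"; cases "j - ps i = 0"; cases "arrs s OUTF i = 0"; cases "adj (vs i) v")
          (use 2 t W W' W'' x x' i esc g K in
            \<open>simp_all add: globals_def i_def[symmetric] defs[symmetric] y\<close>)
    next
      case (3 t)
      then have "regs t RI = k"
        by simp
      then show ?case
        using 3(1) by (simp add: s0_def)
    qed
  qed (use pre jk k_le in \<open>simp_all add: globals_def fits(4) defs\<close>)
  then show ?thesis
    by (rule wp_mono) (use post defs in auto)
qed

end

section \<open>Main loop and delay\<close>

abbreviation (input) RUN :: nat where "RUN \<equiv> 21"

text \<open>The next root \<open>r - 1\<close> can carry a tree only if \<open>k \<le> r\<close>,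
  which is tested as \<open>r + 1 - k \<noteq> 0\<close>.\<close>

definition NEXT :: com where
  "NEXT = IF RF (COPY RM RJ ;; GET RQ PS RJ ;; GET RC VS RJ)
     (SET RX 0 ;; PUT INL RR RX ;; OP PLUS RT RR RONE ;; OP MINUS RT RT RK ;;
      IF RT
        (OP MINUS RR RR RONE ;; PUT VS RX RR ;; PUT INL RR RONE ;;
         COPY RQ RX ;; COPY RM RONE ;; COPY RC RR)
        (SET RUN 0))"

definition MAIN :: com where
  "MAIN = WHILE RUN (DESCEND ;; OUTPUT ;; EMIT ;; FLAGS ;; BACKTRACK ;; NEXT)"

context lister
begin

lemma marks_remove:
  assumes "dfs r vs ps m" "j < m" "marks (verts vs (Suc j)) f"
  shows "marks (verts vs j) (f(vs j := 0))"
proof -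
  have "verts vs (Suc j) = insert (vs j) (verts vs j)" "vs j \<notin> verts vs j"
    using in_verts_iff[OF assms(1,2), of j] assms(2) by (auto simp: verts_def lessThan_Suc)
  then show ?thesis
    using assms(3) by (auto simp: marks_def)
qed

lemma wp_BACKTRACK:
  assumes pre: "globals s" "r < n" "next_ok (arrs s NXT)" "dfs r (arrs s VS) (arrs s PS) k"
      "flags_ok r (arrs s VS) (arrs s PS) k (arrs s OUTF) (arrs s OUTS)"
      "marks (verts (arrs s VS) k) (arrs s INL)"
    and post: "\<And>t. same BACKTRACK s t \<Longrightarrow>
      \<forall>i. regs t RJ < i \<and> i < k \<longrightarrow> \<not> extensible_at r (arrs s VS) (arrs s PS) i \<Longrightarrow>
      (if regs t RF = 0 then regs t RJ = 0 \<and> marks {r} (arrs t INL)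
       else 0 < regs t RJ \<and> regs t RJ < k \<and> extensible_at r (arrs s VS) (arrs s PS) (regs t RJ) \<and>
         marks (verts (arrs s VS) (regs t RJ)) (arrs t INL)) \<Longrightarrow>
      clock t \<le> clock s + k * (90 * k + 60) + 3 \<Longrightarrow> Q t"
  shows "wp BACKTRACK Q s"
proof -
  define s0 where "s0 = s"
  define vs ps where "vs = arrs s VS" "ps = arrs s PS"
  note defs = this
  \<comment> \<open>\<open>40 * k\<close> for \<open>PATH\<close>, \<open>50 * k\<close> for
    \<open>LATER\<close>, and a constant for the rest of an iteration.\<close>
  let ?K = "90 * k + 60"
  let ?ext = "extensible_at r vs ps"
  let ?V = "\<lambda>t. if regs t RC = 0 then 0 else regs t RJ"
  let ?I = "\<lambda>t. (\<forall>i. regs t RJ < i \<and> i < k \<longrightarrow> \<not> ?ext i) \<and>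
    (if regs t RC \<noteq> 0 then 0 < regs t RJ \<and> regs t RJ < k \<and> marks (verts vs (Suc (regs t RJ))) (arrs t INL)
     else if regs t RF = 0 then regs t RJ = 0 \<and> marks {r} (arrs t INL)
     else 0 < regs t RJ \<and> regs t RJ < k \<and> ?ext (regs t RJ) \<and> marks (verts vs (regs t RJ)) (arrs t INL)) \<and>
    clock t + ?V t * ?K \<le> clock s0 + k * ?K + 2"
  have wr: "writes_reg PATH x \<longleftrightarrow> x \<in> {RI, RP, RY, RT, RW, RX, RF}" "\<not> writes_arr PATH a" "silent PATH"
    "writes_reg LATER x \<longleftrightarrow> x \<in> {RG, RI, RL, RP, RX, RW, RF}" "\<not> writes_arr LATER a" "silent LATER" for x a
    by (auto simp: PATH_def LATER_def)
  have "wp BACKTRACK (\<lambda>t. (\<forall>i. regs t RJ < i \<and> i < k \<longrightarrow> \<not> ?ext i) \<and>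
    (if regs t RF = 0 then regs t RJ = 0 \<and> marks {r} (arrs t INL)
       else 0 < regs t RJ \<and> regs t RJ < k \<and> ?ext (regs t RJ) \<and>
         marks (verts vs (regs t RJ)) (arrs t INL)) \<and>
      clock t \<le> clock s + k * ?K + 3) s"
    unfolding BACKTRACK_def wp_simps
  proof (rule conjI, goal_cases)
    case 1
    then show ?case
      using pre fits(4)[of k] k_le by (simp add: globals_def)
  next
    case 2
    show ?case
    proof (rule wp_WHILE[where I = ?I and V = ?V], goal_cases)
      case 1
      have "(k - 1) * ?K \<le> k * ?K"
        by (intro mult_le_mono1) simp
      moreover have "\<not> ?ext i" if "k - 1 < i" "i < k" for i
        using that by linarith
      ultimately show ?case
        using pre k_ge by (simp add: globals_def s0_def defs)
    next
      case (2 t)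
      have t: "globals t" "arrs t VS = vs" "arrs t PS = ps" "arrs t NXT = arrs s NXT"
         "arrs t OUTF = arrs s OUTF" "arrs t OUTS = arrs s OUTS"
        using pre 2(2) by (auto simp: globals_def sames defs wr)
      define j where "j = regs t RJ"
      have j: "0 < j" "j < k" and later: "\<And>i. j < i \<Longrightarrow> i < k \<Longrightarrow> \<not> ?ext i"
        and m: "marks (verts vs (Suc j)) (arrs t INL)"
        using 2(1,3) by (auto simp: j_def)
      have d: "dfs r vs ps k"
        using pre by (simp add: defs)
      have clk: "clock t + j * ?K \<le> clock s0 + k * ?K + 2"
        using 2(1,3) unfolding j_def by (elim conjE) simp
      have v: "vs j < r" "vs j < n"
        using dfs_le[OF d j(2)] j pre(2) by auto
      have W: "cell 16 j \<le> wmax" "cell 16 (vs j) \<le> wmax" "Suc (vs j) \<le> wmax" "j - 1 \<le> wmax" "0 \<le> wmax"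
        using j v k_le by (simp_all add: fits(3,4))
      \<comment> \<open>The end of the subtree of \<open>vs j\<close>: the least position after
        \<open>j\<close> whose parent precedes \<open>j\<close>, or \<open>k\<close>. It occurs only
        in the proof; the program detects it through \<open>RG\<close>.\<close>
      obtain y where y: "j < y" "y \<le> k" "\<And>i. j < i \<Longrightarrow> i < y \<Longrightarrow> j \<le> ps i" "y < k \<Longrightarrow> ps y < j"
      proof -
        let ?P = "\<lambda>y. j < y \<and> (y < k \<longrightarrow> ps y < j)"
        have P: "?P k"
          using j by simp
        show ?thesis
        proof (rule that[of "LEAST y. ?P y"])
          show "j < (LEAST y. ?P y)" "(LEAST y. ?P y) < k \<Longrightarrow> ps (LEAST y. ?P y) < j"
            using LeastI[of ?P k, OF P] by auto
          show le: "(LEAST y. ?P y) \<le> k"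
            using Least_le[of ?P k, OF P] .
          show "j \<le> ps i" if "j < i" "i < (LEAST y. ?P y)" for i
            using not_less_Least[OF that(2)] that le by auto
        qed
      qed
      have iff: "?ext j \<longleftrightarrow> escapes vs (vs j) (pending vs ps j) \<or> escapes vs (vs j) (arcs_from r vs y k)"
        using extensible_at_iff[OF d j(1) y later] by (auto simp: escapes_def)
      have m': "marks (verts vs j) ((arrs t INL)(vs j := 0))"
        using marks_remove[OF d j(2) m] .
      have K: "j * ?K = (j - 1) * ?K + ?K"
        using j by (cases j) simp_all
      have RC: "regs t RC \<noteq> 0" "0 < regs t RC"
        using 2(3) by simp_all
      show ?case
        unfolding wp_simps
        apply (simp only: RC if_True if_False not_False_eq_True simp_thms)
        apply (simp add: W t defs[symmetric] j_def[symmetric] RC)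
        apply (rule conjI)
        using t W apply (simp add: globals_def)
        apply (rule wp_PATH[where r = r])
                   apply (use t pre j v in \<open>simp_all add: globals_def defs[symmetric] j_def[symmetric]\<close>)[10]
        apply (rule wp_LATER[where r = r and y = y])
                     apply (use t pre j v y in \<open>simp_all add: globals_def same_regs same_arrs wr defs[symmetric] j_def[symmetric]\<close>)[12]
        subgoal premises prems for t1 t2
        proof -
          have r1: "regs t2 RJ = j" "regs t2 RV = vs j" "arrs t2 = arrs t" "regs t2 RONE = 1"
            using prems(1,4) t by (auto simp: same_regs same_arrs wr globals_def j_def[symmetric])
          have F: "regs t2 RF \<noteq> 0 \<longleftrightarrow> ?ext j"
            using prems(1,2,5) t unfolding iff
            by (simp add: same_regs same_arrs wr j_def[symmetric])
          have c: "clock t2 \<le> clock t + 90 * k + 20"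
            using prems(3,6) by simp
          show ?thesis
          proof (cases "?ext j")
            case True
            then show ?thesis
              using F r1 c m' later W clk K j by simp
          next
            case False
            have l: "\<not> ?ext i" if "j - 1 < i" "i < k" for i
              using False later[of i] that by (cases "i = j") auto
            have "verts vs (Suc 0) = {r}" "Suc (j - 1) = j"
              using d j by (auto simp: verts_def lessThan_Suc dfs_def)
            then show ?thesis
              using F False r1 c m' l W clk K j by (cases "j = 1") simp_all
          qed
        qed
        done
    next
      case (3 t)
      then show ?case
        by (simp add: s0_def)
    qed
  qed
  then show ?thesis
    by (rule wp_mono) (use post defs in auto)
qed

definition ready :: "state \<Rightarrow> nat set set set \<Rightarrow> bool" where
  "ready s R \<longleftrightarrow> globals s \<and> next_ok (arrs s NXT) \<and>
     (if regs s RUN = 0 then R = {}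
      else regs s RR < n \<and> k \<le> Suc (regs s RR) \<and>
        searching (regs s RR) (arrs s VS) (arrs s PS) (regs s RM) (regs s RQ) (regs s RC) \<and>
        marks (verts (arrs s VS) (regs s RM)) (arrs s INL) \<and>
        R = todo (regs s RR) (arrs s VS) (arrs s PS) (regs s RM) (regs s RQ) (regs s RC))"

lemma remaining_skip:
  assumes "dfs r vs ps k" "\<forall>i. j < i \<and> i < k \<longrightarrow> \<not> extensible_at r vs ps i" "j < k"
  shows "remaining r vs ps k = remaining r vs ps (Suc j)"
proof -
  have "remaining r vs ps k = remaining r vs ps (Suc i)" if "j \<le> i" "i < k" for i
  proof -
    have "i \<le> k - 1"
      using that by simp
    then show ?thesis
      using that(1)
    proof (induction i rule: inc_induct)
      case base
      then show ?case
        using k_ge by simp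
    next
      case (step i)
      then have "remaining r vs ps (Suc (Suc i)) = remaining r vs ps (Suc i)"
        using assms by (intro remaining_pop) auto
      then show ?case
        using step by simp
    qed
  qed
  then show ?thesis
    using assms(3) by simp
qed

lemma wp_NEXT:
  assumes low: "\<And>i. 0 < i \<Longrightarrow> i < n \<Longrightarrow> \<exists>u<i. adj i u"
    and pre: "globals s" "next_ok (arrs s NXT)" "regs s RUN \<noteq> 0" "regs s RR = r" "r < n" "k \<le> Suc r"
      "dfs r (arrs s VS) (arrs s PS) k"
      "\<forall>i. regs s RJ < i \<and> i < k \<longrightarrow> \<not> extensible_at r (arrs s VS) (arrs s PS) i"
      "if regs s RF = 0 then regs s RJ = 0 \<and> marks {r} (arrs s INL)
       else 0 < regs s RJ \<and> regs s RJ < k \<and> extensible_at r (arrs s VS) (arrs s PS) (regs s RJ) \<and>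
         marks (verts (arrs s VS) (regs s RJ)) (arrs s INL)"
    and post: "\<And>t. same NEXT s t \<Longrightarrow> ready t (remaining r (arrs s VS) (arrs s PS) k) \<Longrightarrow>
      clock t \<le> clock s + 40 \<Longrightarrow> Q t"
  shows "wp NEXT Q s"
proof -
  define vs ps j where "vs = arrs s VS" "ps = arrs s PS" "j = regs s RJ"
  note defs = this
  have rem: "remaining r vs ps k = remaining r vs ps (Suc j)"
    using pre(7-9) k_ge by (intro remaining_skip) (auto simp: defs split: if_splits)
  have W: "r \<le> wmax" "cell 16 r \<le> wmax" "Suc r \<le> wmax" "0 \<le> wmax" "cell 16 0 \<le> wmax" "Suc r - k \<le> wmax"
      "r - 1 \<le> wmax" "cell 16 (r - 1) \<le> wmax"
    using pre(5) by (simp_all add: fits(3,4))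
  have "wp NEXT (\<lambda>t. ready t (remaining r vs ps k) \<and> clock t \<le> clock s + 40) s"
  proof (cases "regs s RF = 0")
    case False
    then have j: "0 < j" "j < k" "extensible_at r vs ps j" "marks (verts vs j) (arrs s INL)"
      using pre(9) by (auto simp: defs)
    have d: "dfs r vs ps k"
      using pre(7) by (simp add: defs)
    have Wj: "cell 16 j \<le> wmax"
      using j k_le by (simp add: fits(3))
    show ?thesis
      using False pre(1-6) j Wj searching_resume[OF d j(1-3)] unfolding rem
      by (simp add: NEXT_def ready_def globals_def defs[symmetric])
  next
    case True
    then have j: "j = 0" "marks {r} (arrs s INL)"
      using pre(9) by (auto simp: defs)
    have R: "remaining r vs ps k = {T \<in> trees. \<Union>T \<subseteq> {..<r}}"
      using rem j remaining_1[of r vs ps] by simp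
    show ?thesis
    proof (cases "Suc r - k = 0")
      case True
      then have "{T \<in> trees. \<Union>T \<subseteq> {..<r}} = {}"
        by (intro no_small_trees) simp
      then show ?thesis
        using \<open>regs s RF = 0\<close> True pre(1-6) W unfolding R
        by (simp add: NEXT_def ready_def globals_def)
    next
      case False
      then have r: "k \<le> r" "r = Suc (r - 1)"
        using k_ge by auto
      \<comment> \<open>A list of length 1 is read only at position 0, so the other entries left by
        the previous root can stay.\<close>
      let ?vs = "vs(0 := r - 1)"
      have "searching (r - 1) ?vs ps 1 0 (r - 1)" "todo (r - 1) ?vs ps 1 0 (r - 1) = {T \<in> trees. \<Union>T \<subseteq> {..<Suc (r - 1)}}"
        using pre(5) r by (intro searching_root[OF low]; simp)+
      moreover have "marks (verts ?vs 1) ((arrs s INL)(r := 0, r - 1 := 1))"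
        using j(2) r by (auto simp: marks_def verts_def lessThan_Suc)
      ultimately show ?thesis
        using \<open>regs s RF = 0\<close> False pre(1-6) W r unfolding R
        by (simp add: NEXT_def ready_def globals_def defs[symmetric])
    qed
  qed
  then show ?thesis
    by (rule wp_mono) (use post defs in auto)
qed

lemma describes_record:
  assumes d: "dfs r vs ps k" and r: "r < n" and f: "inj_on f {..<n}"
  shows "describes (record_of f vs ps k) ((`) f ` tree_edges vs ps k)"
  unfolding describes_def
proof (intro exI conjI)
  let ?es = "map (\<lambda>i. (f (vs (ps i)), f (vs i))) [1..<k]"
  let ?e = "\<lambda>i. {vs (ps i), vs i}"
  show "record_of f vs ps k = concat (map (\<lambda>(u, v). [u, v]) ?es)"
    by (simp add: record_of_def comp_def)
  have m: "map (\<lambda>(u, v). {u, v}) ?es = map (\<lambda>i. f ` ?e i) [1..<k]"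
    by simp
  have "card (?e ` {1..<k}) = card {1..<k}"
    using tree_edges_props(1)[OF d] by (simp add: tree_edges_def)
  \<comment> \<open>As many edges as indices leave no room for a collision.\<close>
  then have inj: "inj_on ?e {1..<k}"
    by (intro eq_card_imp_inj_on) auto
  have sub: "?e i \<subseteq> {..<n}" if "i \<in> {1..<k}" for i
    using that dfs_parent[OF d, of i] dfs_le[OF d, of i] dfs_le[OF d, of "ps i"] r by auto
  have "inj_on (\<lambda>i. f ` ?e i) {1..<k}"
  proof (rule inj_onI)
    fix i j
    assume ij: "i \<in> {1..<k}" "j \<in> {1..<k}" "f ` ?e i = f ` ?e j"
    then have "?e i = ?e j"
      using inj_on_image_eq_iff[OF f sub sub] by blast
    then show "i = j"
      using inj ij by (auto dest: inj_onD)
  qed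
  then show "distinct (map (\<lambda>(u, v). {u, v}) ?es)"
    unfolding m by (simp add: distinct_map)
  show "set (map (\<lambda>(u, v). {u, v}) ?es) = (`) f ` tree_edges vs ps k"
    unfolding m by (simp add: tree_edges_def image_image)
qed

definition listed :: "(nat \<Rightarrow> nat) \<Rightarrow> nat list list \<Rightarrow> nat set set set \<Rightarrow> bool" where
  "listed f ls R \<longleftrightarrow> (\<exists>Ts. list_all2 (\<lambda>l T. describes l ((`) f ` T)) ls Ts \<and> distinct Ts \<and>
     set Ts \<inter> R = {} \<and> set Ts \<union> R = trees)"

lemma finite_trees: "finite trees"
proof -
  have "edges \<subseteq> Pow {..<n}"
    using adj_less adj_sym by (auto simp: edges_def)
  then have "trees \<subseteq> Pow (Pow {..<n})"
    by (auto simp: tree_def)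
  then show ?thesis
    by (rule finite_subset) simp
qed

text \<open>Yields the variant of the main loop: every pass adds a record, and there are finitely
  many trees.\<close>

lemma listed_length: "listed f ls R \<Longrightarrow> length ls \<le> card trees"
proof -
  assume "listed f ls R"
  then obtain Ts where "length ls = length Ts" "distinct Ts" "set Ts \<subseteq> trees"
    unfolding listed_def using list_all2_lengthD by blast
  then show ?thesis
    using card_mono[OF finite_trees, of "set Ts"] by (simp add: distinct_card)
qed

lemma listed_append:
  assumes "listed f ls (insert T R)" "T \<notin> R" "describes l ((`) f ` T)"
  shows "listed f (ls @ [l]) R"
proof -
  obtain Ts where Ts: "list_all2 (\<lambda>l T. describes l ((`) f ` T)) ls Ts" "distinct Ts"
     "set Ts \<inter> insert T R = {}" "set Ts \<union> insert T R = trees"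
    using assms(1) by (auto simp: listed_def)
  then have "list_all2 (\<lambda>l T. describes l ((`) f ` T)) (ls @ [l]) (Ts @ [T])" "distinct (Ts @ [T])"
     "set (Ts @ [T]) \<inter> R = {}" "set (Ts @ [T]) \<union> R = trees"
    using assms(2,3) by (auto simp: list_all2_appendI)
  then show ?thesis
    unfolding listed_def by blast
qed

lemma wp_MAIN:
  assumes low: "\<And>i. 0 < i \<Longrightarrow> i < n \<Longrightarrow> \<exists>u<i. adj i u"
    and f: "inj_on (arrs s ORD) {..<n}"
    and gap: "2000 * k\<^sup>2 \<le> gap"
    and pre: "ready s trees" "line s = []" "lines s = []" "latest s = None"
    and post: "\<And>t. line t = [] \<Longrightarrow> listed (arrs s ORD) (lines t) {} \<Longrightarrow> Q t"
  shows "wp MAIN Q s"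
proof -
  define f where "f = arrs s ORD"
  \<comment> \<open>The time from an emission to the next test of the main loop:
    \<open>FLAGS\<close>, \<open>BACKTRACK\<close>, and a constant for \<open>NEXT\<close>.\<close>
  let ?D = "k * (60 * k + 200) + k * (90 * k + 60) + 60"
  let ?I = "\<lambda>t. \<exists>R. ready t R \<and> arrs t ORD = f \<and> line t = [] \<and> listed f (lines t) R \<and>
    (\<forall>l. latest t = Some l \<longrightarrow> clock t \<le> l + ?D)"
  have wr: "\<not> writes_arr DESCEND ORD" "\<not> writes_arr DESCEND NXT" "silent DESCEND"
    "\<not> writes_reg DESCEND RN" "\<not> writes_reg DESCEND RK" "\<not> writes_reg DESCEND RONE" "\<not> writes_reg DESCEND RR" "\<not> writes_reg DESCEND RUN"
    by (auto simp: DESCEND_def)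
  have wrO: "\<not> writes_arr OUTPUT a" "\<not> writes_reg OUTPUT RN" "\<not> writes_reg OUTPUT RK" "\<not> writes_reg OUTPUT RONE"
    "\<not> writes_reg OUTPUT RR" "\<not> writes_reg OUTPUT RUN" for a
    by (auto simp: OUTPUT_def)
  have wrF: "writes_arr FLAGS a \<longleftrightarrow> a \<in> {OUTF, OUTS}" "silent FLAGS"
    "\<not> writes_reg FLAGS RN" "\<not> writes_reg FLAGS RK" "\<not> writes_reg FLAGS RONE"
    "\<not> writes_reg FLAGS RR" "\<not> writes_reg FLAGS RUN" for a
    by (auto simp: FLAGS_def SCAN_def)
  have wrB: "writes_arr BACKTRACK a \<longleftrightarrow> a = INL" "silent BACKTRACK"
    "\<not> writes_reg BACKTRACK RN" "\<not> writes_reg BACKTRACK RK" "\<not> writes_reg BACKTRACK RONE"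
    "\<not> writes_reg BACKTRACK RR" "\<not> writes_reg BACKTRACK RUN" for a
    by (auto simp: BACKTRACK_def PATH_def LATER_def)
  have wrN: "\<not> writes_arr NEXT ORD" "silent NEXT"
    by (auto simp: NEXT_def)
  note wrs = wr wrO wrF wrB wrN
  have kk: "2 * k \<le> k\<^sup>2" "4 \<le> k\<^sup>2"
    using k_ge power_mono[of 2 k 2] by (auto simp: power2_eq_square)
  have "k * (60 * k + 200) + k * (90 * k + 60) = 150 * k\<^sup>2 + 260 * k"
    by (simp add: power2_eq_square algebra_simps)
  \<comment> \<open>With \<open>DESCEND\<close> and \<open>OUTPUT\<close> added, this is
    \<open>630 * k^2 + 300 * k + 80\<close>, at most \<open>800 * k^2\<close> for
    \<open>k \<ge> 2\<close>. The factor 2000 leaves slack.\<close>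
  then have G: "?D + 480 * k\<^sup>2 + 40 * k + 20 \<le> gap"
    using gap kk by linarith
  show ?thesis
    unfolding MAIN_def
  proof (rule wp_WHILE[where I = ?I and V = "\<lambda>t. card trees - length (lines t)"], goal_cases)
    case 1
    have "listed f [] trees"
      by (auto simp: listed_def)
    then show ?case
      using pre by (auto simp: f_def)
  next
    case (2 t)
    then obtain R where R: "ready t R" "arrs t ORD = f" "line t = []" "listed f (lines t) R"
      "\<And>l. latest t = Some l \<Longrightarrow> clock t \<le> l + ?D"
      by blast
    define r where "r = regs t RR"
    have t: "globals t" "next_ok (arrs t NXT)" "r < n" "k \<le> Suc r"
        "searching r (arrs t VS) (arrs t PS) (regs t RM) (regs t RQ) (regs t RC)"
        "marks (verts (arrs t VS) (regs t RM)) (arrs t INL)"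
        "R = todo r (arrs t VS) (arrs t PS) (regs t RM) (regs t RQ) (regs t RC)"
      using R(1) 2(3) by (auto simp: ready_def r_def)
    show ?case
      unfolding wp_simps
    proof (rule wp_DESCEND[where r = r], goal_cases)
      case (7 t1)
      define vs ps where "vs = arrs t1 VS" "ps = arrs t1 PS"
      have s: "searching r vs ps k (regs t1 RQ) (regs t1 RC)"
        using 7 by (simp add: vs_ps_def)
      then have d: "dfs r vs ps k"
        by (simp add: searching_def)
      have R1: "R = insert (tree_edges vs ps k) (remaining r vs ps k)"
        using todo_complete(2)[OF s] 7(3) t(7) by (simp add: vs_ps_def)
      have g1: "globals t1" "arrs t1 ORD = f" "line t1 = []" "lines t1 = lines t" "latest t1 = latest t"
        "regs t1 RR = r" "regs t1 RUN = regs t RUN" "next_ok (arrs t1 NXT)"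
        using 7(1) t R by (auto simp: globals_def sames wrs r_def)
      show ?case
      proof (rule wp_OUTPUT[where r = r], goal_cases)
        case (5 t2)
        have g2: "globals t2" "arrs t2 = arrs t1" "regs t2 RR = r" "regs t2 RUN = regs t RUN"
          using 5(1) g1 by (auto simp: globals_def sames wrs)
        have c2: "clock t2 - l \<le> gap" if "latest t2 = Some l" for l
          using R(5)[of l] that 5(3,5) 7(5) g1(5) G by simp
        let ?t3 = "tick 1 (put_line t2)"
        have "describes (line t2) ((`) f ` tree_edges vs ps k)"
          using describes_record[OF d t(3)] f 5(4) g1(2) by (simp add: f_def vs_ps_def)
        then have L: "listed f (lines t2 @ [line t2]) (remaining r vs ps k)"
          using R(4) todo_complete(3)[OF s] 5(2) g1(4) unfolding R1 by (intro listed_append) auto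
        have "wp FLAGS (wp BACKTRACK (wp NEXT (\<lambda>t'. ?I (tick 1 t') \<and>
            card trees - length (lines (tick 1 t')) < card trees - length (lines t)))) ?t3"
        proof (rule wp_FLAGS[where r = r], goal_cases)
          case (7 t4)
          have g4: "globals t4" "arrs t4 VS = vs" "arrs t4 PS = ps" "arrs t4 INL = arrs t1 INL"
            "arrs t4 NXT = arrs t1 NXT" "arrs t4 ORD = f" "regs t4 RR = r" "regs t4 RUN = regs t RUN"
            "line t4 = []" "lines t4 = lines t2 @ [line t2]" "latest t4 = Some (clock t2)"
            using 7(1) g1 g2 by (auto simp: globals_def sames wrs vs_ps_def)
          have c4: "clock t4 \<le> clock t2 + k * (60 * k + 200) + 4"
            using 7(3) by simp
          have fl: "flags_ok r vs ps k (arrs t4 OUTF) (arrs t4 OUTS)"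
            using 7(2) g2 by (simp add: vs_ps_def)
          show ?case
          proof (rule wp_BACKTRACK[where r = r], goal_cases)
            case (7 t5)
            have g5: "globals t5" "arrs t5 VS = vs" "arrs t5 PS = ps"
              "arrs t5 NXT = arrs t1 NXT" "arrs t5 ORD = f" "regs t5 RR = r" "regs t5 RUN = regs t RUN"
              "line t5 = []" "lines t5 = lines t2 @ [line t2]" "latest t5 = Some (clock t2)"
              using 7(1) g4 by (auto simp: globals_def sames wrs)
            have c5: "clock t5 \<le> clock t2 + k * (60 * k + 200) + k * (90 * k + 60) + 7"
              using 7(4) c4 by simp
            show ?case
            proof (rule wp_NEXT[where r = r, OF low], goal_cases)
              case (12 t6)
              have g6: "arrs t6 ORD = f" "line t6 = []" "lines t6 = lines t2 @ [line t2]" "latest t6 = Some (clock t2)"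
                using 12(1) g5 by (auto simp: sames wrs)
              have "ready (tick 1 t6) (remaining r vs ps k)"
                using 12(2) g5 by (simp add: ready_def globals_def)
              moreover have "length (lines t6) \<le> card trees" "length (lines t6) = Suc (length (lines t))"
                using listed_length[OF L] g6 5(2) g1(4) by auto
              ultimately show ?case
                using g6 L 12(3) c5 by (auto intro!: exI[of _ "remaining r vs ps k"])
            qed (use g5 7 g4 g1 t d 2(3) in auto)
          qed (use g4 g1 t d fl \<open>marks (verts (arrs t1 VS) k) (arrs t1 INL)\<close> in \<open>auto simp: vs_ps_def\<close>)
        qed (use g1 g2 t d 7 in \<open>auto simp: globals_def vs_ps_def\<close>)
        then show ?case
          using c2 by simp
      qed (use g1 t d in \<open>auto simp: vs_ps_def\<close>)
    qed (use t in \<open>auto simp: globals_def r_def\<close>)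
  next
    case (3 t)
    then show ?case
      using post by (auto simp: ready_def f_def)
  qed
qed

end

section \<open>Preprocessing\<close>

text \<open>All preprocessing takes place before the first record, where its running time does not matter.\<close>

definition MATRIX :: com where
  "MATRIX = SET RX 0 ;; INPUT RN RX ;; SET RONE 1 ;; INPUT RK RONE ;;
     SET RV 0 ;; COPY RT RN ;; WHILE RT (
       SET RX 2 ;; OP PLUS RX RX RV ;; INPUT RI RX ;; OP PLUS RX RX RONE ;; INPUT RL RX ;;
       OP MINUS RG RL RI ;; WHILE RG (
         INPUT RY RI ;; OP TIMES RX RV RN ;; OP PLUS RX RX RY ;; PUT ADJ RX RONE ;;
         OP PLUS RI RI RONE ;; OP MINUS RG RL RI) ;;
       OP PLUS RV RV RONE ;; OP MINUS RT RN RV)"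

text \<open>All pairs \<open>(v, u)\<close>, coded as \<open>v * n + u\<close>, are searched for an
  edge from an unlabelled \<open>v\<close> to a labelled \<open>u\<close>; then \<open>v\<close>
  gets the next label and the scan starts over. So each new vertex has a neighbour with a smaller
  label. About \<open>n^3\<close> iterations are harmless before the first record.\<close>

definition LABEL :: com where
  "LABEL = SET RX 0 ;; PUT LAB RX RONE ;; PUT ORD RX RX ;; COPY RM RONE ;; SET RI 0 ;;
     OP MINUS RT RN RM ;; WHILE RT (
       OP OVER RV RI RN ;; OP TIMES RW RV RN ;; OP MINUS RW RI RW ;;
       GET RX ADJ RI ;; GET RY LAB RV ;; GET RP LAB RW ;;
       SET RF 0 ;; IF RX (IF RY SKIP (COPY RF RP)) SKIP ;;
       IF RF (PUT LAB RV RONE ;; PUT ORD RM RV ;; OP PLUS RM RM RONE ;; SET RI 0)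
         (OP PLUS RI RI RONE) ;;
       OP MINUS RT RN RM)"

text \<open>Row \<open>w\<close> is filled from left to right: entry \<open>c\<close> is
  \<open>c\<close> if \<open>c - 1\<close> is a neighbour of \<open>w\<close>, and otherwise a copy
  of the entry before it. Rows and columns are labels, translated by \<open>ORD\<close> for the
  matrix.\<close>

definition NEXTS :: com where
  "NEXTS = SET RI 0 ;; OP TIMES RL RN RN ;; OP MINUS RT RL RI ;; WHILE RT (
     OP OVER RW RI RN ;; OP TIMES RX RW RN ;; OP MINUS RC RI RX ;;
     IF RC
       (OP MINUS RX RC RONE ;; GET RX ORD RX ;; GET RW ORD RW ;; OP TIMES RW RW RN ;;
        OP PLUS RX RW RX ;; GET RX ADJ RX ;;
        IF RX (PUT NXT RI RC) (OP MINUS RX RI RONE ;; GET RX NXT RX ;; PUT NXT RI RX))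
       (PUT NXT RI RC) ;;
     OP PLUS RI RI RONE ;; OP MINUS RT RL RI)"

definition START :: com where
  "START = OP MINUS RR RN RONE ;; SET RX 0 ;; PUT VS RX RR ;; PUT INL RR RONE ;;
     COPY RQ RX ;; COPY RM RONE ;; COPY RC RR ;; COPY RUN RONE"

text \<open>Separates the layout of the input from the program. \<open>E_connected\<close> states
  connectivity as a cut condition, the form in which the labelling consumes it.\<close>

locale graph_input = roomy_machine inp base wmax gap n
  for inp :: "nat \<Rightarrow> nat" and base wmax gap n :: nat +
  fixes k :: nat and E :: "nat \<Rightarrow> nat \<Rightarrow> bool" and st :: "nat \<Rightarrow> nat"
  assumes E_sym: "E u v \<Longrightarrow> E v u"
    and E_irrefl: "\<not> E u u"
    and E_less: "E u v \<Longrightarrow> u < n"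
    and E_connected: "L \<subset> {..<n} \<Longrightarrow> L \<noteq> {} \<Longrightarrow> \<exists>v u. E v u \<and> v \<notin> L \<and> u \<in> L"
    and inp_n: "inp 0 = n" and inp_k: "inp 1 = k"
    and inp_start: "v \<le> n \<Longrightarrow> inp (2 + v) = st v" "v \<le> n \<Longrightarrow> st v \<le> base"
    and inp_list: "v < n \<Longrightarrow> inp ` {st v..<st (Suc v)} = {u. E v u}"
    and n_base: "n + 3 \<le> base" and k_bounds: "2 \<le> k" "k \<le> n"
begin

lemma n_ge: "2 \<le> n"
  using k_bounds by simp

lemma index_eq_iff: "u < n \<Longrightarrow> u' < n \<Longrightarrow> v * n + u = v' * n + u' \<longleftrightarrow> v = v' \<and> u = u'"
  by (metis add.commute add_right_cancel div_less div_mult_self3 less_nat_zero_code mod_less mod_mult_self2)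

lemma index_div_mod:
  assumes "z < n * n"
  shows "z div n < n" "z mod n < n" "z - z div n * n = z mod n" "z div n * n \<le> n * n"
proof -
  show "z div n < n" "z mod n < n" "z - z div n * n = z mod n"
    using assms n_ge by (simp_all add: less_mult_imp_div_less minus_div_mult_eq_mod)
  show "z div n * n \<le> n * n"
    using assms div_times_less_eq_dividend[of z n] by linarith
qed

definition represents_rel :: "(nat \<Rightarrow> nat) \<Rightarrow> (nat \<Rightarrow> nat \<Rightarrow> bool) \<Rightarrow> bool" where
  "represents_rel f P \<longleftrightarrow> (\<forall>v<n. \<forall>u<n. f (v * n + u) = (if P v u then 1 else 0))"

lemma represents_rel_insert:
  "represents_rel f P \<Longrightarrow> v < n \<Longrightarrow> u < n \<Longrightarrow>
    represents_rel (f(v * n + u := 1)) (\<lambda>a b. P a b \<or> a = v \<and> b = u)"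
  by (auto simp: represents_rel_def index_eq_iff)

lemma represents_rel_cong:
  "represents_rel f P \<Longrightarrow> (\<And>a b. a < n \<Longrightarrow> b < n \<Longrightarrow> P a b \<longleftrightarrow> P' a b) \<Longrightarrow> represents_rel f P'"
  by (simp add: represents_rel_def)

lemma wp_MATRIX:
  assumes pre: "\<And>i. arrs s ADJ i = 0"
    and post: "\<And>t. same MATRIX s t \<Longrightarrow> regs t RN = n \<Longrightarrow> regs t RK = k \<Longrightarrow> regs t RONE = 1 \<Longrightarrow>
      represents_rel (arrs t ADJ) E \<Longrightarrow> Q t"
  shows "wp MATRIX Q s"
proof -
  let ?I = "\<lambda>t. regs t RN = n \<and> regs t RK = k \<and> regs t RONE = 1 \<and> regs t RT = n - regs t RV \<and>
    regs t RV \<le> n \<and> represents_rel (arrs t ADJ) (\<lambda>v u. v < regs t RV \<and> E v u)"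
  have "wp MATRIX (\<lambda>t. regs t RN = n \<and> regs t RK = k \<and> regs t RONE = 1 \<and> represents_rel (arrs t ADJ) E) s"
    unfolding MATRIX_def wp_simps
  proof (intro conjI, goal_cases)
    case 6
    show ?case
    proof (rule wp_WHILE[where I = ?I and V = "\<lambda>t. regs t RT"], goal_cases)
      case 1
      then show ?case
        using pre inp_n inp_k by (simp add: represents_rel_def)
    next
      case (2 t)
      define v where "v = regs t RV"
      have v: "v < n" "regs t RN = n" "regs t RK = k" "regs t RONE = 1" "regs t RT = n - v"
        and rep: "represents_rel (arrs t ADJ) (\<lambda>a b. a < v \<and> E a b)"
        using 2 by (auto simp: v_def)
      have st: "inp (2 + v) = st v" "inp (Suc (2 + v)) = st (Suc v)" "st (Suc v) \<le> base"
        using v inp_start(1)[of v] inp_start(1)[of "Suc v"] inp_start(2)[of "Suc v"] by auto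
      \<comment> \<open>At the exit truncated subtraction only yields that \<open>RI\<close> has
        reached at least \<open>st (Suc v)\<close>, hence the minimum.\<close>
      let ?J = "\<lambda>t'. regs t' RN = n \<and> regs t' RK = k \<and> regs t' RONE = 1 \<and> regs t' RV = v \<and>
        regs t' RL = st (Suc v) \<and> regs t' RG = st (Suc v) - regs t' RI \<and> st v \<le> regs t' RI \<and>
        represents_rel (arrs t' ADJ) (\<lambda>a b. a < v \<and> E a b \<or> a = v \<and> b \<in> inp ` {st v..<min (regs t' RI) (st (Suc v))})"
      have W: "2 \<le> wmax" "2 + v \<le> wmax" "Suc (2 + v) \<le> wmax" "2 + v < base" "Suc (2 + v) < base"
          "st (Suc v) - st v \<le> wmax"
        using v n_base st by (auto intro!: fits(5))
      show ?case
        unfolding wp_simps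
      proof (intro conjI, goal_cases)
        case 7
        show ?case
        proof (rule wp_WHILE[where I = ?J and V = "\<lambda>t'. regs t' RG"], goal_cases)
          case 1
          show ?case
            using v rep st by (simp add: v_def[symmetric])
        next
          case (2 t')
          define i where "i = regs t' RI"
          have i: "st v \<le> i" "i < st (Suc v)" "i < base"
            and t': "regs t' RN = n" "regs t' RK = k" "regs t' RONE = 1" "regs t' RV = v"
              "regs t' RL = st (Suc v)" "regs t' RI = i"
            and rep': "represents_rel (arrs t' ADJ) (\<lambda>a b. a < v \<and> E a b \<or> a = v \<and> b \<in> inp ` {st v..<i})"
            using 2 st by (auto simp: i_def min_def split: if_splits)
          have "inp i \<in> {u. E v u}"
            unfolding inp_list[OF v(1), symmetric] using i by auto
          then have u: "inp i < n"
            using E_sym E_less by blast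
          note W' = index_fits[OF v(1) u]
          have W'': "Suc i \<le> wmax" "st (Suc v) - Suc i \<le> wmax"
            using i st by (auto intro!: fits(5))
          have "represents_rel ((arrs t' ADJ)(v * n + inp i := 1))
              (\<lambda>a b. a < v \<and> E a b \<or> a = v \<and> b \<in> inp ` {st v..<Suc i})"
            by (rule represents_rel_cong[OF represents_rel_insert[OF rep' v(1) u]])
              (use i in \<open>auto simp: atLeastLessThanSuc\<close>)
          moreover have "min (Suc i) (st (Suc v)) = Suc i"
            using i by simp
          ultimately show ?case
            using t' W' W'' i 2(1) by simp
        next
          case (3 t')
          have "min (regs t' RI) (st (Suc v)) = st (Suc v)"
            using 3 by (simp add: min_def)
          then have "represents_rel (arrs t' ADJ) (\<lambda>a b. a < v \<and> E a b \<or> a = v \<and> b \<in> {u. E v u})"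
            using 3(1) inp_list[OF v(1)] by simp
          then have "represents_rel (arrs t' ADJ) (\<lambda>a b. a < Suc v \<and> E a b)"
            by (rule represents_rel_cong) (auto simp: less_Suc_eq)
          moreover have "Suc v \<le> wmax" "n - Suc v \<le> wmax"
            using v by (auto intro!: fits(4))
          ultimately show ?case
            using 3 v by auto
        qed
      qed (use v st W in \<open>simp_all add: v_def[symmetric]\<close>)
    next
      case (3 t)
      then have "regs t RV = n"
        by simp
      then show ?case
        using 3(1) represents_rel_cong[of "arrs t ADJ" "\<lambda>v u. v < n \<and> E v u" E] by simp
    qed
  qed (use n_base inp_n k_bounds in \<open>auto intro!: fits(5)\<close>)
  then show ?thesis
    by (rule wp_mono) (use post in auto)
qed

definition ordering :: "(nat \<Rightarrow> nat) \<Rightarrow> nat \<Rightarrow> bool" where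
  "ordering f m \<longleftrightarrow> inj_on f {..<m} \<and> f ` {..<m} \<subseteq> {..<n} \<and> (\<forall>i. 0 < i \<and> i < m \<longrightarrow> (\<exists>j<i. E (f i) (f j)))"

definition labelled :: "(nat \<Rightarrow> nat) \<Rightarrow> nat \<Rightarrow> (nat \<Rightarrow> nat) \<Rightarrow> nat \<Rightarrow> bool" where
  "labelled f m lab z \<longleftrightarrow> ordering f m \<and>
    (\<forall>v<n. lab v = (if v \<in> f ` {..<m} then 1 else 0)) \<and>
    (\<forall>z'<z. z' < n * n \<longrightarrow>
      \<not> (E (z' div n) (z' mod n) \<and> z' div n \<notin> f ` {..<m} \<and> z' mod n \<in> f ` {..<m}))"

text \<open>A lexicographic measure as one number: a new label is worth one more than a full scan of
  the \<open>n * n\<close> pairs, which begins anew.\<close>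

definition effort :: "nat \<Rightarrow> nat \<Rightarrow> nat" where
  "effort m z = (n - m) * (n * n + 1) + (n * n - z)"

lemma effort_skip: "z < n * n \<Longrightarrow> effort m (Suc z) < effort m z"
  unfolding effort_def by linarith

lemma effort_restart: "m < n \<Longrightarrow> effort (Suc m) 0 < effort m z"
proof -
  assume "m < n"
  then have "n - m = Suc (n - Suc m)"
    by simp
  then have "(n - m) * (n * n + 1) = (n - Suc m) * (n * n + 1) + (n * n + 1)"
    by (simp only: mult_Suc add.commute)
  then show ?thesis
    unfolding effort_def by linarith
qed

lemma wp_LABEL:
  assumes pre: "regs s RN = n" "regs s RONE = 1" "represents_rel (arrs s ADJ) E" "\<And>i. arrs s LAB i = 0"
    and post: "\<And>t. same LABEL s t \<Longrightarrow> ordering (arrs t ORD) n \<Longrightarrow> Q t"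
  shows "wp LABEL Q s"
proof -
  let ?I = "\<lambda>t. regs t RT = n - regs t RM \<and> 0 < regs t RM \<and> regs t RM \<le> n \<and>
    labelled (arrs t ORD) (regs t RM) (arrs t LAB) (regs t RI)"
  let ?V = "\<lambda>t. effort (regs t RM) (regs t RI)"
  have "wp LABEL (\<lambda>t. ordering (arrs t ORD) n) s"
    unfolding LABEL_def wp_simps
  proof (intro conjI, goal_cases)
    case 8
    show ?case
    proof (rule wp_WHILE[where I = ?I and V = ?V], goal_cases)
      case 1
      have "labelled ((arrs s ORD)(0 := 0)) 1 ((arrs s LAB)(0 := 1)) 0"
        using pre n_ge by (auto simp add: labelled_def ordering_def lessThan_Suc)
      then show ?case
        using pre n_ge by simp
    next
      case (2 t)
      have t: "regs t RN = n" "regs t RONE = 1" "arrs t ADJ = arrs s ADJ"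
        using pre 2(2) by (auto simp: sames)
      define m z f where "m = regs t RM" "z = regs t RI" "f = arrs t ORD"
      note defs = this
      have I: "0 < m" "m < n" "ordering f m" "\<And>v. v < n \<Longrightarrow> arrs t LAB v = (if v \<in> f ` {..<m} then 1 else 0)"
        "\<And>z'. z' < z \<Longrightarrow> z' < n * n \<Longrightarrow> \<not> (E (z' div n) (z' mod n) \<and> z' div n \<notin> f ` {..<m} \<and> z' mod n \<in> f ` {..<m})"
        using 2(1,3) unfolding defs labelled_def by auto
      have "f ` {..<m} \<subset> {..<n}"
      proof -
        have "card (f ` {..<m}) < card {..<n}"
          using card_image_le[of "{..<m}" f] I(2) by simp
        then have "f ` {..<m} \<noteq> {..<n}"
          by (metis less_irrefl)
        moreover have "f ` {..<m} \<subseteq> {..<n}"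
          using I(3) by (simp add: ordering_def)
        ultimately show ?thesis
          by (rule psubsetI[rotated])
      qed
      moreover have "f ` {..<m} \<noteq> {}"
        using I(1) by auto
      ultimately obtain v u where vu: "E v u" "v \<notin> f ` {..<m}" "u \<in> f ` {..<m}"
        using E_connected[of "f ` {..<m}"] by blast
      then have "v < n" "u < n"
        using E_less E_sym by blast+
      then have "v * n + u < n * n" "(v * n + u) div n = v" "(v * n + u) mod n = u"
        using index_less by auto
      \<comment> \<open>A usable pair exists by connectivity and none was seen before
        \<open>z\<close>, so the scan cannot run off the end and \<open>LABEL\<close> needs no test
        for it.\<close>
      then have z: "z < n * n"
        using I(5)[of "v * n + u"] vu by force
      note zd = index_div_mod[OF z]
      have A: "arrs s ADJ z = (if E (z div n) (z mod n) then 1 else 0)"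
      proof -
        have "arrs s ADJ (z div n * n + z mod n) = (if E (z div n) (z mod n) then 1 else 0)"
          using pre(3) zd unfolding represents_rel_def by blast
        then show ?thesis
          by simp
      qed
      have W: "z \<le> wmax" "Suc z \<le> wmax" "cell 16 z \<le> wmax" "z div n * n \<le> wmax"
        using z zd(4) by (simp_all add: fits(1,2))
      have W': "z div n \<le> wmax" "z mod n \<le> wmax" "cell 16 (z div n) \<le> wmax" "cell 16 (z mod n) \<le> wmax"
        "cell 16 m \<le> wmax" "Suc m \<le> wmax" "n - m \<le> wmax" "n - Suc m \<le> wmax" "0 \<le> wmax"
        using zd(1,2) I(2) by (simp_all add: fits(3,4))
      have lab: "arrs t LAB (z div n) = (if z div n \<in> f ` {..<m} then 1 else 0)"
        "arrs t LAB (z mod n) = (if z mod n \<in> f ` {..<m} then 1 else 0)"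
        using I(4) zd by simp_all
      define a b where "a = z div n" "b = z mod n"
      have D: "z div n = a" "z - a * n = b"
        using zd(3) by (simp_all add: a_b_def)
      note W = W[unfolded D(1)] W'[folded a_b_def]
      have M: "regs t RM = m" "regs t RI = z" "regs t RT = n - m" "arrs t ORD = f"
        using 2(1) by (auto simp: defs)
      show ?case
      proof (cases "E (z div n) (z mod n) \<and> z div n \<notin> f ` {..<m} \<and> z mod n \<in> f ` {..<m}")
        case True
        let ?f = "f(m := z div n)"
        have img: "?f ` {..<Suc m} = insert (z div n) (f ` {..<m})"
          by (auto simp: lessThan_Suc)
        have "inj_on ?f {..<Suc m}"
          using I(3) True unfolding ordering_def lessThan_Suc inj_on_insert
          by (auto intro!: inj_on_fun_updI simp: image_iff)
        moreover have "\<exists>j<i. E (?f i) (?f j)" if i: "0 < i" "i < Suc m" for i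
        proof (cases "i = m")
          case True
          obtain j where "j < m" "z mod n = f j"
            using \<open>E _ _ \<and> _\<close> by auto
          then show ?thesis
            using \<open>E _ _ \<and> _\<close> True by (auto intro!: exI[of _ j])
        next
          case False
          then obtain j where "j < i" "E (f i) (f j)"
            using i I(3) by (auto simp: ordering_def)
          then show ?thesis
            using False i by (auto intro!: exI[of _ j])
        qed
        ultimately have o: "ordering ?f (Suc m)"
          using I(3) zd unfolding ordering_def img by auto
        then have "labelled ?f (Suc m) ((arrs t LAB)(z div n := 1)) 0"
          using I(4) unfolding labelled_def img by simp
        moreover have "arrs s ADJ z = 1" "arrs t LAB a = 0" "arrs t LAB b = 1"
          using True A lab by (simp_all add: a_b_def)
        ultimately show ?thesis
          using t W I(1,2) M D effort_restart[OF I(2), of z] by (simp add: a_b_def(1)[symmetric])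
      next
        case False
        have nz: "\<not> (E (z' div n) (z' mod n) \<and> z' div n \<notin> f ` {..<m} \<and> z' mod n \<in> f ` {..<m})"
          if "z' < Suc z" "z' < n * n" for z'
          using I(5)[of z'] False that by (cases "z' = z") auto
        then have nz: "labelled f m (arrs t LAB) (Suc z)"
          using I(3,4) by (simp add: labelled_def)
        have no: "arrs s ADJ z = 0 \<or> arrs t LAB a \<noteq> 0 \<or> arrs t LAB b = 0"
          using False A lab by (auto simp: a_b_def)
        show ?thesis
          using effort_skip[OF z, of m] no t W I(1,2) M D nz
          by (cases "arrs s ADJ z = 0"; cases "arrs t LAB a = 0"; cases "arrs t LAB b = 0") simp_all
      qed
    next
      case (3 t)
      then have "regs t RM = n"
        by simp
      then show ?case
        using 3(1) by (simp add: labelled_def)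
    qed
  qed (use pre n_ge in \<open>simp_all add: fits(3,4)\<close>)
  then show ?thesis
    by (rule wp_mono) (use post in auto)
qed

definition next_at :: "(nat \<Rightarrow> nat \<Rightarrow> bool) \<Rightarrow> nat \<Rightarrow> nat \<Rightarrow> nat \<Rightarrow> bool" where
  "next_at A w c x \<longleftrightarrow> (x = 0 \<longrightarrow> (\<forall>u<c. \<not> A w u)) \<and>
     (\<forall>u. x = Suc u \<longrightarrow> u < c \<and> A w u \<and> (\<forall>v. u < v \<and> v < c \<longrightarrow> \<not> A w v))"

lemma wp_NEXTS:
  assumes pre: "regs s RN = n" "regs s RONE = 1" "represents_rel (arrs s ADJ) E" "arrs s ORD = f"
      "\<And>i. i < n \<Longrightarrow> f i < n"
    and post: "\<And>t. same NEXTS s t \<Longrightarrow>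
      \<forall>w<n. \<forall>c<n. next_at (\<lambda>a b. E (f a) (f b)) w c (arrs t NXT (w * n + c)) \<Longrightarrow> Q t"
  shows "wp NEXTS Q s"
proof -
  let ?A = "\<lambda>a b. E (f a) (f b)"
  let ?I = "\<lambda>t. regs t RL = n * n \<and> regs t RT = n * n - regs t RI \<and> regs t RI \<le> n * n \<and>
    (\<forall>z<regs t RI. next_at ?A (z div n) (z mod n) (arrs t NXT z))"
  have "wp NEXTS (\<lambda>t. \<forall>z<n * n. next_at ?A (z div n) (z mod n) (arrs t NXT z)) s"
    unfolding NEXTS_def wp_simps
  proof (intro conjI, goal_cases)
    case 4
    show ?case
    proof (rule wp_WHILE[where I = ?I and V = "\<lambda>t. regs t RT"], goal_cases)
      case 1
      then show ?case
        using pre by simp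
    next
      case (2 t)
      have t: "regs t RN = n" "regs t RONE = 1" "arrs t ADJ = arrs s ADJ" "arrs t ORD = f"
        using pre 2(2) by (auto simp: sames)
      define z where "z = regs t RI"
      have z: "z < n * n" "regs t RL = n * n" "regs t RT = n * n - z"
        and I: "\<And>z'. z' < z \<Longrightarrow> next_at ?A (z' div n) (z' mod n) (arrs t NXT z')"
        using 2 by (auto simp: z_def)
      note zd = index_div_mod[OF z(1)]
      define w c where "w = z div n" "c = z mod n"
      have wc: "w < n" "c < n" "z = w * n + c" "z - w * n = c" "w * n \<le> n * n"
        using zd by (auto simp: w_c_def)
      have W: "z \<le> wmax" "Suc z \<le> wmax" "cell 16 z \<le> wmax" "w * n \<le> wmax" "n * n - Suc z \<le> wmax"
        using z(1) wc(5) by (simp_all add: fits(1,2))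
      have W': "w \<le> wmax" "c \<le> wmax" "c - 1 \<le> wmax" "cell 16 w \<le> wmax" "cell 16 (c - 1) \<le> wmax"
        using wc(1,2) by (simp_all add: fits(3,4))
      have fin: "next_at ?A (z' div n) (z' mod n) (((arrs t NXT)(z := x)) z')"
        if "z' < Suc z" "next_at ?A w c x" for z' x
        using that I[of z'] w_c_def by (cases "z' = z") auto
      have D: "z div n = w"
        by (simp add: w_c_def)
      have zi: "regs t RI = z"
        by (simp add: z_def)
      show ?case
      proof (cases c)
        case 0
        then have "next_at ?A w c 0"
          by (simp add: next_at_def)
        then have F: "\<forall>z'<Suc z. next_at ?A (z' div n) (z' mod n) (((arrs t NXT)(z := 0)) z')"
          using fin by blast
        then show ?thesis
          using 0 t z W W' wc(4) F
          by (simp add: zi D)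
      next
        case (Suc c')
        have c': "c' < n" "f w < n" "f c' < n"
          using wc Suc pre(5) by auto
        note X = index_fits[OF c'(2,3)]
        have A: "arrs s ADJ (f w * n + f c') = (if ?A w c' then 1 else 0)"
          using pre(3) c' unfolding represents_rel_def by blast
        have z': "z - 1 = w * n + c'" "(z - 1) div n = w" "(z - 1) mod n = c'" "z - 1 < z"
          using wc(3) Suc c'(1) by auto
        have Z: "z - 1 \<le> wmax" "cell 16 (z - 1) \<le> wmax"
          using z(1) by (simp_all add: fits(1,2))
        show ?thesis
        proof (cases "?A w c'")
          case True
          then have "next_at ?A w c c"
            using Suc by (auto simp: next_at_def)
          then have F: "\<forall>z'<Suc z. next_at ?A (z' div n) (z' mod n) (((arrs t NXT)(z := c)) z')"
            using fin by blast
          then show ?thesis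
            using Suc True t z W W' X A wc(4) F
            by (simp add: zi D)
        next
          case False
          have "next_at ?A w c' (arrs t NXT (z - 1))"
            using I[OF z'(4)] unfolding z'(2,3) .
          then have "next_at ?A w c (arrs t NXT (z - 1))"
            using False Suc unfolding next_at_def by (auto simp: less_Suc_eq)
          then have F: "\<forall>z'<Suc z. next_at ?A (z' div n) (z' mod n) (((arrs t NXT)(z := arrs t NXT (z - 1))) z')"
            using fin by blast
          then show ?thesis
            using Suc False t z W W' X A Z wc(4) F
            by (simp add: zi D)
        qed
      qed
    next
      case (3 t)
      then have "regs t RI = n * n"
        by simp
      then show ?case
        using 3(1) by simp
    qed
  qed (use pre in \<open>auto intro!: fits(1,2)\<close>)
  then show ?thesis
  proof (rule wp_mono)
    fix t
    assume t: "\<forall>z<n * n. next_at ?A (z div n) (z mod n) (arrs t NXT z)" "same NEXTS s t"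
    have "next_at ?A w c (arrs t NXT (w * n + c))" if "w < n" "c < n" for w c
      using t(1) index_less[OF that] that by force
    then show "Q t"
      using post t(2) by blast
  qed
qed

end

section \<open>The complete program\<close>

definition PROGRAM :: com where
  "PROGRAM = MATRIX ;; LABEL ;; NEXTS ;; START ;; MAIN"

definition program :: "instr list" where
  "program = [Const 3 0, Load 4 3, Const 3 2, Add 3 3 4, Load 2 3, Const 1 16] @ compile 6 PROGRAM"

context graph_input
begin

lemma wp_PROGRAM:
  assumes gap: "2000 * k\<^sup>2 \<le> gap"
    and pre: "\<And>a i. arrs s a i = 0" "line s = []" "lines s = []" "latest s = None"
  shows "wp PROGRAM (\<lambda>t. line t = [] \<and> (\<exists>Ts. list_all2 describes (lines t) Ts \<and> distinct Ts \<and>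
    set Ts = {T. tree {{u, v} | u v. E u v} k T})) s"
  unfolding PROGRAM_def wp_simps
proof (rule wp_MATRIX, goal_cases)
  case (2 t1)
  have wM: "writes_arr MATRIX a \<longleftrightarrow> a = ADJ" "silent MATRIX" for a
    by (auto simp: MATRIX_def)
  have wL: "writes_arr LABEL a \<longleftrightarrow> a \<in> {LAB, ORD}" "silent LABEL"
    "\<not> writes_reg LABEL RN" "\<not> writes_reg LABEL RK" "\<not> writes_reg LABEL RONE" for a
    by (auto simp: LABEL_def)
  have wN: "writes_arr NEXTS a \<longleftrightarrow> a = NXT" "silent NEXTS"
    "\<not> writes_reg NEXTS RN" "\<not> writes_reg NEXTS RK" "\<not> writes_reg NEXTS RONE" for a
    by (auto simp: NEXTS_def)
  have t1: "\<And>a i. a \<noteq> ADJ \<Longrightarrow> arrs t1 a i = 0" "line t1 = []" "lines t1 = []" "latest t1 = None"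
    using 2(1) pre by (simp_all add: sames wM)
  show ?case
  proof (rule wp_LABEL, goal_cases)
    case (5 t2)
    have t2: "arrs t2 ADJ = arrs t1 ADJ" "\<And>i. arrs t2 INL i = 0" "line t2 = []" "lines t2 = []" "latest t2 = None"
      "regs t2 RN = n" "regs t2 RK = k" "regs t2 RONE = 1"
      using 5(1) t1 2 by (simp_all add: sames wL)
    define f where "f = arrs t2 ORD"
    have f: "inj_on f {..<n}" "\<And>i. i < n \<Longrightarrow> f i < n" "\<And>i. 0 < i \<Longrightarrow> i < n \<Longrightarrow> \<exists>j<i. E (f i) (f j)"
      using 5(2) by (auto simp: f_def ordering_def)
    \<comment> \<open>Adjacency of labels. Outside \<open>{..<n}\<close> the contents of
      \<open>ORD\<close> are not controlled, hence the bounds on \<open>i\<close> and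
      \<open>j\<close>.\<close>
    let ?A = "\<lambda>i j. i < n \<and> j < n \<and> E (f i) (f j)"
    interpret lister ?A n k inp base wmax gap
      by unfold_locales (use E_sym E_irrefl k_bounds room in auto)
    show ?case
    proof (rule wp_NEXTS[where f = f], goal_cases)
      case (6 t3)
      have t3: "\<And>i. arrs t3 INL i = 0" "line t3 = []" "lines t3 = []" "latest t3 = None" "arrs t3 ORD = f"
        "regs t3 RN = n" "regs t3 RK = k" "regs t3 RONE = 1"
        using 6(1) t2 by (simp_all add: sames wN f_def)
      have nx: "next_ok (arrs t3 NXT)"
        unfolding next_ok_def
      proof (intro allI impI)
        fix w c
        assume wc: "w < n" "c < n"
        then have "next_at (\<lambda>a b. E (f a) (f b)) w c (arrs t3 NXT (w * n + c))"
          using 6(2) by blast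
        then show "(arrs t3 NXT (w * n + c) = 0 \<longrightarrow> (\<forall>u<c. \<not> ?A w u)) \<and>
          (\<forall>u. arrs t3 NXT (w * n + c) = Suc u \<longrightarrow>
            u < c \<and> ?A w u \<and> (\<forall>v. u < v \<and> v < c \<longrightarrow> \<not> ?A w v))"
          using wc unfolding next_at_def by auto
      qed
      have low: "\<exists>u<i. ?A i u" if "0 < i" "i < n" for i
        using f(3)[OF that] that by force
      define vs where "vs = (arrs t3 VS)(0 := n - 1)"
      have root: "searching (n - 1) vs (arrs t3 PS) 1 0 (n - 1)"
        "todo (n - 1) vs (arrs t3 PS) 1 0 (n - 1) = trees"
      proof -
        have n: "n - 1 < n" "k \<le> Suc (n - 1)" "vs 0 = n - 1" "Suc (n - 1) = n"
          using k_bounds by (auto simp: vs_def)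
        show "searching (n - 1) vs (arrs t3 PS) 1 0 (n - 1)"
          by (rule searching_root(1)[where r = "n - 1"]) (use low n in auto)
        show "todo (n - 1) vs (arrs t3 PS) 1 0 (n - 1) = trees"
        proof -
          have "todo (n - 1) vs (arrs t3 PS) 1 0 (n - 1) = {T \<in> trees. \<Union>T \<subseteq> {..<Suc (n - 1)}}"
            by (rule searching_root(2)[where r = "n - 1"]) (use low n in auto)
          then show ?thesis
            using all_trees unfolding n(4) by simp
        qed
      qed
      have "marks (verts vs 1) ((arrs t3 INL)(n - 1 := 1))"
        using t3(1) by (auto simp: marks_def verts_def vs_def lessThan_Suc)
      moreover have "n - 1 \<le> wmax" "cell 16 (n - 1) \<le> wmax" "0 \<le> wmax" "cell 16 0 \<le> wmax"
        by (simp_all add: fits(3,4))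
      ultimately have "wp START (\<lambda>t. ready t trees \<and> arrs t ORD = f \<and> line t = [] \<and> lines t = [] \<and> latest t = None) t3"
        using t3 nx root k_bounds by (simp add: START_def ready_def globals_def vs_def)
      then show ?case
      proof (rule wp_mono)
        fix t4
        assume t4: "ready t4 trees \<and> arrs t4 ORD = f \<and> line t4 = [] \<and> lines t4 = [] \<and> latest t4 = None"
        show "wp MAIN (\<lambda>t. line t = [] \<and> (\<exists>Ts. list_all2 describes (lines t) Ts \<and> distinct Ts \<and>
          set Ts = {T. tree {{u, v} | u v. E u v} k T})) t4"
        proof (rule wp_MAIN, goal_cases)
          case (8 t)
          then obtain Ts where Ts: "list_all2 (\<lambda>l T. describes l ((`) f ` T)) (lines t) Ts" "distinct Ts" "set Ts = trees"
            using t4 by (auto simp: listed_def)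
          have sub: "\<Union>edges \<subseteq> {..<n}"
            by (auto simp: edges_def)
          then have inj: "inj_on f (\<Union>edges)"
            using f(1) inj_on_subset by blast
          \<comment> \<open>An injection of a finite set into itself is onto, so every edge of the
            input is an edge between labels.\<close>
          have "f ` {..<n} = {..<n}"
            using f(1,2) by (intro endo_inj_surj) auto
          then have "\<exists>i<n. f i = u" if "u < n" for u
            using that by (metis imageE lessThan_iff)
          then have onto: "\<exists>i j. ?A i j \<and> u = f i \<and> v = f j" if "E u v" for u v
            using that E_less E_sym by metis
          have im: "(`) f ` edges = {{u, v} | u v. E u v}"
          proof (intro set_eqI iffI)
            fix e
            assume "e \<in> (`) f ` edges"
            then obtain i j where "e = f ` {i, j}" "?A i j"
              by (auto simp: edges_def)
            then show "e \<in> {{u, v} | u v. E u v}"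
              by auto
          next
            fix e
            assume "e \<in> {{u, v} | u v. E u v}"
            then obtain i j where "e = {f i, f j}" "?A i j"
              using onto by fast
            then have "e = f ` {i, j}" "{i, j} \<in> edges"
              by (auto simp: edges_def)
            then show "e \<in> (`) f ` edges"
              by blast
          qed
          have "inj_on ((`) ((`) f)) trees"
          proof (rule inj_onI)
            fix S T
            assume ST: "S \<in> trees" "T \<in> trees" "(`) f ` S = (`) f ` T"
            have "inj_on ((`) f) edges"
              using inj by (meson Union_upper inj_on_image_eq_iff inj_on_def)
            then show "S = T"
              using ST inj_on_image_eq_iff[of "(`) f" edges S T] by (auto simp: tree_def)
          qed
          then have "distinct (map ((`) ((`) f)) Ts)"
            using Ts by (simp add: distinct_map)
          moreover have "set (map ((`) ((`) f)) Ts) = {T. tree {{u, v} | u v. E u v} k T}"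
            using trees_image[OF inj, of k] Ts(3) unfolding im by simp
          moreover have "list_all2 describes (lines t) (map ((`) ((`) f)) Ts)"
            using Ts(1) by (simp add: list_all2_map2)
          ultimately show ?case
            using 8(1) by blast
        qed (use low gap t4 f in auto)
      qed
    qed (use t2 2 f in \<open>auto simp: f_def\<close>)
  qed (use 2 t1 in auto)
qed (use pre in auto)

end

text \<open>The last address in the input table, in cell \<open>2 + n\<close>, points just behind
  the adjacency lists. It is therefore the first free cell and becomes the base of the arrays, whose
  initial zeros are those of the memory.\<close>

lemma (in machine) simulates_start:
  assumes base: "inp (2 + inp 0) = base" "2 < base" "2 + inp 0 < base"
    and w: "16 \<le> wmax" "base \<le> wmax" "\<And>x. x < base \<Longrightarrow> inp x \<le> wmax"
    and s0: "pc s0 = 0" "reg s0 = (\<lambda>_. 0)" "\<And>x. mem s0 x = (if x < base then inp x else 0)"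
      "current s0 = []" "emitted s0 = []"
  shows "simulates program s0 6
    \<lparr>regs = (\<lambda>_. 0), arrs = (\<lambda>_ _. 0), line = [], lines = [], clock = 6, latest = None\<rparr>"
proof -
  have P: "i < 6 \<Longrightarrow> program ! i = [Const 3 0, Load 4 3, Const 3 2, Add 3 3 4, Load 2 3, Const 1 16] ! i"
    "6 \<le> length program" for i
    unfolding program_def by (simp_all only: nth_append) simp_all
  have step: "step program s = exec ([Const 3 0, Load 4 3, Const 3 2, Add 3 3 4, Load 2 3, Const 1 16] ! pc s) s"
    if "pc s < 6" for s
    using that P by (simp add: step_def halted_def)
  define m where "m = (\<lambda>t. run program s0 t)"
  have m: "m 0 = s0" "\<And>t. m (Suc t) = step program (m t)"
    by (auto simp: m_def run_def)
  have "0 < base" "inp (Suc (Suc (inp 0))) = base" "Suc (Suc (inp 0)) < base"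
    using base by simp_all
  note simps = this step set_reg_def s0 base
  have e: "m 1 = step program (m 0)" "m 2 = step program (m 1)" "m 3 = step program (m 2)"
    "m 4 = step program (m 3)" "m 5 = step program (m 4)" "m 6 = step program (m 5)"
    using m(2)[of 0] m(2)[of 1] m(2)[of 2] m(2)[of 3] m(2)[of 4] m(2)[of 5]
    by (simp_all add: eval_nat_numeral)
  have m1: "m 1 = s0\<lparr>pc := 1, reg := (\<lambda>_. 0)(3 := 0)\<rparr>"
    unfolding e(1) m(1) by (simp add: simps fun_upd_twist)
  have m2: "m 2 = s0\<lparr>pc := 2, reg := (\<lambda>_. 0)(3 := 0, 4 := inp 0)\<rparr>"
    unfolding e(2) m1 by (simp add: simps fun_upd_twist)
  have m3: "m 3 = s0\<lparr>pc := 3, reg := (\<lambda>_. 0)(3 := 2, 4 := inp 0)\<rparr>"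
    unfolding e(3) m2 by (simp add: simps fun_upd_twist)
  have m4: "m 4 = s0\<lparr>pc := 4, reg := (\<lambda>_. 0)(3 := 2 + inp 0, 4 := inp 0)\<rparr>"
    unfolding e(4) m3 by (simp add: simps fun_upd_twist)
  have m5: "m 5 = s0\<lparr>pc := 5, reg := (\<lambda>_. 0)(3 := 2 + inp 0, 4 := inp 0, 2 := base)\<rparr>"
    unfolding e(5) m4 by (simp add: simps fun_upd_twist)
  have m6: "m 6 = s0\<lparr>pc := 6, reg := (\<lambda>_. 0)(3 := 2 + inp 0, 4 := inp 0, 2 := base, 1 := 16)\<rparr>"
    unfolding e(6) m5 by (simp add: simps fun_upd_twist)
  have cases6: "t = 0 \<or> t = 1 \<or> t = 2 \<or> t = 3 \<or> t = 4 \<or> t = 5 \<or> t = 6" if "t \<le> 6" for t :: nat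
    using that by linarith
  have words: "reg (m t) a \<le> wmax \<and> mem (m t) a \<le> wmax" if "t \<le> 6" for t a
  proof -
    have le: "2 + inp 0 \<le> wmax" "inp 0 \<le> wmax" "2 \<le> wmax"
      using w(2) base(2,3) by auto
    have "mem (m t) = mem s0"
      using cases6[OF that] m(1) m1 m2 m3 m4 m5 m6 by auto
    moreover have "reg (m t) a \<le> wmax"
      using cases6[OF that] m(1) m1 m2 m3 m4 m5 m6 s0(2) le w(1,2) by auto
    ultimately show ?thesis
      using w(3) s0(3) by simp
  qed
  have silent: "\<not> emits_at program s0 t" if "t < 6" for t
  proof -
    have "pc (m t) = t"
      using cases6[of t] that m(1) m1 m2 m3 m4 m5 s0 by auto
    moreover have "program ! t \<noteq> Emit"
      using cases6[of t] that P by auto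
    ultimately show ?thesis
      by (simp add: emits_at_def m_def)
  qed
  show ?thesis
    unfolding simulates_def good_history_def represents_def
    using words silent s0 m6 by (auto simp: m_def[symmetric] fun_eq_iff)
qed

section \<open>Layout of the input\<close>

lemma nth_concat:
  assumes "v < length xss" "i < length (xss ! v)"
  shows "concat xss ! (length (concat (take v xss)) + i) = xss ! v ! i"
proof -
  have "concat xss = concat (take v xss) @ xss ! v @ concat (drop (Suc v) xss)"
    using assms(1) by (metis append_take_drop_id Cons_nth_drop_Suc concat_append concat.simps(2))
  then show ?thesis
    using assms(2) by (simp add: nth_append)
qed

lemma input_word_le:
  assumes V: "simple_graph V E" "adjacency_lists V E adj" "k \<le> card V" and x: "x \<in> set (input_words adj k)"
  shows "x \<le> length (input_words adj k)"
proof -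
  have Vn: "V = {..<length adj}"
    using V(2) by (simp add: adjacency_lists_def)
  have "u < length adj" if "v < length adj" "u \<in> set (adj ! v)" for u v
  proof -
    have "{v, u} \<in> E"
      using V(2) that by (simp add: adjacency_lists_def)
    then show ?thesis
      using V(1) Vn unfolding simple_graph_def by (fastforce simp: doubleton_eq_iff)
  qed
  then have "u < length adj" if "u \<in> set (concat adj)" for u
    using that by (auto simp: in_set_conv_nth[of _ adj])
  moreover have "length (concat (take v adj)) \<le> length (concat adj)" for v
    by (metis append_take_drop_id concat_append le_add1 length_append)
  ultimately show ?thesis
    using x V(3) Vn by (force simp: input_words_def less_imp_le intro: trans_le_add1)
qed

lemma graph_input_adjacency_lists:
  fixes V :: "nat set" and adj :: "nat list list" and k :: nat
  defines "inp \<equiv> \<lambda>a. if a < length (input_words adj k) then input_words adj k ! a else 0"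
  assumes V: "simple_graph V E" "connected_on V E" "adjacency_lists V E adj" and k: "2 \<le> k" "k \<le> card V"
  shows "graph_input inp (length (input_words adj k)) ((card V + card E) ^ 8) (card V) k
    (\<lambda>u v. {u, v} \<in> E) (\<lambda>v. 3 + length adj + length (concat (take v adj)))"
proof -
  define n where "n = length adj"
  let ?st = "\<lambda>v. 3 + length adj + length (concat (take v adj))"
  have Vn: "V = {..<n}" "card V = n"
    using V(3) by (auto simp: adjacency_lists_def n_def)
  have adj: "distinct (adj ! v)" "set (adj ! v) = {u. {v, u} \<in> E}" if "v < n" for v
    using V(3) that by (auto simp: adjacency_lists_def n_def)
  have E: "u < n \<and> u \<noteq> v" if "{u, v} \<in> E" for u v
    using V(1) that Vn unfolding simple_graph_def by (fastforce simp: doubleton_eq_iff)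
  have loop: "{u} \<notin> E" for u
    using E[of u u] by auto
  have len: "length (input_words adj k) = 3 + n + length (concat adj)"
    by (simp add: input_words_def n_def)
  have start: "inp (2 + v) = ?st v" if "v \<le> n" for v
    using that by (simp add: inp_def len input_words_def nth_append n_def del: upt_Suc)
  have mono: "?st v \<le> ?st w" if "v \<le> w" for v w
  proof -
    have "take w adj = take v adj @ take (w - v) (drop v adj)"
      using that by (metis le_add_diff_inverse take_add)
    then show ?thesis
      by simp
  qed
  have list: "inp ` {?st v..<?st (Suc v)} = {u. {v, u} \<in> E}" if v: "v < n" for v
  proof -
    have S: "?st (Suc v) = ?st v + length (adj ! v)"
      using v by (simp add: take_Suc_conv_app_nth n_def)
    have "inp (?st v + i) = adj ! v ! i" if i: "i < length (adj ! v)" for i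
    proof -
      have "?st v + i < 3 + n + length (concat adj)"
        using S i mono[of "Suc v" n] v by (simp add: n_def)
      then have "inp (?st v + i) = concat adj ! (length (concat (take v adj)) + i)"
        by (simp add: inp_def len) (simp add: input_words_def nth_append n_def del: upt_Suc)
      then show ?thesis
        using nth_concat[of v adj i] v i by (simp add: n_def)
    qed
    then have "(\<lambda>i. inp (?st v + i)) ` {0..<length (adj ! v)} = set (adj ! v)"
      by (auto simp: set_conv_nth image_iff)
    moreover have "{?st v..<?st (Suc v)} = (+) (?st v) ` {0..<length (adj ! v)}"
      unfolding S by (simp add: add.commute)
    ultimately show ?thesis
      using adj(2)[OF v] by (simp only: image_image)
  qed
  have "length (concat adj) \<le> n * n"
  proof -
    have "length (adj ! v) \<le> n" if "v < n" for v
    proof -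
      have "set (adj ! v) \<subseteq> {..<n}"
        using adj(2)[OF that] E by (auto simp: insert_commute)
      then show ?thesis
        using adj(1)[OF that] card_mono[of "{..<n}" "set (adj ! v)"] by (simp add: distinct_card)
    qed
    then have "sum_list (map length adj) \<le> sum_list (map (\<lambda>_. n) adj)"
      by (intro sum_list_mono) (auto simp: in_set_conv_nth n_def)
    then show ?thesis
      by (simp add: length_concat sum_list_triv n_def)
  qed
  then have "16 * (n * n) + length (input_words adj k) + 16 \<le> 17 * (n * n) + n + 19"
    by (simp add: len)
  also have "\<dots> \<le> 64 * n\<^sup>2"
  proof -
    have "2 \<le> n"
      using k Vn by simp
    then have "2 * n \<le> n * n" "4 \<le> n * n"
      using mult_le_mono[of 2 n 2 n] by auto
    then show ?thesis
      unfolding power2_eq_square by linarith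
  qed
  \<comment> \<open>The word bound has to be a pure power, so the factor 64 is absorbed by
    \<open>n ^ 6\<close>, using \<open>n \<ge> 2\<close>. This gives the exponent 8.\<close>
  also have "\<dots> \<le> n ^ 6 * n\<^sup>2"
    using power_mono[of 2 n 6] k Vn by (intro mult_le_mono1) simp
  also have "\<dots> = n ^ 8"
    by (simp add: power_add[symmetric])
  also have "\<dots> \<le> (card V + card E) ^ 8"
    using Vn by (intro power_mono) auto
  finally have room: "16 * (n * n) + length (input_words adj k) + 16 \<le> (card V + card E) ^ 8" .
  show ?thesis
  proof
    fix L
    assume "L \<subset> {..<card V}" "L \<noteq> {}"
    then obtain p u where "{p, u} \<in> E" "p \<in> L" "u \<notin> L"
      using connected_onD[OF V(2), of L] Vn by auto
    then show "\<exists>v u. {v, u} \<in> E \<and> v \<notin> L \<and> u \<in> L"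
      by (metis insert_commute)
  next
    show "inp 0 = card V" "inp 1 = k"
      using Vn by (simp_all add: inp_def len input_words_def n_def del: upt_Suc)
    show "machine.cell (length (input_words adj k)) 16 (card V * card V) \<le> (card V + card E) ^ 8"
      using room Vn by (simp add: machine.cell_def algebra_simps)
    show "?st v \<le> length (input_words adj k)" if "v \<le> card V" for v
      using mono[of v n] that Vn by (simp add: len n_def)
  qed (use Vn E loop start list k len in \<open>auto simp: insert_commute\<close>)
qed

theorem theorem3p4:
  "\<exists>(P :: instr list) (C :: nat) (c :: nat).
     \<forall>(V :: nat set) (E :: nat set set) (adj :: nat list list) (k :: nat).
       simple_graph V E \<and> connected_on V E \<and> adjacency_lists V E adj \<and> 2 \<le> k \<and> k \<le> card V \<longrightarrow>
         lists_exactly_once P (initial adj k) {T. k_subtree E k T} \<and>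
         delay_at_most P (initial adj k) (C * k\<^sup>2) \<and>
         words_at_most P (initial adj k) ((card V + card E) ^ c)"
proof (rule exI[of _ program], rule exI[of _ 2000], rule exI[of _ 8], intro allI impI, elim conjE)
  fix V :: "nat set" and E adj k
  assume V: "simple_graph V E" "connected_on V E" "adjacency_lists V E adj" and k: "2 \<le> k" "k \<le> card V"
  let ?inp = "\<lambda>a. if a < length (input_words adj k) then input_words adj k ! a else 0"
  let ?base = "length (input_words adj k)"
  let ?w = "(card V + card E) ^ 8"
  let ?gap = "2000 * k\<^sup>2"
  let ?init = "initial adj k"
  interpret graph_input ?inp ?base ?w ?gap "card V" k "\<lambda>u v. {u, v} \<in> E"
    "\<lambda>v. 3 + length adj + length (concat (take v adj))"
    using graph_input_adjacency_lists[OF V k] .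
  have n: "card V = length adj"
    using V(3) by (auto simp: adjacency_lists_def)
  let ?s0 = "\<lparr>regs = (\<lambda>_. 0), arrs = (\<lambda>_ _. 0), line = [], lines = [], clock = 6, latest = None\<rparr>"
  have "wp PROGRAM (\<lambda>t. line t = [] \<and> (\<exists>Ts. list_all2 describes (lines t) Ts \<and> distinct Ts \<and>
      set Ts = {T. tree {{u, v} | u v. {u, v} \<in> E} k T})) ?s0"
    by (rule wp_PROGRAM) auto
  then obtain t Ts where t: "ev PROGRAM ?s0 t" "line t = []"
    "list_all2 describes (lines t) Ts" "distinct Ts" "set Ts = {T. tree {{u, v} | u v. {u, v} \<in> E} k T}"
    unfolding wp_def by blast
  have base: "?base \<le> ?w" "16 \<le> ?w"
    using room by (simp_all add: cell_def)
  have "simulates program ?init 6 ?s0"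
  proof (rule simulates_start, goal_cases)
    case 1
    then show ?case
      using inp_start(1)[of "card V"] inp_n n by (simp add: input_words_def)
  next
    case (6 x)
    then have "input_words adj k ! x \<le> ?base"
      using V k by (intro input_word_le[of V E]) auto
    then show ?case
      using 6 base by simp
  qed (use base n_base inp_n in \<open>auto simp: initial_def\<close>)
  moreover have "code_at program 6 (compile 6 PROGRAM)"
    unfolding code_at_def program_def by (rule exI[of _ "[Const 3 0, Load 4 3, Const 3 2, Add 3 3 4, Load 2 3, Const 1 16]"]) simp
  ultimately have "simulates program ?init (6 + code_size PROGRAM) t"
    using compile_correct[OF t(1)] by blast
  moreover have "length program = 6 + code_size PROGRAM"
    by (simp add: program_def)
  ultimately have sim: "simulates program ?init (length program) t"
    by simp
  let ?t = "clock t"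
  have h: "halted program (run program ?init ?t)"
    using sim by (simp add: simulates_def halted_def)
  \<comment> \<open>A halted machine no longer changes, so the bounds known up to time
    \<open>?t\<close> hold for ever and nothing is emitted later.\<close>
  have stay: "run program ?init (?t + u) = run program ?init ?t" for u
    using h by (induction u) (auto simp: run_Suc step_def)
  have stay': "run program ?init u = run program ?init ?t" if "?t \<le> u" for u
    using stay[of "u - ?t"] that by simp
  have hist: "good_history program ?init ?t (latest t)"
    using sim by (simp add: simulates_def)
  have edges: "{{u, v} | u v. {u, v} \<in> E} = E"
  proof
    show "E \<subseteq> {{u, v} | u v. {u, v} \<in> E}"
    proof
      fix e
      assume "e \<in> E"
      moreover obtain u v where "e = {u, v}"
        using V(1) \<open>e \<in> E\<close> unfolding simple_graph_def by meson
      ultimately show "e \<in> {{u, v} | u v. {u, v} \<in> E}"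
        by auto
    qed
  qed auto
  have "current (run program ?init ?t) = []" "emitted (run program ?init ?t) = lines t"
    using sim t(2) by (simp_all add: simulates_def represents_def)
  moreover have "set Ts = {T. k_subtree E k T}"
    using t(5) unfolding edges k_subtree_iff_tree[OF k(1)] .
  ultimately have "lists_exactly_once program ?init {T. k_subtree E k T}"
    unfolding lists_exactly_once_def using h t(3,4) by metis
  moreover have "delay_at_most program ?init ?gap"
  proof -
    have "u < ?t" if "emits_at program ?init u" for u
      using that h stay'[of u] by (metis emits_at_def not_le)
    then show ?thesis
      using hist unfolding delay_at_most_def good_history_def by blast
  qed
  moreover have "words_at_most program ?init ?w"
    unfolding words_at_most_def
  proof (intro allI)
    fix u a
    show "reg (run program ?init u) a \<le> ?w \<and> mem (run program ?init u) a \<le> ?w"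
      using hist stay'[of u] unfolding good_history_def by (cases "u \<le> ?t") auto
  qed
  ultimately show "lists_exactly_once program ?init {T. k_subtree E k T} \<and> delay_at_most program ?init ?gap \<and>
      words_at_most program ?init ?w"
    by blast
qed

end
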